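(* Let $h_3^m=2^m-1$ for integers $m\ge 0$. The optimal move counts $a_n,b_n,c_n,d_n$ of the parity-constrained four-peg Tower of Hanoi satisfy $a_0=b_0=c_0=d_0=0$, $a_1=b_1=c_1=d_1=1$, and for all $n\ge 2$: \[ a_n=2b_{n-1}+1, \] \[ b_n=\begin{cases} c_{n-1}+h_3^{\lfloor (n-1)/2\rfloor}+1, & n \text{ even},\\ d_{n-1}+h_3^{\lfloor (n-1)/2\rfloor}+1, & n\text{ odd},\end{cases} \] \[ c_n=\begin{cases} b_{n-1}+h_3^{\lfloor (n-1)/2\rfloor}+1, & n \text{ even},\\ b_{n-2}+2h_3^{\lfloor (n-1)/2\rfloor}+h_3^{\lfloor (n-2)/2\rfloor}+2, & n\text{ odd},\end{cases} \] \[ d_n=\begin{cases} b_{n-2}+3h_3^{\lfloor (n-2)/2\rfloor}+2, & n \text{ even},\\ b_{n-1}+h_3^{\lfloor (n-1)/2\rfloor}+1, & n\text{ odd}.\end{cases} \]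
   Context: Parity-constrained four-peg Tower of Hanoi with $n$ discs labelled $1,\dots,n$ (disc $1$ smallest). There are four pegs $N_1,E,O,N_2$: $N_1,N_2$ are neutral (may hold any disc), $E$ may hold only even-labelled discs, $O$ only odd-labelled discs. A state places every disc on a peg compatible with its parity such that on every peg the discs increase from top to bottom. A legal move takes the top disc $d$ of a peg $p$ to a peg $q\ne p$ that is empty or whose top disc is larger than $d$, where both $p$ and $q$ are allowed for the parity of $d$ (odd discs: $N_1,N_2,O$; even discs: $N_1,N_2,E$). Starting from all discs on $N_1$: $a_n$ is the minimum number of legal moves to bring all discs to $N_2$; $b_n$ the minimum to reach all even discs on $E$ and all odd discs on $O$; $c_n$ the minimum to reach all odd discs on $O$ and all even discs on $N_2$; $d_n$ the minimum to reach all odd discs on $N_2$ and all even discs on $E$. *)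

theory Defs
  imports "HOL-Library.FuncSet" "HOL-Library.Extended_Nat"
begin

datatype peg = Neutral1 | EvenPeg | OddPeg | Neutral2

definition allowed_pegs :: "nat \<Rightarrow> peg set" where
  "allowed_pegs d = {Neutral1, Neutral2, if even d then EvenPeg else OddPeg}"

text \<open>A state records only the peg of each disc: the discs on a peg must increase from top to
  bottom, so their order on the peg is determined.  Functions are \<^const>\<open>undefined\<close> outside
  \<open>{1..n}\<close>, so distinct functions are distinct states.\<close>

definition states :: "nat \<Rightarrow> (nat \<Rightarrow> peg) set" where
  "states n = (\<Pi>\<^sub>E d\<in>{1..n}. allowed_pegs d)"

definition discs_on :: "nat \<Rightarrow> (nat \<Rightarrow> peg) \<Rightarrow> peg \<Rightarrow> nat set" where
  "discs_on n s p = {d \<in> {1..n}. s d = p}"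

text \<open>Meaningful only if peg \<open>p\<close> is nonempty.\<close>

definition top_disc :: "nat \<Rightarrow> (nat \<Rightarrow> peg) \<Rightarrow> peg \<Rightarrow> nat" where
  "top_disc n s p = Min (discs_on n s p)"

definition legal_moves :: "nat \<Rightarrow> ((nat \<Rightarrow> peg) \<times> (nat \<Rightarrow> peg)) set" where
  "legal_moves n = {(s, s(d := q)) | s d p q.
     s \<in> states n \<and> discs_on n s p \<noteq> {} \<and> d = top_disc n s p \<and>
     q \<noteq> p \<and> p \<in> allowed_pegs d \<and> q \<in> allowed_pegs d \<and>
     (discs_on n s q = {} \<or> d < top_disc n s q)}"

text \<open>The minimum is taken in \<^typ>\<open>enat\<close>: it is \<open>\<infinity>\<close> exactly if no sequence of legal moves leads
  from \<open>s\<close> to \<open>t\<close>, and otherwise it is attained.\<close>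

definition min_moves :: "nat \<Rightarrow> (nat \<Rightarrow> peg) \<Rightarrow> (nat \<Rightarrow> peg) \<Rightarrow> enat" where
  "min_moves n s t = (INF k \<in> {k. (s, t) \<in> legal_moves n ^^ k}. enat k)"

definition parity_state :: "nat \<Rightarrow> peg \<Rightarrow> peg \<Rightarrow> nat \<Rightarrow> peg" where
  "parity_state n p_odd p_even = (\<lambda>d\<in>{1..n}. if odd d then p_odd else p_even)"

definition start_state :: "nat \<Rightarrow> nat \<Rightarrow> peg" where
  "start_state n = parity_state n Neutral1 Neutral1"

definition a_count :: "nat \<Rightarrow> enat" where
  "a_count n = min_moves n (start_state n) (parity_state n Neutral2 Neutral2)"

definition b_count :: "nat \<Rightarrow> enat" where
  "b_count n = min_moves n (start_state n) (parity_state n OddPeg EvenPeg)"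

definition c_count :: "nat \<Rightarrow> enat" where
  "c_count n = min_moves n (start_state n) (parity_state n OddPeg Neutral2)"

definition d_count :: "nat \<Rightarrow> enat" where
  "d_count n = min_moves n (start_state n) (parity_state n Neutral2 EvenPeg)"

definition h3 :: "nat \<Rightarrow> nat" where
  "h3 m = 2 ^ m - 1"

end

theory Submission
  imports Defs
begin

text \<open>Forgetting the discs of one parity leaves an ordinary three-peg tower, so every passage of
  such a tower from one peg to another costs at least \<open>2 ^ k - 1\<close> of its own moves.  The parities
  interact when a disc \<open>d\<close> leaves the source for the first time.  If it goes to the other neutral
  peg, all smaller discs stand on their own pegs, which is the goal counted by \<open>b\<close> for \<open>d - 1\<close>
  discs.  If it goes to its own peg, the smaller discs of its parity stand on \<open>Neutral2\<close>, the
  others there or on their own peg.  Let \<open>j\<close> be the last disc that first goes to the neutral peg.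
  The induction bounds the moves before its departure by \<open>b (j - 1)\<close>, and adding the three-peg costs
  between the later departures gives the recurrences, the optimum having \<open>j\<close> close to \<open>n\<close>.

  This is slightly too weak in a single configuration (\<open>j\<close> odd, followed by three departures to own
  pegs, or by two when the goal has the parity class of \<open>n - 1\<close> on \<open>Neutral2\<close>).  There both towers
  have to pass the neutral pegs in both directions, and a case analysis of how the largest discs get
  out of each other's way yields a sufficient number of additional moves.  For \<open>a\<close>, unless disc \<open>n\<close>
  moves directly between the neutral pegs, the bounds are applied to the play and to its reversal.\<close>

subsection \<open>Parity classes and the moves of their discs\<close>

text \<open>The two parity classes are counted separately, each up to a departure of its own. This
  loses nothing until the growth of \<open>beta\<close> enters:
  \<open>beta (2 * u + 1) - beta (2 * u)\<close> may exceed \<open>2 ^ u\<close> (first 26 - 17 = 9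
  against 8), whereas the separate counts supply \<open>2 ^ u\<close>. In the critical configuration
  the discs below \<open>j\<close> number \<open>2 * u\<close>, and the excess is at most a quarter
  of \<open>2 ^ u\<close>, which is \<open>P = 2 ^ height (j - 3)\<close>. The analysis of the
  interference gains \<open>2 * P\<close>. This explains why it looks at exactly three discs below
  \<open>j\<close> and why the inequalities on \<open>beta\<close> are multiplied by 4.\<close>

definition own_peg :: "nat \<Rightarrow> peg" where
  "own_peg d = (if even d then EvenPeg else OddPeg)"

text \<open>The disc \<open>k\<close> itself is left out: \<open>tower k\<close> is what must stand
  on the third peg whenever \<open>k\<close> moves. The class that includes \<open>k\<close> is
  \<open>tower (Suc (Suc k))\<close>, and \<open>tower (Suc n)\<close> is the class of
  \<open>n - 1\<close>.\<close>

definition tower :: "nat \<Rightarrow> nat set" where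
  "tower k = {d. 1 \<le> d \<and> d < k \<and> (even d \<longleftrightarrow> even k)}"

text \<open>The number of discs in \<open>tower k\<close>.\<close>

definition height :: "nat \<Rightarrow> nat" where
  "height k = (k - 1) div 2"

text \<open>Only smaller discs are mentioned and there is no bound \<open>n\<close>, so a play of
  many discs is also a play of the first few.\<close>

definition moves_disc :: "nat \<Rightarrow> (nat \<Rightarrow> peg) \<Rightarrow> (nat \<Rightarrow> peg) \<Rightarrow> bool" where
  "moves_disc d s t \<longleftrightarrow> 1 \<le> d \<and> t = s(d := t d) \<and> t d \<noteq> s d \<and>
     s d \<in> allowed_pegs d \<and> t d \<in> allowed_pegs d \<and>
     (\<forall>e. 1 \<le> e \<and> e < d \<longrightarrow> s e \<noteq> s d \<and> s e \<noteq> t d)"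

lemma allowed_pegs_own: "allowed_pegs d = {Neutral1, Neutral2, own_peg d}"
  by (simp add: allowed_pegs_def own_peg_def)

lemma own_peg_neq [simp]: "own_peg d \<noteq> Neutral1" "own_peg d \<noteq> Neutral2"
    "Neutral1 \<noteq> own_peg d" "Neutral2 \<noteq> own_peg d"
  by (auto simp: own_peg_def)

lemma own_peg_tower: "e \<in> tower d \<Longrightarrow> own_peg e = own_peg d"
  by (auto simp: own_peg_def tower_def)

lemma tower_Suc_Suc: "1 \<le> k \<Longrightarrow> tower (Suc (Suc k)) = insert k (tower k)"
  by (auto simp: tower_def less_Suc_eq)

lemma third_peg_unique:
  assumes "x \<in> allowed_pegs k" "y \<in> allowed_pegs k" "u \<in> allowed_pegs k" "v \<in> allowed_pegs k"
    and "u \<noteq> v" "x \<noteq> u" "x \<noteq> v" "y \<noteq> u" "y \<noteq> v"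
  shows "x = y"
  using assms by (cases "even k") (auto simp: allowed_pegs_def)

lemma third_peg_exists:
  assumes "u \<in> allowed_pegs k" "v \<in> allowed_pegs k"
  shows "\<exists>x\<in>allowed_pegs k. x \<noteq> u \<and> x \<noteq> v"
  using assms by (cases "even k") (auto simp: allowed_pegs_def)

lemma tower_range:
  assumes "d \<in> tower k" "k \<le> n + 2"
  shows "1 \<le> d" "d \<le> n"
proof -
  have "1 \<le> d" "d < k" "k \<noteq> Suc d"
    using assms(1) by (auto simp: tower_def)
  then show "1 \<le> d" "d \<le> n"
    using assms(2) by linarith+
qed

lemma notin_tower: "k \<notin> tower k"
  by (simp add: tower_def)

lemma height_Suc_Suc: "1 \<le> k \<Longrightarrow> height (Suc (Suc k)) = height k + 1"
  by (simp add: height_def)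

section \<open>Counting the moves of a set of discs in a time interval\<close>

definition count_moves :: "(nat \<Rightarrow> nat) \<Rightarrow> nat set \<Rightarrow> nat \<Rightarrow> nat \<Rightarrow> nat" where
  "count_moves w S a b = card {i. a \<le> i \<and> i < b \<and> w i \<in> S}"

lemma count_moves_split:
  assumes "a \<le> b" "b \<le> c"
  shows "count_moves w S a c = count_moves w S a b + count_moves w S b c"
proof -
  have "{i. a \<le> i \<and> i < c \<and> w i \<in> S} = {i. a \<le> i \<and> i < b \<and> w i \<in> S} \<union> {i. b \<le> i \<and> i < c \<and> w i \<in> S}"
    using assms by auto
  moreover have "card ({i. a \<le> i \<and> i < b \<and> w i \<in> S} \<union> {i. b \<le> i \<and> i < c \<and> w i \<in> S}) =
      card {i. a \<le> i \<and> i < b \<and> w i \<in> S} + card {i. b \<le> i \<and> i < c \<and> w i \<in> S}"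
    by (rule card_Un_disjoint) auto
  ultimately show ?thesis
    by (simp add: count_moves_def)
qed

lemma count_moves_Un:
  assumes "S \<inter> S' = {}"
  shows "count_moves w (S \<union> S') a b = count_moves w S a b + count_moves w S' a b"
proof -
  have "{i. a \<le> i \<and> i < b \<and> w i \<in> S \<union> S'} = {i. a \<le> i \<and> i < b \<and> w i \<in> S} \<union> {i. a \<le> i \<and> i < b \<and> w i \<in> S'}"
    by auto
  moreover have "card ({i. a \<le> i \<and> i < b \<and> w i \<in> S} \<union> {i. a \<le> i \<and> i < b \<and> w i \<in> S'}) =
      card {i. a \<le> i \<and> i < b \<and> w i \<in> S} + card {i. a \<le> i \<and> i < b \<and> w i \<in> S'}"
    using assms by (intro card_Un_disjoint) auto
  ultimately show ?thesis
    by (simp add: count_moves_def)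
qed

lemma count_moves_mono: "S \<subseteq> S' \<Longrightarrow> count_moves w S a b \<le> count_moves w S' a b"
  unfolding count_moves_def by (intro card_mono) auto

lemma count_moves_mono2:
  assumes "S \<subseteq> S'" "a \<le> b"
  shows "count_moves w S 0 a \<le> count_moves w S' 0 b"
  using count_moves_mono[OF assms(1), of w 0 a] count_moves_split[of 0 a b w S'] assms(2) by simp

lemma count_moves_le: "count_moves w S a b \<le> b - a"
proof -
  have "card {i. a \<le> i \<and> i < b \<and> w i \<in> S} \<le> card {a..<b}"
    by (intro card_mono) auto
  then show ?thesis
    by (simp add: count_moves_def)
qed

lemma count_moves_ge_1:
  assumes "a \<le> i" "i < b" "w i = d"
  shows "1 \<le> count_moves w {d} a b"
proof -
  have "card {i} \<le> card {i. a \<le> i \<and> i < b \<and> w i \<in> {d}}"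
    using assms by (intro card_mono) auto
  then show ?thesis
    by (simp add: count_moves_def)
qed

lemma count_moves_ge_2:
  assumes "a \<le> i" "i < j" "j < b" "w i = d" "w j = d"
  shows "2 \<le> count_moves w {d} a b"
proof -
  have "card {i, j} \<le> card {i. a \<le> i \<and> i < b \<and> w i \<in> {d}}"
    using assms by (intro card_mono) auto
  then show ?thesis
    using assms by (simp add: count_moves_def)
qed

lemma count_moves_tower_Suc_Suc:
  "1 \<le> k \<Longrightarrow> count_moves w (tower (Suc (Suc k))) a b = count_moves w (tower k) a b + count_moves w {k} a b"
  using count_moves_Un[of "tower k" "{k}" w a b] notin_tower[of k]
  by (simp add: tower_Suc_Suc)

lemma first_switch:
  fixes a b :: nat
  assumes "a \<le> b" "P a" "\<not> P b"
  obtains i where "a \<le> i" "i < b" "P i" "\<not> P (Suc i)" "\<And>c. a \<le> c \<Longrightarrow> c \<le> i \<Longrightarrow> P c"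
proof -
  define j where "j = (LEAST c. a \<le> c \<and> \<not> P c)"
  have j: "a \<le> j \<and> \<not> P j"
    unfolding j_def by (rule LeastI[of _ b]) (use assms in auto)
  have least: "P c" if "a \<le> c" "c < j" for c
    using that not_less_Least[of c "\<lambda>c. a \<le> c \<and> \<not> P c"] by (auto simp: j_def)
  have "j \<le> b"
    unfolding j_def by (rule Least_le) (use assms in auto)
  have "j \<noteq> a"
    using j assms by auto
  then obtain i where i: "j = Suc i" "a \<le> i"
    using j by (metis le_SucE not0_implies_Suc le_0_eq)
  show ?thesis
    by (rule that[of i]) (use i j least \<open>j \<le> b\<close> in auto)
qed

lemma last_switch:
  fixes a b :: nat
  assumes "a \<le> b" "P a" "\<not> P b"
  obtains i where "a \<le> i" "i < b" "P i" "\<not> P (Suc i)" "\<And>c. i < c \<Longrightarrow> c \<le> b \<Longrightarrow> \<not> P c"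
proof -
  define i where "i = (GREATEST c. c \<le> b \<and> P c)"
  have i: "i \<le> b \<and> P i"
    unfolding i_def by (rule GreatestI_nat[of _ a b]) (use assms in auto)
  have greatest: "\<not> P c" if "i < c" "c \<le> b" for c
    using that Greatest_le_nat[of "\<lambda>c. c \<le> b \<and> P c" c b] by (auto simp: i_def)
  have "a \<le> i"
    unfolding i_def by (rule Greatest_le_nat[of _ _ b]) (use assms in auto)
  moreover have "i < b"
    using i assms by (metis order_le_less)
  ultimately show ?thesis
    using that[of i] i greatest by simp
qed

subsection \<open>Plays\<close>

text \<open>A play is an infinite sequence of states; \<open>w i\<close> is the disc moved at time \<open>i\<close>, and
  \<open>w i = 0\<close> means that nothing is moved.\<close>

locale play =
  fixes s :: "nat \<Rightarrow> nat \<Rightarrow> peg" and w :: "nat \<Rightarrow> nat"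
  assumes allowed_0: "1 \<le> d \<Longrightarrow> s 0 d \<in> allowed_pegs d"
    and idle: "w i = 0 \<Longrightarrow> s (Suc i) = s i"
    and active: "1 \<le> w i \<Longrightarrow> moves_disc (w i) (s i) (s (Suc i))"
begin

lemma unchanged: "w i \<noteq> d \<Longrightarrow> s (Suc i) d = s i d"
  using idle[of i] active[of i] unfolding moves_disc_def
  by (cases "w i = 0") (simp, metis One_nat_def Suc_leI fun_upd_apply neq0_conv)

lemma allowed: "1 \<le> d \<Longrightarrow> s i d \<in> allowed_pegs d"
proof (induction i)
  case 0
  then show ?case
    using allowed_0 by simp
next
  case (Suc i)
  then show ?case
    using unchanged[of i d] active[of i] by (cases "w i = d") (auto simp: moves_disc_def)
qed

lemma moves_neq: "w i = d \<Longrightarrow> 1 \<le> d \<Longrightarrow> s (Suc i) d \<noteq> s i d"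
  using active[of i] by (auto simp: moves_disc_def)

lemma moves_clear:
  assumes "w i = d" "1 \<le> e" "e < d"
  shows "s i e \<noteq> s i d" "s i e \<noteq> s (Suc i) d"
  using active[of i] assms by (auto simp: moves_disc_def)

lemma neq_imp_moves: "s (Suc i) d \<noteq> s i d \<Longrightarrow> w i = d"
  using unchanged by blast

lemma first_exit:
  assumes "a \<le> b" "s a d = x" "s b d \<noteq> x"
  shows "\<exists>i. a \<le> i \<and> i < b \<and> w i = d \<and> s i d = x \<and> s (Suc i) d \<noteq> x \<and> (\<forall>c. a \<le> c \<and> c \<le> i \<longrightarrow> s c d = x)"
proof -
  obtain i where "a \<le> i" "i < b" "s i d = x" "s (Suc i) d \<noteq> x" "(\<forall>c. a \<le> c \<and> c \<le> i \<longrightarrow> s c d = x)"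
    by (rule first_switch[of a b "\<lambda>c. s c d = x"]) (use assms in auto)
  then show ?thesis
    using neq_imp_moves[of i d] by metis
qed

lemma last_exit:
  assumes "a \<le> b" "s a d = x" "s b d \<noteq> x"
  shows "\<exists>i. a \<le> i \<and> i < b \<and> w i = d \<and> s i d = x \<and> s (Suc i) d \<noteq> x \<and> (\<forall>c. i < c \<and> c \<le> b \<longrightarrow> s c d \<noteq> x)"
proof -
  obtain i where "a \<le> i" "i < b" "s i d = x" "s (Suc i) d \<noteq> x" "(\<forall>c. i < c \<and> c \<le> b \<longrightarrow> s c d \<noteq> x)"
    by (rule last_switch[of a b "\<lambda>c. s c d = x"]) (use assms in auto)
  then show ?thesis
    using neq_imp_moves[of i d] by metis
qed

lemma last_entry:
  assumes "a \<le> b" "s a d \<noteq> x" "s b d = x"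
  shows "\<exists>i. a \<le> i \<and> i < b \<and> w i = d \<and> s i d \<noteq> x \<and> s (Suc i) d = x \<and> (\<forall>c. i < c \<and> c \<le> b \<longrightarrow> s c d = x)"
proof -
  obtain i where "a \<le> i" "i < b" "s i d \<noteq> x" "s (Suc i) d = x" "(\<forall>c. i < c \<and> c \<le> b \<longrightarrow> s c d = x)"
    by (rule last_switch[of a b "\<lambda>c. s c d \<noteq> x"]) (use assms in auto)
  then show ?thesis
    using neq_imp_moves[of i d] by metis
qed

section \<open>Positions of towers and three-peg lower bounds\<close>

definition on :: "nat \<Rightarrow> nat \<Rightarrow> peg \<Rightarrow> bool" where
  "on k i x \<longleftrightarrow> (\<forall>d\<in>tower k. s i d = x)"

lemma onD: "on k i x \<Longrightarrow> d \<in> tower k \<Longrightarrow> s i d = x"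
  by (simp add: on_def)

lemma on_Suc_Suc: "1 \<le> k \<Longrightarrow> on (Suc (Suc k)) i x \<longleftrightarrow> on k i x \<and> s i k = x"
  by (auto simp: on_def tower_Suc_Suc)

lemma on_Suc: "w i = k \<Longrightarrow> on k (Suc i) x \<longleftrightarrow> on k i x"
  using unchanged[of i] by (auto simp: on_def tower_def)

text \<open>The discs of the tower have to avoid both pegs involved in the move, and each parity has
  only three pegs.\<close>

lemma on_third:
  assumes "w i = k" "1 \<le> k" "x \<in> allowed_pegs k" "x \<noteq> s i k" "x \<noteq> s (Suc i) k"
  shows "on k i x"
  unfolding on_def
proof
  fix e assume e: "e \<in> tower k"
  then have "1 \<le> e" "e < k"
    by (auto simp: tower_def)
  then have "s i e \<noteq> s i k" "s i e \<noteq> s (Suc i) k" "s i e \<in> allowed_pegs k"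
    using moves_clear[OF assms(1)] allowed[of e i] own_peg_tower[OF e] by (auto simp: allowed_pegs_own)
  then show "s i e = x"
    using third_peg_unique[of "s i e" k x "s i k" "s (Suc i) k"] assms moves_neq[OF assms(1,2)]
      allowed[OF assms(2)] by metis
qed

lemma third:
  assumes "w i = k" "1 \<le> k"
  shows "\<exists>y. on k i y \<and> y \<noteq> s i k \<and> y \<noteq> s (Suc i) k"
  using third_peg_exists[OF allowed allowed, OF assms(2) assms(2), of i "Suc i"] on_third[OF assms]
  by blast

text \<open>This is where one parity constrains the other: the neutral pegs are exactly the shared
  ones, and if both must be clear of smaller discs, each of these has only its own peg left.\<close>

lemma neutral_move:
  assumes "w i = d" "s i d \<noteq> own_peg d" "s (Suc i) d \<noteq> own_peg d" "1 \<le> e" "e < d"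
  shows "s i e = own_peg e"
proof -
  have "1 \<le> d"
    using assms by simp
  then have "s i d \<in> {Neutral1, Neutral2}" "s (Suc i) d \<in> {Neutral1, Neutral2}" "s (Suc i) d \<noteq> s i d"
    using allowed[of d i] allowed[of d "Suc i"] moves_neq[OF assms(1)] assms(2,3)
    by (auto simp: allowed_pegs_own)
  then show ?thesis
    using moves_clear[OF assms(1,4,5)] allowed[OF assms(4), of i] by (auto simp: allowed_pegs_own)
qed

text \<open>The bound \<open>k \<le> d + 1\<close> includes \<open>k = d + 1\<close>, that is, all
  smaller discs of the other parity.\<close>

lemma neutral_move_on:
  assumes "w i = d" "s i d \<noteq> own_peg d" "s (Suc i) d \<noteq> own_peg d" "k \<le> d + 1"
  shows "on k i (own_peg k)"
  unfolding on_def
proof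
  fix e assume e: "e \<in> tower k"
  show "s i e = own_peg k"
  proof (cases "e = d")
    case True
    then have "k = Suc d"
      using e assms(4) by (simp add: tower_def)
    then show ?thesis
      using e True by (simp add: tower_def)
  next
    case False
    then show ?thesis
      using neutral_move[OF assms(1-3), of e] e assms(4) own_peg_tower[OF e] by (auto simp: tower_def)
  qed
qed

text \<open>The classical argument: when the largest disc first leaves \<open>x\<close>, and again
  when it last enters \<open>y\<close>, the smaller ones are on a third peg, so they make one
  passage before and one after. The summand 1 avoids a subtraction.\<close>

lemma tower_cost:
  assumes "a \<le> b" "on k a x" "on k b y" "x \<noteq> y"
  shows "2 ^ height k \<le> count_moves w (tower k) a b + 1"
  using assms
proof (induction k arbitrary: a b x y rule: less_induct)
  case (less k)
  show ?case
  proof (cases "k \<le> 2")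
    case True
    then show ?thesis by (auto simp: height_def)
  next
    case False
    define d where "d = k - 2"
    have d: "1 \<le> d" "k = Suc (Suc d)" "d < k"
      using False by (auto simp: d_def)
    have ends: "on d a x" "s a d = x" "on d b y" "s b d = y"
      using less.prems d by (auto simp: on_Suc_Suc)
    obtain i where i: "a \<le> i" "i < b" "w i = d" "s i d = x" "\<forall>c. a \<le> c \<and> c \<le> i \<longrightarrow> s c d = x"
      using first_exit[OF less.prems(1) ends(2)] ends(4) less.prems(4) by metis
    obtain i' where i': "a \<le> i'" "i' < b" "w i' = d" "s (Suc i') d = y"
      using last_entry[OF less.prems(1) _ ends(4)] ends(2) less.prems(4) by metis
    have "i \<le> i'"
    proof (rule ccontr)
      assume "\<not> i \<le> i'"
      then have "s (Suc i') d = x"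
        using i(5) i'(1) by simp
      then show False
        using i'(4) less.prems(4) by simp
    qed
    obtain v where v: "on d i v" "v \<noteq> x"
      using third[OF i(3) d(1)] i(4) by metis
    obtain v' where v': "on d i' v'" "v' \<noteq> y"
      using third[OF i'(3) d(1)] i'(4) by metis
    have "2 ^ height d \<le> count_moves w (tower d) a i + 1"
      using less.IH[OF d(3) i(1) ends(1) v(1)] v(2) by auto
    moreover have "2 ^ height d \<le> count_moves w (tower d) i' b + 1"
      using less.IH[OF d(3) _ v'(1) ends(3) v'(2)] i' by auto
    moreover have "count_moves w (tower d) a b = count_moves w (tower d) a i +
        count_moves w (tower d) i i' + count_moves w (tower d) i' b"
      using count_moves_split[of a i b] count_moves_split[of i i' b] i i' \<open>i \<le> i'\<close> by simp
    moreover have "1 \<le> count_moves w {d} a b"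
      by (rule count_moves_ge_1[of a i b w d]) (use i in auto)
    moreover have "(2::nat) ^ height k = 2 * 2 ^ height d"
      using d height_Suc_Suc by simp
    ultimately show ?thesis
      using count_moves_tower_Suc_Suc[OF d(1), of w a b] d(2) by simp
  qed
qed

lemma tower_cost2:
  assumes "a \<le> b" "b \<le> c" "on k a x" "on k b y" "on k c z" "x \<noteq> y" "y \<noteq> z"
  shows "2 * 2 ^ height k \<le> count_moves w (tower k) a c + 2"
  using tower_cost[OF assms(1,3,4,6)] tower_cost[OF assms(2,4,5,7)] count_moves_split[OF assms(1,2), of w "tower k"]
  by simp

lemma tower_cost3:
  assumes "a \<le> b" "b \<le> c" "c \<le> d" "on k a x" "on k b y" "on k c z" "on k d v" "x \<noteq> y" "y \<noteq> z" "z \<noteq> v"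
  shows "3 * 2 ^ height k \<le> count_moves w (tower k) a d + 3"
  using tower_cost2[OF assms(1,2,4,5,6,8,9)] tower_cost[OF assms(3,6,7,10)]
    count_moves_split[of a c d w "tower k"] assms by simp

text \<open>Disc \<open>k\<close> can enter \<open>x\<close> only while its tower is elsewhere, so
  the tower leaves \<open>x\<close> and comes back.\<close>

lemma return_cost:
  assumes "1 \<le> k" "a \<le> b" "on k a x" "on k b x" "s a k \<noteq> x" "s b k = x"
  shows "2 * 2 ^ height k \<le> count_moves w (tower (Suc (Suc k))) a b + 1"
proof -
  obtain i where i: "a \<le> i" "i < b" "w i = k" "s (Suc i) k = x"
    using last_entry[OF assms(2,5,6)] by blast
  obtain y where y: "on k i y" "y \<noteq> x"
    using third[OF i(3) assms(1)] i(4) by blast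
  have "2 * 2 ^ height k \<le> count_moves w (tower k) a b + 2"
    using tower_cost2[OF i(1) less_imp_le[OF i(2)] assms(3) y(1) assms(4)] y(2) by simp
  moreover have "1 \<le> count_moves w {k} a b"
    by (rule count_moves_ge_1[OF i(1,2), where w = w]) (rule i(3))
  ultimately show ?thesis
    using count_moves_tower_Suc_Suc[OF assms(1), of w a b] by simp
qed

text \<open>As in \<open>return_cost\<close>, but disc \<open>k\<close> leaves \<open>x\<close> as
  well and so moves at least twice.\<close>

lemma detour_cost:
  assumes "1 \<le> k" "a \<le> c" "c \<le> b" "on k a x" "on k b x" "s a k = x" "s b k = x" "s c k \<noteq> x"
  shows "2 * 2 ^ height k \<le> count_moves w (tower (Suc (Suc k))) a b"
proof -
  obtain i where i: "a \<le> i" "i < c" "w i = k" "s i k = x"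
    using first_exit[OF assms(2,6,8)] by blast
  obtain i' where i': "c \<le> i'" "i' < b" "w i' = k"
    using last_entry[OF assms(3,8,7)] by blast
  obtain y where y: "on k i y" "y \<noteq> x"
    using third[OF i(3) assms(1)] i(4) by blast
  have "2 * 2 ^ height k \<le> count_moves w (tower k) a b + 2"
    using tower_cost2[OF i(1) _ assms(4) y(1) assms(5)] y(2) i(2) assms(3) by simp
  moreover have "2 \<le> count_moves w {k} a b"
    by (rule count_moves_ge_2[of a i i' b]) (use i i' in auto)
  ultimately show ?thesis
    using count_moves_tower_Suc_Suc[OF assms(1), of w a b] by simp
qed

end

subsection \<open>Interference of the two parity classes\<close>

text \<open>Here \<open>j\<close> is odd, \<open>k = j + 1\<close>, and \<open>m\<close>, \<open>l\<close>, \<open>q\<close> are the three discs below \<open>j\<close>.  Disc \<open>j\<close> has just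
  left the source for \<open>Neutral2\<close> at time \<open>t0\<close>, disc \<open>k\<close> has just left it for its own peg at time \<open>t1\<close>, and
  disc \<open>k + 1\<close> is about to leave it at time \<open>t2\<close>.  With \<open>P = 2 ^ height q\<close> the three-peg bounds give
  \<open>A + B + C + 3 \<ge> 20 * P\<close>; they treat the parity classes as independent.\<close>

locale congestion = play +
  fixes q l m j k t0 t1 t2 t3 e :: nat
  assumes q: "even q" "2 \<le> q"
    and discs: "l = Suc q" "m = Suc (Suc q)" "j = Suc (Suc l)" "k = Suc (Suc m)"
    and times: "t0 \<le> t1" "t1 \<le> t2" "t2 \<le> t3" "t3 \<le> e"
    and at_t0: "on j t0 OddPeg" "s t0 j = Neutral2"
    and at_t1: "on k t1 Neutral2" "s t1 k = EvenPeg" "s t1 j \<noteq> Neutral1"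
    and at_t2: "on j t2 Neutral2" "s t2 j = Neutral2" "s t2 m \<noteq> Neutral1" "s t2 k \<noteq> Neutral1"
    and at_t3: "on k t3 Neutral2" "s t3 k = Neutral2"
    and at_e: "on j e OddPeg" "s e j = OddPeg"
begin

abbreviation "A \<equiv> count_moves w (tower (Suc (Suc k))) t1 t3"
abbreviation "B \<equiv> count_moves w (tower j) t0 t2"
abbreviation "C \<equiv> count_moves w (tower (Suc (Suc j))) t2 e"
abbreviation "P \<equiv> (2 :: nat) ^ height q"

lemma own_pegs [simp]:
  "own_peg q = EvenPeg" "own_peg m = EvenPeg" "own_peg k = EvenPeg" "own_peg l = OddPeg" "own_peg j = OddPeg"
  using q by (auto simp: own_peg_def discs)

lemma disc_pos: "1 \<le> q" "1 \<le> l" "1 \<le> m" "1 \<le> j" "1 \<le> k"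
  using q by (auto simp: discs)

lemma heights: "2 ^ height l = 2 * P" "2 ^ height m = 2 * P" "2 ^ height j = 4 * P" "2 ^ height k = 4 * P"
proof -
  have "height l = Suc (height q)" "height m = Suc (height q)"
    using q by (auto simp: height_def discs elim!: evenE)
  moreover have "height j = Suc (height l)" "height k = Suc (height m)"
    using disc_pos by (auto simp: discs(3,4) height_Suc_Suc)
  ultimately show "2 ^ height l = 2 * P" "2 ^ height m = 2 * P" "2 ^ height j = 4 * P" "2 ^ height k = 4 * P"
    by simp_all
qed

lemma on_m: "on m i x \<longleftrightarrow> on q i x \<and> s i q = x"
  and on_j: "on j i x \<longleftrightarrow> on l i x \<and> s i l = x"
  and on_k: "on k i x \<longleftrightarrow> on m i x \<and> s i m = x"
  using disc_pos by (simp_all only: discs(2-4) on_Suc_Suc)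

lemma count_j: "count_moves w (tower j) a b = count_moves w (tower l) a b + count_moves w {l} a b"
  and count_k: "count_moves w (tower k) a b = count_moves w (tower m) a b + count_moves w {m} a b"
  using disc_pos by (simp_all only: discs(2-4) count_moves_tower_Suc_Suc)

lemma count_A: "count_moves w (tower (Suc (Suc k))) a b = count_moves w (tower k) a b + count_moves w {k} a b"
  and count_C: "count_moves w (tower (Suc (Suc j))) a b = count_moves w (tower j) a b + count_moves w {j} a b"
  using disc_pos by (simp_all only: count_moves_tower_Suc_Suc)

lemma base: "8 * P \<le> A + 1" "4 * P \<le> B + 1" "8 * P \<le> C + 1"
proof -
  show "8 * P \<le> A + 1"
    using return_cost[of k t1 t3 Neutral2] disc_pos at_t1 at_t3 times heights by simp
  show "4 * P \<le> B + 1"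
    using tower_cost[of t0 t2 j OddPeg Neutral2] at_t0 at_t2 times heights by simp
  have "8 * P = 2 ^ height (Suc (Suc j))"
    using height_Suc_Suc[of j] disc_pos heights by simp
  moreover have "on (Suc (Suc j)) t2 Neutral2" "on (Suc (Suc j)) e OddPeg"
    using at_t2 at_e disc_pos by (simp_all add: on_Suc_Suc)
  ultimately show "8 * P \<le> C + 1"
    using tower_cost[of t2 e "Suc (Suc j)" Neutral2 OddPeg] times by simp
qed

lemma one_le_P: "1 \<le> P"
  by simp

text \<open>A surplus of \<open>2 * P\<close> in one of the three counts over its minimum in
  \<open>base\<close> is enough, so each case below looks for only one.\<close>

lemma extra:
  assumes "10 * P \<le> A + 1 \<or> 6 * P \<le> B + 1 \<or> 10 * P \<le> C + 1"
  shows "22 * P \<le> A + B + C + 3"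
  using assms base by linarith

text \<open>Disc \<open>j\<close> enters \<open>OddPeg\<close> only while its tower is elsewhere.
  The tower therefore leaves \<open>OddPeg\<close>, is back at \<open>x\<close>, and still has to
  reach \<open>Neutral2\<close>: three passages instead of one.\<close>

lemma entry_own_before_t2:
  assumes "t0 \<le> c" "c \<le> x" "x \<le> t2" "s c j = OddPeg" "on j x OddPeg"
  shows "22 * P \<le> A + B + C + 3"
proof -
  obtain i where i: "t0 \<le> i" "i < c" "w i = j" "s (Suc i) j = OddPeg"
    using last_entry[OF assms(1) _ assms(4)] at_t0 by auto
  obtain y where y: "on j i y" "y \<noteq> OddPeg"
    using third[OF i(3) disc_pos(4)] i(4) by metis
  have "3 * 2 ^ height j \<le> B + 3"
    using tower_cost3[of t0 i x t2 j OddPeg y OddPeg Neutral2] i y assms at_t0 at_t2 by simp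
  then show ?thesis
    using extra heights one_le_P by linarith
qed

lemma disc_order: "q < l" "l < m" "m < j" "j < k" "k \<le> j + 1" "j \<le> m + 1" "m \<le> l + 1"
  by (simp_all add: discs)

lemma pegs:
  "s i q \<in> {Neutral1, Neutral2, EvenPeg}" "s i m \<in> {Neutral1, Neutral2, EvenPeg}"
  "s i k \<in> {Neutral1, Neutral2, EvenPeg}"
  "s i l \<in> {Neutral1, Neutral2, OddPeg}" "s i j \<in> {Neutral1, Neutral2, OddPeg}"
  using allowed[OF disc_pos(1), of i] allowed[OF disc_pos(2), of i] allowed[OF disc_pos(3), of i]
    allowed[OF disc_pos(4), of i] allowed[OF disc_pos(5), of i]
  by (auto simp: allowed_pegs_own)

lemma allowed_sets:
  "allowed_pegs q = {Neutral1, Neutral2, EvenPeg}" "allowed_pegs m = {Neutral1, Neutral2, EvenPeg}"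
  "allowed_pegs k = {Neutral1, Neutral2, EvenPeg}"
  "allowed_pegs l = {Neutral1, Neutral2, OddPeg}" "allowed_pegs j = {Neutral1, Neutral2, OddPeg}"
  by (simp_all add: allowed_pegs_own)

text \<open>Disc \<open>k\<close> lands on \<open>Neutral2\<close> only if the smaller disc
  \<open>j\<close> is absent, yet \<open>j\<close> is there at \<open>t2\<close>. The return of
  \<open>j\<close> forces additional passages of its tower or of the tower of
  \<open>k\<close>.\<close>

lemma k_enters_before_t2:
  assumes i: "t1 \<le> i" "i < t2" "w i = k" "s (Suc i) k = Neutral2"
  shows "22 * P \<le> A + B + C + 3"
proof -
  have "s i j \<noteq> Neutral2"
    using moves_clear(2)[OF i(3) disc_pos(4)] i(4) disc_order by simp
  then obtain x where x: "i \<le> x" "x < t2" "w x = j" "s x j \<noteq> Neutral2" "s (Suc x) j = Neutral2"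
    using last_entry[of i t2 j Neutral2] at_t2(2) i(2) by auto
  consider "s x j = OddPeg" | "s x j = Neutral1"
    using pegs(5)[of x] x(4) by auto
  then show ?thesis
  proof cases
    case 1
    then have "on j x Neutral1"
      using on_third[OF x(3) disc_pos(4), of Neutral1] x allowed_sets by simp
    then have "2 * 2 ^ height j \<le> B + 2"
      using tower_cost2[of t0 x t2 j OddPeg Neutral1 Neutral2] at_t0 at_t2 times i x by simp
    then show ?thesis
      using extra heights one_le_P by linarith
  next
    case 2
    have on_x: "on j x OddPeg"
      using neutral_move_on[OF x(3), of j] 2 x(5) by simp
    show ?thesis
    proof (cases "\<exists>c. t0 \<le> c \<and> c \<le> x \<and> s c j = OddPeg")
      case True
      then show ?thesis
        using entry_own_before_t2[of _ x] on_x x by auto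
    next
      case False
      then have never: "s c j \<noteq> OddPeg" if "t0 \<le> c" "c \<le> x" for c
        using that by blast
      have t1: "s t1 j = Neutral2"
        using pegs(5)[of t1] at_t1(3) never[of t1] times i x by auto
      have i_j: "s i j \<noteq> OddPeg"
        using never[of i] times i x by simp
      have "s i k = EvenPeg"
      proof (rule ccontr)
        assume "s i k \<noteq> EvenPeg"
        then have "s i j = own_peg j"
          using neutral_move[OF i(3), of j] i(4) disc_order(4) disc_pos(4) by simp
        then show False
          using i_j by simp
      qed
      then have on_i: "on k i Neutral1"
        using on_third[OF i(3) disc_pos(5), of Neutral1] i(4) allowed_sets by simp
      \<comment> \<open>Disc \<open>j\<close> has used the neutral pegs only. When it leaves
        \<open>Neutral2\<close> at \<open>c\<close>, the tower of \<open>k\<close> is on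
        \<open>EvenPeg\<close>; at \<open>i\<close> it is on \<open>Neutral1\<close>. It thus makes
        three passages between \<open>t1\<close> and \<open>t3\<close>.\<close>
      obtain c where c: "t1 \<le> c" "c < i" "w c = j" "s c j = Neutral2" "s (Suc c) j \<noteq> Neutral2"
        using first_exit[OF i(1) t1 \<open>s i j \<noteq> Neutral2\<close>] by auto
      have "on k c EvenPeg"
        using neutral_move_on[OF c(3), of k] c never[of "Suc c"] times x disc_order by simp
      then have "3 * 2 ^ height k \<le> count_moves w (tower k) t1 t3 + 3"
        using tower_cost3[of t1 c i t3 k Neutral2 EvenPeg Neutral1 Neutral2] on_i at_t1 at_t3 times c i by simp
      moreover have "1 \<le> count_moves w {k} t1 t3"
        by (rule count_moves_ge_1[of t1 i t3]) (use i times in auto)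
      ultimately show ?thesis
        using extra heights one_le_P count_A[of t1 t3] by linarith
    qed
  qed
qed

text \<open>The entry requires disc \<open>m\<close> on \<open>Neutral1\<close>, where it is not at
  \<open>t2\<close>. Its way there costs either three passages of its own tower before
  \<open>i\<close> or three passages of the tower of \<open>j\<close> after
  \<open>t2\<close>.\<close>

lemma k_enters_from_own_peg:
  assumes i: "t2 \<le> i" "i < t3" "w i = k" "s (Suc i) k = Neutral2" "s i k = EvenPeg"
  shows "22 * P \<le> A + B + C + 3"
proof -
  have on_i: "on k i Neutral1"
    using on_third[OF i(3) disc_pos(5), of Neutral1] i allowed_sets by simp
  then have i_m: "on m i Neutral1" "s i m = Neutral1"
    by (simp_all add: on_k)
  have t1_m: "on m t1 Neutral2" "s t1 m = Neutral2"
    using at_t1 by (simp_all add: on_k)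
  have A: "A \<ge> count_moves w (tower m) t1 i + count_moves w {m} t1 i + 4 * P"
  proof -
    have "4 * P \<le> count_moves w (tower k) i t3 + 1"
      using tower_cost[of i t3 k Neutral1 Neutral2] on_i at_t3 i heights by simp
    moreover have "1 \<le> count_moves w {k} t1 t3"
      by (rule count_moves_ge_1[of t1 i t3]) (use i times in auto)
    moreover have "count_moves w (tower k) t1 t3 = count_moves w (tower k) t1 i + count_moves w (tower k) i t3"
      by (rule count_moves_split) (use i times in auto)
    ultimately show ?thesis
      using count_A[of t1 t3] count_k[of t1 i] by linarith
  qed
  obtain v where v: "t2 \<le> v" "v < i" "w v = m" "s v m \<noteq> Neutral1" "s (Suc v) m = Neutral1"
    using last_entry[OF i(1) at_t2(3) i_m(2)] by blast
  have "t1 \<le> i" "s i m \<noteq> Neutral2"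
    using times i i_m by auto
  then obtain v0 where v0: "t1 \<le> v0" "v0 < i" "w v0 = m" "s v0 m = Neutral2" "s (Suc v0) m \<noteq> Neutral2"
      "\<forall>c. t1 \<le> c \<and> c \<le> v0 \<longrightarrow> s c m = Neutral2"
    using first_exit[of t1 i m Neutral2] t1_m by blast
  obtain x0 where x0: "on m v0 x0" "x0 \<noteq> Neutral2"
    using third[OF v0(3) disc_pos(3)] v0(4) by metis
  \<comment> \<open>Three passages of the tower of \<open>m\<close> and two moves of
    \<open>m\<close> give \<open>6 * P - 1\<close>; with the \<open>4 * P\<close> reserved in
    \<open>A\<close> this is the required \<open>10 * P - 1\<close>.\<close>
  have detour: ?thesis if "6 * P \<le> count_moves w (tower m) t1 i + 3" "2 \<le> count_moves w {m} t1 i"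
    using that A extra by linarith
  consider "s v m = EvenPeg" | "s v m = Neutral2" "s t2 m = EvenPeg" | "s v m = Neutral2" "s t2 m = Neutral2"
    using pegs(2)[of v] pegs(2)[of t2] v(4) at_t2(3) by auto
  then show ?thesis
  proof cases
    case 1
    then have "on m v Neutral2"
      using on_third[OF v(3) disc_pos(3), of Neutral2] v allowed_sets by simp
    moreover have "v0 < v"
    proof (rule ccontr)
      assume "\<not> v0 < v"
      then have "s v m = Neutral2"
        using v0(6) v(1) times by simp
      then show False
        using 1 by simp
    qed
    ultimately have "3 * 2 ^ height m \<le> count_moves w (tower m) t1 i + 3"
      using tower_cost3[of t1 v0 v i m Neutral2 x0 Neutral2 Neutral1] x0 t1_m i_m v v0 by simp
    moreover have "2 \<le> count_moves w {m} t1 i"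
      by (rule count_moves_ge_2[of t1 v0 v i]) (use v0 v \<open>v0 < v\<close> in auto)
    ultimately show ?thesis
      using detour heights by simp
  next
    case 2
    then have on_v: "on m v EvenPeg"
      using neutral_move_on[OF v(3), of m] v by simp
    obtain v1 where v1: "t1 \<le> v1" "v1 < t2" "w v1 = m" "s v1 m \<noteq> EvenPeg" "s (Suc v1) m = EvenPeg"
      using last_entry[OF times(2) _ 2(2)] t1_m(2) by auto
    obtain y where y: "on m v1 y" "y \<noteq> EvenPeg" "y \<noteq> s v1 m"
      using third[OF v1(3) disc_pos(3)] v1(5) by metis
    have "3 * 2 ^ height m \<le> count_moves w (tower m) t1 i + 3"
    proof (cases "y = Neutral2")
      case False
      then show ?thesis
        using tower_cost3[of t1 v1 v i m Neutral2 y EvenPeg Neutral1] y on_v t1_m i_m v v1 by simp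
    next
      case True
      have "v0 < v1"
      proof (rule ccontr)
        assume "\<not> v0 < v1"
        then have "s v1 m = Neutral2"
          using v0(6) v1(1) by simp
        then show False
          using True y(3) by simp
      qed
      then have "3 * 2 ^ height m \<le> count_moves w (tower m) t1 v + 3"
        using tower_cost3[of t1 v0 v1 v m Neutral2 x0 Neutral2 EvenPeg] x0 y True on_v t1_m v v1 v0 by simp
      moreover have "count_moves w (tower m) t1 v \<le> count_moves w (tower m) t1 i"
        using count_moves_split[of t1 v i w "tower m"] v v1 by simp
      ultimately show ?thesis
        by simp
    qed
    moreover have "2 \<le> count_moves w {m} t1 i"
      by (rule count_moves_ge_2[of t1 v1 v i]) (use v1 v in auto)
    ultimately show ?thesis
      using detour heights by simp
  next
    case 3
    have on_v: "on m v EvenPeg"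
      using neutral_move_on[OF v(3), of m] v 3 by simp
    obtain v2 where v2: "t2 \<le> v2" "v2 < i" "w v2 = m" "s v2 m = Neutral2" "s (Suc v2) m \<noteq> Neutral2"
        "\<forall>c. t2 \<le> c \<and> c \<le> v2 \<longrightarrow> s c m = Neutral2"
      using first_exit[OF i(1) 3(2)] i_m by auto
    show ?thesis
    proof (cases "s (Suc v2) m = EvenPeg")
      case True
      then have on_v2: "on m v2 Neutral1"
        using on_third[OF v2(3) disc_pos(3), of Neutral1] v2 allowed_sets by simp
      have "v2 < v"
      proof (rule ccontr)
        assume "\<not> v2 < v"
        then consider "v = v2" | "Suc v \<le> v2"
          by linarith
        then show False
        proof cases
          case 1
          then show False using True v(5) by simp
        next
          case 2
          then have "s (Suc v) m = Neutral2"
            using v2(6) v(1) by simp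
          then show False using v(5) by simp
        qed
      qed
      then have "3 * 2 ^ height m \<le> count_moves w (tower m) t1 i + 3"
        using tower_cost3[of t1 v2 v i m Neutral2 Neutral1 EvenPeg Neutral1] on_v2 on_v t1_m i_m v v2 times by simp
      moreover have "2 \<le> count_moves w {m} t1 i"
        by (rule count_moves_ge_2[of t1 v2 v i]) (use v2 v times \<open>v2 < v\<close> in auto)
      ultimately show ?thesis
        using detour heights by simp
    next
      case False
      then have on_v2: "on j v2 OddPeg"
        using neutral_move_on[OF v2(3), of j] v2 disc_order(6) by simp
      \<comment> \<open>Disc \<open>m\<close> rests on \<open>Neutral2\<close> from
        \<open>t2\<close> to \<open>v2\<close> and blocks the larger disc \<open>j\<close> beneath
        it.\<close>
      have j_v2: "s v2 j = Neutral2"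
      proof (rule ccontr)
        assume "s v2 j \<noteq> Neutral2"
        then obtain c where c: "t2 \<le> c" "c < v2" "w c = j" "s c j = Neutral2"
          using first_exit[OF v2(1) at_t2(2)] by blast
        then have "s c m \<noteq> Neutral2"
          using moves_clear(1)[OF c(3) disc_pos(3)] disc_order by simp
        then show False
          using v2(6) c by simp
      qed
      have "v2 \<le> e"
        using v2 i times by simp
      obtain c where c: "v2 \<le> c" "c < e" "w c = j" "s (Suc c) j = OddPeg"
        using last_entry[OF \<open>v2 \<le> e\<close> _ at_e(2)] j_v2 by auto
      obtain y where y: "on j c y" "y \<noteq> OddPeg"
        using third[OF c(3) disc_pos(4)] c(4) by metis
      have "3 * 2 ^ height j \<le> count_moves w (tower j) t2 e + 3"
        using tower_cost3[of t2 v2 c e j Neutral2 OddPeg y OddPeg] on_v2 y at_t2 at_e v2 c by simp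
      moreover have "1 \<le> count_moves w {j} t2 e"
        by (rule count_moves_ge_1[of t2 c e]) (use c v2 in auto)
      ultimately show ?thesis
        using extra heights one_le_P count_C[of t2 e] by linarith
    qed
  qed
qed

text \<open>Disc \<open>k\<close> was on its own peg at \<open>t1\<close>, hence it has returned to
  the source, and at \<open>i\<close> all smaller discs are on their own pegs. The cases ask when
  and where to \<open>k\<close> last left its own peg.\<close>

lemma k_enters_from_source:
  assumes i: "t2 \<le> i" "i < t3" "w i = k" "s (Suc i) k = Neutral2" "s i k = Neutral1"
  shows "22 * P \<le> A + B + C + 3"
proof -
  have at_i: "on k i EvenPeg" "on j i OddPeg" "s i j = OddPeg"
    using neutral_move_on[OF i(3), of k] neutral_move_on[OF i(3), of j] neutral_move[OF i(3), of j]
      i disc_order disc_pos by simp_all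
  have i_m: "on m i EvenPeg" "s i m = EvenPeg"
    using at_i by (simp_all add: on_k)
  have "t1 \<le> i"
    using i times by simp
  then obtain v where v: "t1 \<le> v" "v < i" "w v = k" "s v k = EvenPeg" "s (Suc v) k \<noteq> EvenPeg"
      "\<forall>c. v < c \<and> c \<le> i \<longrightarrow> s c k \<noteq> EvenPeg"
    using last_exit[of t1 i k EvenPeg] at_t1(2) i(5) by auto
  have k_twice: "2 \<le> count_moves w {k} t1 t3"
    by (rule count_moves_ge_2[of t1 v i]) (use v i in auto)
  consider "s (Suc v) k = Neutral2" | "s (Suc v) k = Neutral1" "v < t2" | "s (Suc v) k = Neutral1" "t2 \<le> v"
    using pegs(3)[of "Suc v"] v(5) by fastforce
  then show ?thesis
  proof cases
    case 1
    then have "on k v Neutral1"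
      using on_third[OF v(3) disc_pos(5), of Neutral1] v allowed_sets by simp
    then have "3 * 2 ^ height k \<le> count_moves w (tower k) t1 t3 + 3"
      using tower_cost3[of t1 v i t3 k Neutral2 Neutral1 EvenPeg Neutral2] at_i at_t1 at_t3 v i by simp
    then show ?thesis
      using extra heights one_le_P count_A[of t1 t3] k_twice by linarith
  next
    case 2
    then have "s t2 k = Neutral2"
      using pegs(3)[of t2] at_t2(4) v(6) i(1) by auto
    then obtain v' where v': "Suc v \<le> v'" "v' < t2" "w v' = k" "s v' k \<noteq> Neutral2" "s (Suc v') k = Neutral2"
      using last_entry[of "Suc v" t2 k Neutral2] 2 by auto
    have "s v' k \<noteq> EvenPeg"
      using v(6) v' i by simp
    then have "on j v' OddPeg" "s v' j = OddPeg"
      using neutral_move_on[OF v'(3), of j] neutral_move[OF v'(3), of j] v' disc_order(4) disc_pos(4) by simp_all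
    then show ?thesis
      using entry_own_before_t2[of v' v'] v' v times by simp
  next
    case 3
    then have on_v: "on k v Neutral2"
      using on_third[OF v(3) disc_pos(5), of Neutral2] v allowed_sets by simp
    have v_m: "on m v Neutral2" "s v m = Neutral2" "on q v Neutral2" "s v q = Neutral2"
      using on_v by (simp_all add: on_k on_m)
    have t1_m: "on m t1 Neutral2" "s t1 m = Neutral2" "on q t1 Neutral2" "s t1 q = Neutral2"
      using at_t1 by (simp_all add: on_k on_m)
    \<comment> \<open>The passage of the tower after \<open>i\<close> costs
      \<open>4 * P - 1\<close>, and disc \<open>k\<close> moves at \<open>v\<close> and at
      \<open>i\<close>.\<close>
    have up_to_i: "A \<ge> count_moves w (tower k) t1 v + count_moves w (tower k) v i + 4 * P + 1"
    proof -
      have "4 * P \<le> count_moves w (tower k) i t3 + 1"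
        using tower_cost[of i t3 k EvenPeg Neutral2] at_i at_t3 i heights by simp
      moreover have "count_moves w (tower k) t1 t3 = count_moves w (tower k) t1 v
          + count_moves w (tower k) v i + count_moves w (tower k) i t3"
        using count_moves_split[of t1 v t3 w "tower k"] count_moves_split[of v i t3 w "tower k"] v i by simp
      ultimately show ?thesis
        using count_A[of t1 t3] k_twice by linarith
    qed
    have v_to_i: "4 * P \<le> count_moves w (tower k) v i + 1"
      using tower_cost[of v i k Neutral2 EvenPeg] at_i on_v v heights by simp
    have detour: ?thesis if "2 * P \<le> count_moves w (tower k) t1 v"
      using that up_to_i v_to_i extra by linarith
    show ?thesis
    proof (cases "\<exists>c. t1 \<le> c \<and> c \<le> v \<and> (s c m \<noteq> Neutral2 \<or> s c q \<noteq> Neutral2)")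
      case True
      then obtain c where c: "t1 \<le> c" "c \<le> v" "s c m \<noteq> Neutral2 \<or> s c q \<noteq> Neutral2"
        by blast
      show ?thesis
      proof (cases "s c m = Neutral2")
        case False
        then have "2 * 2 ^ height m \<le> count_moves w (tower k) t1 v"
          using detour_cost[of m t1 c v Neutral2, folded discs(4)] c v_m t1_m disc_pos by simp
        then show ?thesis
          using detour heights by simp
      next
        case True
        then have "2 * P \<le> count_moves w (tower m) t1 v"
          using detour_cost[of q t1 c v Neutral2, folded discs(2)] c v_m t1_m disc_pos by simp
        then show ?thesis
          using detour count_k[of t1 v] by simp
      qed
    next
      case False
      then have rest: "s c m = Neutral2" "s c q = Neutral2" if "t1 \<le> c" "c \<le> v" for c
        using that by blast+
      \<comment> \<open>As long as \<open>m\<close> and \<open>q\<close> rest on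
        \<open>Neutral2\<close>, no disc larger than one of them can leave this peg.\<close>
      have stuck: "s v d = Neutral2" if d: "s t2 d = Neutral2" "\<exists>f. 1 \<le> f \<and> f < d \<and> (f = m \<or> f = q)" for d
      proof (rule ccontr)
        assume "s v d \<noteq> Neutral2"
        then obtain c where c: "t2 \<le> c" "c < v" "w c = d" "s c d = Neutral2"
          using first_exit[OF 3(2) d(1)] by blast
        obtain f where f: "1 \<le> f" "f < d" "f = m \<or> f = q"
          using d(2) by blast
        have "s c f \<noteq> Neutral2"
          using moves_clear(1)[OF c(3) f(1,2)] c(4) by simp
        then show False
          using rest[of c] c times f(3) by auto
      qed
      have v_j: "s v j = Neutral2"
        using stuck[of j] at_t2(2) disc_pos disc_order by blast
      have t2_l: "s t2 l = Neutral2" "on l t2 Neutral2"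
        using at_t2(1) by (simp_all add: on_j)
      have v_l: "s v l = Neutral2"
        using stuck[of l] t2_l disc_pos disc_order by blast
      \<comment> \<open>At \<open>v\<close> the discs \<open>j\<close>, \<open>m\<close>,
        \<open>l\<close> and \<open>q\<close> are all on \<open>Neutral2\<close>, so a disc leaves
        only after the smaller ones: \<open>l\<close> at \<open>z\<close>, then \<open>m\<close> at
        \<open>x\<close>, then \<open>j\<close> at \<open>g\<close>. The destinations of
        \<open>j\<close>, \<open>l\<close> and \<open>m\<close> decide which tower needs three
        passages.\<close>
      obtain g where g: "v \<le> g" "g < i" "w g = j" "s g j = Neutral2" "s (Suc g) j \<noteq> Neutral2"
        using first_exit[OF less_imp_le[OF v(2)] v_j] at_i by auto
      show ?thesis
      proof (cases "s (Suc g) j = OddPeg")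
        case False
        then have on_g: "on j g OddPeg"
          using neutral_move_on[OF g(3), of j] g by simp
        have "Suc g \<le> e"
          using g i times by simp
        then obtain c where c: "Suc g \<le> c" "c < e" "w c = j" "s (Suc c) j = OddPeg"
          using last_entry[OF _ False at_e(2)] by auto
        obtain y where y: "on j c y" "y \<noteq> OddPeg"
          using third[OF c(3) disc_pos(4)] c(4) by metis
        have "3 * 2 ^ height j \<le> count_moves w (tower j) t2 e + 3"
          using tower_cost3[of t2 g c e j Neutral2 OddPeg y OddPeg] on_g y at_t2 at_e g c 3 by simp
        moreover have "1 \<le> count_moves w {j} t2 e"
          by (rule count_moves_ge_1[of t2 c e]) (use c g 3 in auto)
        ultimately show ?thesis
          using extra heights one_le_P count_C[of t2 e] by linarith
      next
        case True
        then have on_g: "on j g Neutral1"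
          using on_third[OF g(3) disc_pos(4), of Neutral1] g allowed_sets by simp
        have g_m: "s g m \<noteq> Neutral2"
          using moves_clear(1)[OF g(3) disc_pos(3)] g(4) disc_order by simp
        obtain x where x: "v \<le> x" "x < g" "w x = m" "s x m = Neutral2" "s (Suc x) m \<noteq> Neutral2"
          using first_exit[OF g(1) v_m(2) g_m] by blast
        have x_l: "s x l \<noteq> Neutral2"
          using moves_clear(1)[OF x(3) disc_pos(2)] x(4) disc_order by simp
        obtain z where z: "v \<le> z" "z < x" "w z = l" "s z l = Neutral2" "s (Suc z) l \<noteq> Neutral2"
          using first_exit[OF x(1) v_l x_l] by blast
        show ?thesis
        proof (cases "s (Suc z) l = OddPeg")
          case True
          then have on_z: "on l z Neutral1"
            using on_third[OF z(3) disc_pos(2), of Neutral1] z allowed_sets by simp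
          have g_l: "on l g Neutral1" "s g l = Neutral1"
            using on_g by (simp_all add: on_j)
          obtain c where c: "Suc z \<le> c" "c < g" "w c = l" "s (Suc c) l = Neutral1"
            using last_entry[of "Suc z" g l Neutral1] True g_l z x by auto
          obtain y where y: "on l c y" "y \<noteq> Neutral1"
            using third[OF c(3) disc_pos(2)] c(4) by metis
          have "3 * 2 ^ height l \<le> count_moves w (tower l) t2 g + 3"
            using tower_cost3[of t2 z c g l Neutral2 Neutral1 y Neutral1] on_z y t2_l g_l z c x 3 by simp
          moreover have "2 \<le> count_moves w {l} t2 g"
            by (rule count_moves_ge_2[of t2 z c g]) (use c z 3 in auto)
          moreover have "4 * P \<le> count_moves w (tower j) g e + 1"
            using tower_cost[of g e j Neutral1 OddPeg] on_g at_e g i times heights by simp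
          moreover have "1 \<le> count_moves w {j} t2 e"
            by (rule count_moves_ge_1[of t2 g e]) (use g i times 3 in auto)
          moreover have "count_moves w (tower j) t2 e = count_moves w (tower j) t2 g + count_moves w (tower j) g e"
            by (rule count_moves_split) (use g i times 3 in auto)
          ultimately show ?thesis
            using extra heights one_le_P count_C[of t2 e] count_j[of t2 g] by linarith
        next
          case False
          then have on_z: "on m z EvenPeg"
            using neutral_move_on[OF z(3), of m] z disc_order(7) by simp
          \<comment> \<open>The tower of \<open>m\<close> is on \<open>EvenPeg\<close> at
            \<open>z\<close> and again at \<open>i\<close>, but \<open>m\<close> cannot reach that
            peg in between without driving it away.\<close>
          have "6 * P \<le> count_moves w (tower m) v i + 3 \<and> 1 \<le> count_moves w {m} v i"
          proof (cases "s (Suc x) m = EvenPeg")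
            case True
            then have "on m x Neutral1"
              using on_third[OF x(3) disc_pos(3), of Neutral1] x allowed_sets by simp
            then have "3 * 2 ^ height m \<le> count_moves w (tower m) v i + 3"
              using tower_cost3[of v z x i m Neutral2 EvenPeg Neutral1 EvenPeg] on_z v_m i_m z x g by simp
            moreover have "1 \<le> count_moves w {m} v i"
              by (rule count_moves_ge_1[of v x i]) (use x g in auto)
            ultimately show ?thesis
              using heights by simp
          next
            case False
            then have on_x: "on m x EvenPeg"
              using neutral_move_on[OF x(3), of m] x by simp
            obtain c where c: "Suc x \<le> c" "c < i" "w c = m" "s (Suc c) m = EvenPeg"
              using last_entry[of "Suc x" i m EvenPeg] False i_m x g by auto
            obtain y where y: "on m c y" "y \<noteq> EvenPeg"
              using third[OF c(3) disc_pos(3)] c(4) by metis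
            have "3 * 2 ^ height m \<le> count_moves w (tower m) v i + 3"
              using tower_cost3[of v x c i m Neutral2 EvenPeg y EvenPeg] on_x y v_m i_m x c by simp
            moreover have "1 \<le> count_moves w {m} v i"
              by (rule count_moves_ge_1[of v x i]) (use x g in auto)
            ultimately show ?thesis
              using heights by simp
          qed
          then show ?thesis
            using up_to_i extra count_k[of v i] by linarith
        qed
      qed
    qed
  qed
qed

lemma congestion_cost: "22 * P \<le> A + B + C + 3"
proof -
  have "t1 \<le> t3"
    using times by simp
  then obtain i where i: "t1 \<le> i" "i < t3" "w i = k" "s i k \<noteq> Neutral2" "s (Suc i) k = Neutral2"
    using last_entry[of t1 t3 k Neutral2] at_t1(2) at_t3(2) by auto
  then show ?thesis
    using k_enters_before_t2[of i] k_enters_from_own_peg[of i] k_enters_from_source[of i] pegs(3)[of i]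
    by fastforce
qed

end

subsection \<open>The recurrence for \<open>b\<close>\<close>

text \<open>Obtained from the claimed recurrences by eliminating \<open>c\<close> and \<open>d\<close>.\<close>

fun beta :: "nat \<Rightarrow> nat" where
  "beta 0 = 0"
| "beta (Suc 0) = 1"
| "beta (Suc (Suc 0)) = 2"
| "beta (Suc (Suc (Suc n))) =
    beta n + 2 * 2 ^ height (n + 2) + 2 ^ height (n + 1) + 2 ^ height (n + 3) - 1"

section \<open>Growth of \<open>beta\<close>\<close>

lemma height_double [simp]:
  "height (Suc (2 * u)) = u" "height (Suc (Suc (2 * u))) = u" "height (2 * u + 3) = u + 1"
  "height (2 * u + 4) = u + 1" "height (2 * u + 5) = u + 2"
  by (simp_all add: height_def)

lemma beta_odd: "beta (2 * u + 3) + 1 = beta (2 * u) + 5 * 2 ^ u"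
proof -
  have eq: "2 * u + 3 = Suc (Suc (Suc (2 * u)))"
    by simp
  have "beta (2 * u + 3) = beta (2 * u) + 5 * 2 ^ u - 1"
    using beta.simps(4)[of "2 * u"] unfolding eq[symmetric] by simp
  moreover have "1 \<le> (2 :: nat) ^ u"
    by simp
  ultimately show ?thesis
    by linarith
qed

lemma beta_even: "beta (2 * u + 4) + 1 = beta (2 * u + 1) + 7 * 2 ^ u"
proof -
  have eqs: "2 * u + 4 = Suc (Suc (Suc (2 * u + 1)))" "2 * u + 1 + 2 = 2 * u + 3"
      "2 * u + 1 + 1 = Suc (Suc (2 * u))" "2 * u + 1 + 3 = 2 * u + 4"
    by simp_all
  have "beta (2 * u + 4) = beta (2 * u + 1) + 7 * 2 ^ u - 1"
    using beta.simps(4)[of "2 * u + 1"] unfolding eqs(2-4) unfolding eqs(1)[symmetric] by simp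
  moreover have "1 \<le> (2 :: nat) ^ u"
    by simp
  ultimately show ?thesis
    by linarith
qed

text \<open>The recursion goes back by three and thus exchanges the parities: the gap after an even
  index comes from a gap after an odd one, and conversely. The upper bound 2 for the latter, in
  units of \<open>2 ^ u\<close>, yields (2 + 3) / 4 for the former, whence the constants 4 and
  5.\<close>

lemma beta_gaps:
  "beta (2 * u) + 2 ^ u \<le> beta (2 * u + 1) \<and> 4 * beta (2 * u + 1) \<le> 4 * beta (2 * u) + 5 * 2 ^ u \<and>
   beta (2 * u + 1) + 2 ^ u \<le> beta (2 * u + 2) \<and> beta (2 * u + 2) \<le> beta (2 * u + 1) + 2 * 2 ^ u"
proof (induction u rule: induct_nat_012)
  case 0
  then show ?case
    by (simp add: numeral_2_eq_2)
next
  case 1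
  have "beta 2 = 2" "beta 3 = 4" "beta 4 = 7"
    using beta_odd[of 0] beta_even[of 0] by (simp_all add: numeral_2_eq_2)
  then show ?case
    by simp
next
  case (ge2 u)
  have eqs: "2 * Suc (Suc u) = 2 * u + 4" "2 * Suc u = 2 * u + 2"
      "2 * u + 2 + 1 = 2 * u + 3" "2 * u + 2 + 2 = 2 * u + 4" "2 * u + 2 + 3 = 2 * u + 5" "2 * u + 2 + 4 = 2 * u + 6"
      "2 * u + 4 + 1 = 2 * u + 5" "2 * u + 4 + 2 = 2 * u + 6"
      "(2::nat) ^ Suc u = 2 * 2 ^ u" "(2::nat) ^ Suc (Suc u) = 4 * 2 ^ u"
    by simp_all
  show ?case
    using ge2 beta_odd[of u] beta_even[of u] beta_odd[of "Suc u"] beta_even[of "Suc u"]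
    unfolding eqs by (intro conjI; linarith)
qed

lemma beta_gaps_Suc:
  "beta (2 * u + 2) + 2 * 2 ^ u \<le> beta (2 * u + 3) \<and> 4 * beta (2 * u + 3) \<le> 4 * beta (2 * u + 2) + 10 * 2 ^ u \<and>
   beta (2 * u + 3) + 2 * 2 ^ u \<le> beta (2 * u + 4) \<and> beta (2 * u + 4) \<le> beta (2 * u + 3) + 4 * 2 ^ u"
proof -
  have eqs: "2 * Suc u = 2 * u + 2" "2 * u + 2 + 1 = 2 * u + 3" "2 * u + 2 + 2 = 2 * u + 4" "(2::nat) ^ Suc u = 2 * 2 ^ u"
    by simp_all
  show ?thesis
    using beta_gaps[of "Suc u"] unfolding eqs by simp
qed

lemma beta_Suc: "beta n \<le> beta (Suc n)"
proof (cases "even n")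
  case True
  then obtain u where "n = 2 * u"
    by (rule evenE)
  then show ?thesis
    using beta_gaps[of u] by simp
next
  case False
  then obtain u where "n = 2 * u + 1"
    by (rule oddE)
  then show ?thesis
    using beta_gaps[of u] by simp
qed

text \<open>The inequality wanted is the one without the last summands on both sides.  The loss on the
  right is genuine and is what \<open>congestion_cost\<close> compensates; the gain on the left keeps it from
  propagating to larger \<open>k\<close>.  The factor 4 makes room for fractions of powers of two.\<close>

lemma run_bound:
  fixes W :: "nat \<Rightarrow> nat"
  assumes j: "1 \<le> j" "j + 2 \<le> k" "k \<le> n"
    and start: "beta (j - 1) + 2 ^ height j + 2 ^ height (j + 1) \<le> W (j + 2) + 1"
    and step: "\<And>i. j + 2 \<le> i \<Longrightarrow> i < n \<Longrightarrow> W i + 2 ^ height (i + 1) \<le> W (i + 1)"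
  shows "4 * beta (k - 3) + 4 * 2 ^ height (k - 2) + 4 * 2 ^ height (k - 1)
      + (if odd k \<and> k \<noteq> j + 2 then 2 ^ ((k - 3) div 2) else 0)
    \<le> 4 * W k + 4 + (if even k \<and> k = j + 3 then 2 ^ ((k - 4) div 2) else 0)"
  using j(2,3)
proof (induction k rule: dec_induct)
  case base
  have "j + 2 - 3 = j - 1" "j + 2 - 2 = j" "j + 2 - 1 = j + 1"
    using j by simp_all
  then show ?case
    using start by simp
next
  case (step k)
  have IH: "4 * beta (k - 3) + 4 * 2 ^ height (k - 2) + 4 * 2 ^ height (k - 1)
      + (if odd k \<and> k \<noteq> j + 2 then 2 ^ ((k - 3) div 2) else 0)
    \<le> 4 * W k + 4 + (if even k \<and> k = j + 3 then 2 ^ ((k - 4) div 2) else 0)"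
    using step by simp
  have W: "W k + 2 ^ height (k + 1) \<le> W (k + 1)"
    using assms(5)[of k] step by simp
  have "k \<ge> 3"
    using step j by simp
  show ?case
  proof (cases "odd k")
    case True
    obtain u where u: "k = 2 * u + 3"
    proof
      show "k = 2 * ((k - 3) div 2) + 3"
        using True \<open>k \<ge> 3\<close> by (metis Nat.add_diff_assoc2 add_diff_cancel_right' dvd_mult_div_cancel
            le_add_diff_inverse2 odd_add odd_numeral)
    qed
    have e: "k - 3 = 2 * u" "k - 2 = 2 * u + 1" "k - 1 = 2 * u + 2" "Suc k - 3 = 2 * u + 1"
        "Suc k - 2 = 2 * u + 2" "Suc k - 1 = 2 * u + 3" "(k - 3) div 2 = u" "(Suc k - 4) div 2 = u" "k + 1 = 2 * u + 4"
      using u by simp_all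
    have "4 * beta (2 * u) + 8 * 2 ^ u + (if k \<noteq> j + 2 then 2 ^ u else 0) \<le> 4 * W k + 4"
      using IH True unfolding e by (cases "k = j + 2") simp_all
    moreover have "height (Suc k) = u + 1"
      using e(9) height_double(4)[of u] by (metis Suc_eq_plus1)
    then have "W k + 2 * 2 ^ u \<le> W (Suc k)"
      using W by simp
    \<comment> \<open>In units of \<open>2 ^ u\<close> the left side grows by at most 5 + 4 = 9,
      while the step supplies 8: this is the loss of 1.\<close>
    ultimately have "4 * beta (2 * u + 1) + 12 * 2 ^ u \<le> 4 * W (Suc k) + 4 + (if k = j + 2 then 2 ^ u else 0)"
      using beta_gaps[of u] by (cases "k = j + 2") simp_all
    then show ?thesis
      using True unfolding e by (cases "k = j + 2") simp_all
  next
    case False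
    obtain u where u: "k = 2 * u + 4"
    proof
      show "k = 2 * ((k - 4) div 2) + 4"
        using False \<open>k \<ge> 3\<close> by (cases "k = 3") auto
    qed
    have e: "k - 3 = 2 * u + 1" "k - 2 = 2 * u + 2" "k - 1 = 2 * u + 3" "Suc k - 3 = 2 * u + 2"
        "Suc k - 2 = 2 * u + 3" "Suc k - 1 = 2 * u + 4" "(k - 4) div 2 = u" "(Suc k - 3) div 2 = u + 1" "k + 1 = 2 * u + 5"
      using u by simp_all
    have "4 * beta (2 * u + 1) + 12 * 2 ^ u \<le> 4 * W k + 4 + 2 ^ u"
      using IH False unfolding e by (cases "k = j + 3") simp_all
    moreover have "height (Suc k) = u + 2"
      using e(9) height_double(5)[of u] by (metis Suc_eq_plus1)
    then have "W k + 4 * 2 ^ u \<le> W (Suc k)"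
      using W by simp
    \<comment> \<open>The supply is 16, the growth at most 8 + 4; this repays the loss of 1 and
      leaves the gain of 2, which is \<open>2 ^ (u + 1)\<close>.\<close>
    ultimately have "4 * beta (2 * u + 2) + 18 * 2 ^ u \<le> 4 * W (Suc k) + 4"
      using beta_gaps[of u] by linarith
    then show ?thesis
      using False unfolding e by (cases "k = j + 1") simp_all
  qed
qed

lemma double_plus_cases:
  fixes n :: nat
  assumes "3 \<le> n"
  obtains u where "n = 2 * u + 3" | u where "n = 2 * u + 4"
proof (cases "even n")
  case True
  then obtain v where "n = 2 * v"
    by (rule evenE)
  then have "n = 2 * (v - 2) + 4"
    using assms by simp
  then show ?thesis
    by (rule that(2))
next
  case False
  then obtain v where "n = 2 * v + 1"
    by (rule oddE)
  then have "n = 2 * (v - 1) + 3"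
    using assms by simp
  then show ?thesis
    by (rule that(1))
qed

lemma double_plus_3:
  assumes "n = 2 * u + 3"
  shows "n - 1 = 2 * u + 2" "n - 2 = 2 * u + 1" "n - 3 = 2 * u" "height n = u + 1" "height (n - 1) = u"
    "height (n - 2) = u" "(n - 3) div 2 = u" "odd n"
  using assms by (simp_all add: height_def)

lemma double_plus_4:
  assumes "n = 2 * u + 4"
  shows "n - 1 = 2 * u + 3" "n - 2 = 2 * u + 2" "n - 3 = 2 * u + 1" "height n = u + 1" "height (n - 1) = u + 1"
    "height (n - 2) = u" "(n - 4) div 2 = u" "even n"
  using assms by (simp_all add: height_def)

lemma beta_rec:
  assumes "3 \<le> n"
  shows "beta n + 1 = beta (n - 3) + 2 * 2 ^ height (n - 1) + 2 ^ height (n - 2) + 2 ^ height n"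
  using assms
proof (cases rule: double_plus_cases)
  case (1 u)
  then show ?thesis
    using beta_odd[of u] unfolding double_plus_3[OF 1] by simp
next
  case (2 u)
  then show ?thesis
    using beta_even[of u] unfolding double_plus_4[OF 2] by simp
qed

lemma beta_le_neutral_last:
  assumes "3 \<le> n"
  shows "beta n \<le> beta (n - 1) + 2 * 2 ^ height n"
  using assms
proof (cases rule: double_plus_cases)
  case (1 u)
  then show ?thesis
    using beta_odd[of u] beta_gaps[of u] unfolding double_plus_3[OF 1] by simp
next
  case (2 u)
  then show ?thesis
    using beta_gaps_Suc[of u] unfolding double_plus_4[OF 2] by simp
qed

lemma beta_le_neutral_last_but_one:
  assumes "3 \<le> n"
  shows "beta n + 1 \<le> beta (n - 2) + 2 * 2 ^ height n + 2 * 2 ^ height (n - 1)"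
  using assms
proof (cases rule: double_plus_cases)
  case (1 u)
  then show ?thesis
    using beta_odd[of u] beta_gaps[of u] unfolding double_plus_3[OF 1] by simp
next
  case (2 u)
  then show ?thesis
    using 2 beta_even[of u] beta_gaps[of u] unfolding double_plus_4[OF 2] by simp
qed

text \<open>Larger discs may be present and move, and \<open>e\<close> is any time. Thus the bound
  applies to an initial segment of a longer play, and also to a reversed one.\<close>

definition b_bound :: "nat \<Rightarrow> bool" where
  "b_bound n \<longleftrightarrow> (\<forall>s w e. play s w \<longrightarrow> (\<forall>d\<in>{1..n}. s 0 d = Neutral1) \<longrightarrow>
     (\<forall>d\<in>{1..n}. s e d = own_peg d) \<longrightarrow> beta n \<le> count_moves w {1..n} 0 e)"

lemma b_boundD:
  assumes "b_bound n" "play s w" "\<And>d. 1 \<le> d \<Longrightarrow> d \<le> n \<Longrightarrow> s 0 d = Neutral1"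
    "\<And>d. 1 \<le> d \<Longrightarrow> d \<le> n \<Longrightarrow> s e d = own_peg d"
  shows "beta n \<le> count_moves w {1..n} 0 e"
  using assms by (simp add: b_bound_def)

lemma discs_below_split: "1 \<le> k \<Longrightarrow> {1..<k} = tower k \<union> tower (Suc k)"
  by (auto simp: tower_def less_Suc_eq)

lemma discs_upto_split: "1 \<le> k \<Longrightarrow> {1..k} = tower (Suc (Suc k)) \<union> tower (Suc k)"
  by (auto simp: tower_def less_Suc_eq)

lemma tower_disjoint: "tower k \<inter> tower (Suc k) = {}" "tower (Suc (Suc k)) \<inter> tower (Suc k) = {}"
  by (auto simp: tower_def)

lemma count_moves_below:
  "1 \<le> k \<Longrightarrow> count_moves w {1..<k} a b = count_moves w (tower k) a b + count_moves w (tower (Suc k)) a b"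
  using count_moves_Un[OF tower_disjoint(1)] discs_below_split by simp

lemma count_moves_upto:
  "1 \<le> k \<Longrightarrow> count_moves w {1..k} a b = count_moves w (tower (Suc (Suc k))) a b + count_moves w (tower (Suc k)) a b"
  using count_moves_Un[OF tower_disjoint(2)] discs_upto_split by simp

subsection \<open>First departures from the source\<close>

text \<open>Asking only that every disc has left the source covers all four goals at once.\<close>

locale departure = play +
  fixes n e :: nat
  assumes at_start: "1 \<le> d \<Longrightarrow> d \<le> n \<Longrightarrow> s 0 d = Neutral1"
    and all_left: "1 \<le> d \<Longrightarrow> d \<le> n \<Longrightarrow> s e d \<noteq> Neutral1"
begin

definition first :: "nat \<Rightarrow> nat" where
  "first d = (SOME i. i < e \<and> w i = d \<and> s i d = Neutral1 \<and> s (Suc i) d \<noteq> Neutral1 \<and>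
     (\<forall>c\<le>i. s c d = Neutral1))"

lemma first_props:
  assumes "1 \<le> d" "d \<le> n"
  shows "first d < e" "w (first d) = d" "s (first d) d = Neutral1" "s (Suc (first d)) d \<noteq> Neutral1"
    "\<And>c. c \<le> first d \<Longrightarrow> s c d = Neutral1"
proof -
  have "\<exists>i. i < e \<and> w i = d \<and> s i d = Neutral1 \<and> s (Suc i) d \<noteq> Neutral1 \<and> (\<forall>c\<le>i. s c d = Neutral1)"
    using first_exit[of 0 e d Neutral1] at_start[OF assms] all_left[OF assms] by auto
  from someI_ex[OF this, folded first_def] show "first d < e" "w (first d) = d" "s (first d) d = Neutral1"
    "s (Suc (first d)) d \<noteq> Neutral1" "\<And>c. c \<le> first d \<Longrightarrow> s c d = Neutral1"
    by blast+
qed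

lemma first_clear:
  assumes "1 \<le> d" "d < d'" "d' \<le> n"
  shows "s (first d') d \<noteq> Neutral1" "first d < first d'"
proof -
  show "s (first d') d \<noteq> Neutral1"
    using moves_clear(1)[of "first d'" d' d] first_props(2,3)[of d'] assms by simp
  then show "first d < first d'"
    using first_props(5)[of d "first d'"] assms by (cases "first d' \<le> first d") simp_all
qed

definition to_own :: "nat \<Rightarrow> bool" where
  "to_own d \<longleftrightarrow> s (Suc (first d)) d = own_peg d"

lemma not_to_own: "1 \<le> d \<Longrightarrow> d \<le> n \<Longrightarrow> \<not> to_own d \<Longrightarrow> s (Suc (first d)) d = Neutral2"
  using first_props(4)[of d] allowed[of d "Suc (first d)"] by (auto simp: to_own_def allowed_pegs_own)

lemma to_own_on:
  assumes "1 \<le> d" "d \<le> n" "to_own d"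
  shows "on d (first d) Neutral2"
proof (rule on_third[OF first_props(2)[OF assms(1,2)] assms(1)])
  show "Neutral2 \<in> allowed_pegs d"
    by (simp add: allowed_pegs_own)
  show "Neutral2 \<noteq> s (first d) d" "Neutral2 \<noteq> s (Suc (first d)) d"
    using first_props(3)[OF assms(1,2)] assms(3) by (simp_all add: to_own_def)
qed

text \<open>If the tower is already on \<open>z\<close> when \<open>k\<close> departs, it has to
  make way for the entry of \<open>k\<close> and come back; otherwise it crosses at least once. The
  departing move of \<open>k\<close> makes up for the 1 subtracted in the three-peg bounds.\<close>

lemma extend:
  assumes k: "1 \<le> k" "k \<le> n" "first k < c" "on k (first k) x" "on (Suc (Suc k)) c z"
  shows "x \<noteq> z \<Longrightarrow> count_moves w (tower k) 0 (first k) + 2 ^ height k \<le> count_moves w (tower (Suc (Suc k))) 0 c"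
    and "x = z \<Longrightarrow> s (Suc (first k)) k \<noteq> z \<Longrightarrow>
      count_moves w (tower k) 0 (first k) + 2 * 2 ^ height k \<le> count_moves w (tower (Suc (Suc k))) 0 c"
proof -
  have ends: "on k (Suc (first k)) x" "on k c z" "s c k = z" "Suc (first k) \<le> c"
    using k on_Suc[OF first_props(2)[OF k(1,2)]] on_Suc_Suc[OF k(1)] by simp_all
  have split: "count_moves w S 0 c = count_moves w S 0 (first k) + count_moves w S (first k) (Suc (first k))
      + count_moves w S (Suc (first k)) c" for S
    using count_moves_split[of 0 "first k" c w S] count_moves_split[of "first k" "Suc (first k)" c w S] k by simp
  have one: "1 \<le> count_moves w {k} (first k) (Suc (first k))"
    by (rule count_moves_ge_1[of _ "first k"]) (use first_props(2) k in auto)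
  have first: "count_moves w (tower k) 0 (first k) + 1 \<le>
      count_moves w (tower (Suc (Suc k))) 0 (first k) + count_moves w (tower (Suc (Suc k))) (first k) (Suc (first k))"
    using one count_moves_tower_Suc_Suc[OF k(1)] by simp
  show "count_moves w (tower k) 0 (first k) + 2 ^ height k \<le> count_moves w (tower (Suc (Suc k))) 0 c" if "x \<noteq> z"
    using tower_cost[OF ends(4,1,2) that] first split[of "tower (Suc (Suc k))"]
      count_moves_tower_Suc_Suc[OF k(1), of w "Suc (first k)" c] by linarith
  show "count_moves w (tower k) 0 (first k) + 2 * 2 ^ height k \<le> count_moves w (tower (Suc (Suc k))) 0 c"
    if "x = z" "s (Suc (first k)) k \<noteq> z"
    using return_cost[OF k(1) ends(4) _ ends(2) that(2) ends(3)] ends(1) that(1) first split[of "tower (Suc (Suc k))"]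
    by simp
qed

text \<open>The choice \<open>j = 1\<close> is the default when every disc first goes to its own
  peg. No smaller discs exist then, so the later statements about the position at the departure of
  \<open>j\<close> still hold.\<close>

lemma last_neutral_departure:
  assumes "1 \<le> n"
  obtains j where "1 \<le> j" "j \<le> n" "j = 1 \<or> \<not> to_own j" "\<And>k. j < k \<Longrightarrow> k \<le> n \<Longrightarrow> to_own k"
proof -
  define S where "S = {d \<in> {1..n}. d = 1 \<or> \<not> to_own d}"
  have fin: "finite S"
    by (simp add: S_def)
  have "1 \<in> S"
    using assms by (simp add: S_def)
  then have max: "Max S \<in> S"
    using Max_in[OF fin] by blast
  show ?thesis
  proof (rule that)
    show "1 \<le> Max S" "Max S \<le> n" "Max S = 1 \<or> \<not> to_own (Max S)"
      using max by (simp_all only: S_def mem_Collect_eq atLeastAtMost_iff)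
    show "to_own k" if "Max S < k" "k \<le> n" for k
    proof (rule ccontr)
      assume "\<not> to_own k"
      then have "k \<in> S"
        using that by (simp add: S_def)
      then show False
        using Max_ge[OF fin, of k] that(1) by simp
    qed
  qed
qed

lemma own_pegs_at_departure:
  assumes "1 \<le> j" "j \<le> n" "j = 1 \<or> \<not> to_own j" "1 \<le> d" "d < j"
  shows "s (first j) d = own_peg d"
proof -
  have "\<not> to_own j"
    using assms by auto
  then have "s (Suc (first j)) j \<noteq> own_peg j" "s (first j) j \<noteq> own_peg j"
    using not_to_own[OF assms(1,2)] first_props(3)[OF assms(1,2)] by simp_all
  then show ?thesis
    using neutral_move[OF first_props(2)[OF assms(1,2)]] assms(4,5) by blast
qed

lemma on_at_departure:
  assumes "1 \<le> j" "j \<le> n" "j = 1 \<or> \<not> to_own j" "k \<le> j + 1"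
  shows "on k (first j) (own_peg k)"
  unfolding on_def
proof
  fix d assume d: "d \<in> tower k"
  then have "1 \<le> d" "d < k" "k \<noteq> Suc d"
    by (auto simp: tower_def)
  then have "1 \<le> d" "d < j"
    using assms(4) by linarith+
  then have "s (first j) d = own_peg d"
    by (rule own_pegs_at_departure[OF assms(1-3)])
  then show "s (first j) d = own_peg k"
    using own_peg_tower[OF d] by (rule trans)
qed

lemma moves_before_departure:
  assumes "b_bound (j - 1)" "1 \<le> j" "j \<le> n" "j = 1 \<or> \<not> to_own j"
  shows "beta (j - 1) \<le> count_moves w (tower j) 0 (first j) + count_moves w (tower (Suc j)) 0 (first j)"
proof -
  have "beta (j - 1) \<le> count_moves w {1..j - 1} 0 (first j)"
  proof (rule b_boundD[OF assms(1)])
    show "play s w"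
      by unfold_locales
    show "s 0 d = Neutral1" if "1 \<le> d" "d \<le> j - 1" for d
      using at_start[of d] that assms(2,3) by simp
    show "s (first j) d = own_peg d" if "1 \<le> d" "d \<le> j - 1" for d
      using own_pegs_at_departure[OF assms(2-4), of d] that assms(2) by simp
  qed
  moreover have "{1..j - 1} = {1..<j}"
    using assms(2) by auto
  ultimately show ?thesis
    using count_moves_below[OF assms(2), of w 0 "first j"] by simp
qed

text \<open>Each of the two classes is counted up to its own latest departure. Passing from
  \<open>k\<close> to \<open>k + 1\<close> therefore advances only the class of
  \<open>k + 1\<close>, and the other summand stays the same.\<close>

definition W :: "nat \<Rightarrow> nat" where
  "W k = count_moves w (tower k) 0 (first k) + count_moves w (tower (k - 1)) 0 (first (k - 1))"

lemma W_one:
  assumes "b_bound (j - 1)" "1 \<le> j" "Suc j \<le> n" "j = 1 \<or> \<not> to_own j" "to_own (Suc j)"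
  shows "beta (j - 1) + 2 ^ height (Suc j) \<le> W (Suc j) + 1"
proof -
  have le: "first j \<le> first (Suc j)"
    using first_clear(2)[of j "Suc j"] assms by simp
  have "2 ^ height (Suc j) \<le> count_moves w (tower (Suc j)) (first j) (first (Suc j)) + 1"
    using tower_cost[OF le on_at_departure[of j "Suc j"] to_own_on[of "Suc j"]] assms by simp
  then show ?thesis
    using moves_before_departure[OF assms(1,2) _ assms(4)] assms(3) count_moves_split[of 0 "first j" "first (Suc j)" w "tower (Suc j)"] le
    by (simp add: W_def)
qed

lemma W_two:
  assumes "b_bound (j - 1)" "1 \<le> j" "j + 2 \<le> n" "j = 1 \<or> \<not> to_own j" "to_own (Suc j)" "to_own (j + 2)"
  shows "beta (j - 1) + 2 ^ height j + 2 ^ height (j + 1) \<le> W (j + 2) + 1"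
proof -
  have "count_moves w (tower j) 0 (first j) + 2 ^ height j \<le> count_moves w (tower (Suc (Suc j))) 0 (first (Suc (Suc j)))"
    using extend(1)[of j "first (Suc (Suc j))" "own_peg j" Neutral2] on_at_departure[of j j] to_own_on[of "Suc (Suc j)"]
      first_clear(2)[of j "Suc (Suc j)"] assms by simp
  then show ?thesis
    using W_one[OF assms(1,2) _ assms(4,5)] assms(3) by (simp add: W_def)
qed

text \<open>At the departures of \<open>k - 1\<close> and of \<open>k + 1\<close> the tower of
  \<open>k - 1\<close> is on \<open>Neutral2\<close>. In between disc \<open>k - 1\<close> goes to
  its own peg and must join it, so the tower moves away and back, for
  \<open>2 * 2 ^ height (k - 1) = 2 ^ height (k + 1)\<close>.\<close>

lemma W_step:
  assumes "2 \<le> k" "k < n" "to_own (k - 1)" "to_own (k + 1)"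
  shows "W k + 2 ^ height (k + 1) \<le> W (k + 1)"
proof -
  obtain i where i: "k = Suc i" "1 \<le> i"
    using assms(1) by (cases k) auto
  have "count_moves w (tower i) 0 (first i) + 2 * 2 ^ height i \<le> count_moves w (tower (Suc (Suc i))) 0 (first (Suc (Suc i)))"
    using extend(2)[of i "first (Suc (Suc i))" Neutral2 Neutral2] to_own_on[of i] to_own_on[of "Suc (Suc i)"]
      first_clear(2)[of i "Suc (Suc i)"] assms i by (simp add: to_own_def)
  then show ?thesis
    using i height_Suc_Suc[of i] by (simp add: W_def)
qed

lemma W_bound:
  assumes "\<And>k. k < n \<Longrightarrow> b_bound k" "1 \<le> j" "j + 2 \<le> n" "j = 1 \<or> \<not> to_own j" "\<And>k. j < k \<Longrightarrow> k \<le> n \<Longrightarrow> to_own k"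
  shows "4 * beta (n - 3) + 4 * 2 ^ height (n - 2) + 4 * 2 ^ height (n - 1)
      + (if odd n \<and> n \<noteq> j + 2 then 2 ^ ((n - 3) div 2) else 0)
    \<le> 4 * W n + 4 + (if even n \<and> n = j + 3 then 2 ^ ((n - 4) div 2) else 0)"
proof (rule run_bound[OF assms(2,3) order_refl])
  show "beta (j - 1) + 2 ^ height j + 2 ^ height (j + 1) \<le> W (j + 2) + 1"
    using W_two[of j] assms by simp
  show "W i + 2 ^ height (i + 1) \<le> W (i + 1)" if "j + 2 \<le> i" "i < n" for i
    using W_step[of i] assms that by simp
qed

text \<open>Here 26 = 22 + 4: besides \<open>congestion_cost\<close>, the tower of
  \<open>j + 1\<close> passes from its own peg to \<open>Neutral2\<close> between the departures of
  \<open>j\<close> and \<open>j + 1\<close>. The time \<open>t3\<close> is left open because it is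
  the departure of disc \<open>j + 3\<close> in the bound for \<open>b\<close>, but the end of the
  play in \<open>hard_cost\<close>.\<close>

lemma congested_moves:
  assumes "odd j" "5 \<le> j" "j + 2 \<le> n" "b_bound (j - 1)" "\<not> to_own j" "to_own (Suc j)" "to_own (Suc (Suc j))"
    and t3: "first (Suc (Suc j)) \<le> t3" "t3 \<le> e" "on (Suc (Suc (Suc j))) t3 Neutral2"
    and end_own: "on (Suc (Suc j)) e (own_peg j)"
  shows "beta (j - 1) + 26 * 2 ^ height (j - 3) \<le>
    count_moves w (tower (Suc (Suc (Suc j)))) 0 t3 + count_moves w (tower (Suc (Suc (Suc (Suc j))))) 0 e + 1"
proof -
  define q where "q = j - 3"
  have j_q: "j = Suc (Suc (Suc q))" "even q" "2 \<le> q"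
    using assms(1,2) by (auto simp: q_def)
  define k where "k = Suc j"
  have in_range: "1 \<le> j" "j \<le> n" "1 \<le> k" "k \<le> n" "j < k" "Suc (Suc j) \<le> n" "k < Suc (Suc j)"
    using assms(2,3) by (auto simp: k_def)
  have k_own: "to_own k"
    using assms(6) by (simp add: k_def)
  have own: "own_peg j = OddPeg" "own_peg k = EvenPeg"
    using assms(1) by (simp_all add: own_peg_def k_def)
  define t0 t1 t2 where "t0 = Suc (first j)" and "t1 = Suc (first k)" and "t2 = first (Suc (Suc j))"
  have ts: "first j < first k" "first k < t2" "t2 < e"
    using first_clear(2)[OF in_range(1,5,4)] first_clear(2)[OF in_range(3,7,6)] first_props(1)[of "Suc (Suc j)"]
      in_range by (simp_all add: t2_def)
  have at_t0: "on j t0 OddPeg" "s t0 j = Neutral2"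
    using on_at_departure[OF in_range(1,2), of j] on_Suc[OF first_props(2)[OF in_range(1,2)]]
      not_to_own[OF in_range(1,2)] assms(5) own by (simp_all add: t0_def)
  have "w (first k) \<noteq> j"
    using first_props(2)[OF in_range(3,4)] in_range(5) by simp
  then have at_t1: "on k t1 Neutral2" "s t1 k = EvenPeg" "s t1 j \<noteq> Neutral1"
    using to_own_on[OF in_range(3,4)] on_Suc[OF first_props(2)[OF in_range(3,4)]] k_own own
      unchanged[of "first k" j] first_clear(1)[OF in_range(1,5,4)]
    by (simp_all add: t1_def to_own_def)
  have "on (Suc (Suc j)) t2 Neutral2"
    using to_own_on[OF _ in_range(6)] assms(7) by (simp add: t2_def)
  then have at_t2: "on j t2 Neutral2" "s t2 j = Neutral2"
    using on_Suc_Suc[OF in_range(1)] by simp_all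
  have clear: "s t2 (Suc (Suc q)) \<noteq> Neutral1" "s t2 k \<noteq> Neutral1"
    using first_clear(1)[of "Suc (Suc q)" "Suc (Suc j)"] first_clear(1)[of k "Suc (Suc j)"] in_range
    by (simp_all add: t2_def j_q(1))
  have at_t3: "on k t3 Neutral2" "s t3 k = Neutral2"
    using t3(3) on_Suc_Suc[OF in_range(3)] by (simp_all add: k_def)
  have at_e: "on j e OddPeg" "s e j = OddPeg"
    using end_own on_Suc_Suc[OF in_range(1)] own by simp_all
  interpret congestion s w q "Suc q" "Suc (Suc q)" j k t0 t1 t2 t3 e
    by unfold_locales (use j_q at_t0 at_t1 at_t2 clear at_t3 at_e ts t3 in \<open>simp_all add: k_def t0_def t1_def t2_def\<close>)
  have le: "beta (j - 1) \<le> count_moves w (tower j) 0 (first j) + count_moves w (tower k) 0 (first j)"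
    using moves_before_departure[OF assms(4) in_range(1,2)] assms(5) by (simp add: k_def)
  have "on k (first j) EvenPeg"
    using on_at_departure[OF in_range(1,2), of k] assms(5) own by (simp add: k_def)
  moreover have "on k (first k) Neutral2"
    using to_own_on[OF in_range(3,4)] k_own by simp
  ultimately have K: "4 * P \<le> count_moves w (tower k) (first j) (first k) + 1"
    using tower_cost[of "first j" "first k" k EvenPeg Neutral2] ts heights by simp
  have "1 \<le> count_moves w {k} 0 t1"
    by (rule count_moves_ge_1[of 0 "first k"]) (use first_props(2)[OF in_range(3,4)] in \<open>simp_all add: t1_def\<close>)
  moreover have "count_moves w (tower k) 0 t1 = count_moves w (tower k) 0 (first j)
      + count_moves w (tower k) (first j) (first k) + count_moves w (tower k) (first k) t1"
    using count_moves_split[of 0 "first j" t1 w "tower k"] count_moves_split[of "first j" "first k" t1 w "tower k"] ts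
    by (simp add: t1_def)
  moreover have "count_moves w (tower (Suc (Suc k))) 0 t3 = count_moves w (tower (Suc (Suc k))) 0 t1 + A"
    by (rule count_moves_split) (use ts t3 in \<open>simp_all add: t1_def t2_def\<close>)
  ultimately have total_k: "count_moves w (tower k) 0 (first j) + 4 * P + A \<le> count_moves w (tower (Suc (Suc k))) 0 t3"
    using K count_A[of 0 t1] by linarith
  have "1 \<le> count_moves w {Suc (Suc j)} 0 e"
    by (rule count_moves_ge_1[of 0 t2]) (use first_props(2)[of "Suc (Suc j)"] in_range ts in \<open>simp_all add: t2_def\<close>)
  moreover have "1 \<le> count_moves w {j} 0 t2"
    by (rule count_moves_ge_1[of 0 "first j"]) (use first_props(2)[OF in_range(1,2)] ts in simp_all)
  moreover have "count_moves w (tower j) 0 t2 = count_moves w (tower j) 0 (first j)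
      + count_moves w (tower j) (first j) t0 + B"
    using count_moves_split[of 0 "first j" t2 w "tower j"] count_moves_split[of "first j" t0 t2 w "tower j"] ts
    by (simp add: t0_def)
  moreover have "count_moves w (tower (Suc (Suc j))) 0 e = count_moves w (tower (Suc (Suc j))) 0 t2 + C"
    by (rule count_moves_split) (use ts in simp_all)
  moreover have "count_moves w (tower (Suc (Suc (Suc (Suc j))))) 0 e =
      count_moves w (tower (Suc (Suc j))) 0 e + count_moves w {Suc (Suc j)} 0 e"
    by (rule count_moves_tower_Suc_Suc) simp
  ultimately have "count_moves w (tower j) 0 (first j) + 2 + B + C \<le> count_moves w (tower (Suc (Suc (Suc (Suc j))))) 0 e"
    using count_C[of 0 t2] by linarith
  then show ?thesis
    using total_k le congestion_cost by (simp add: k_def q_def)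
qed

lemma b_step:
  assumes IH: "\<And>k. k < n \<Longrightarrow> b_bound k" and n: "3 \<le> n"
    and at_end: "\<And>d. 1 \<le> d \<Longrightarrow> d \<le> n \<Longrightarrow> s e d = own_peg d"
  shows "beta n \<le> count_moves w {1..n} 0 e"
proof -
  obtain i where i: "n = Suc i" "1 \<le> i" "i \<le> n" "i - 1 < n"
    using n by (cases n) auto
  have n1: "1 \<le> n"
    using n by simp
  have end_on: "on k e (own_peg k)" if "k \<le> n + 2" for k
    unfolding on_def
  proof
    fix d assume d: "d \<in> tower k"
    show "s e d = own_peg k"
      using at_end[OF tower_range[OF d that]] own_peg_tower[OF d] by simp
  qed
  have end_n: "on (Suc (Suc n)) e (own_peg n)" and end_i: "on (Suc n) e (own_peg i)"
    using end_on[of "Suc (Suc n)"] end_on[of "Suc n"] by (simp_all add: own_peg_def i(1))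
  have total: "count_moves w {1..n} 0 e = count_moves w (tower (Suc (Suc n))) 0 e + count_moves w (tower (Suc n)) 0 e"
    by (rule count_moves_upto[OF n1])
  have first_n: "first n < e"
    using first_props(1)[OF n1] by simp
  have first_i: "first i < e"
    using first_props(1)[OF i(2,3)] by simp
  obtain j where j: "1 \<le> j" "j \<le> n" "j = 1 \<or> \<not> to_own j" "\<And>k. j < k \<Longrightarrow> k \<le> n \<Longrightarrow> to_own k"
    using last_neutral_departure[OF n1] by metis
  consider "j = n" | "j = i" | "j + 2 \<le> n"
    using j(2) i(1) by linarith
  then show ?thesis
  proof cases
    case 1
    then have "\<not> to_own n"
      using j(3) n by simp
    then have "count_moves w (tower n) 0 (first n) + 2 * 2 ^ height n \<le> count_moves w (tower (Suc (Suc n))) 0 e"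
      using extend(2)[OF n1 order_refl first_n on_at_departure[of n n] end_n] n1 by (simp add: to_own_def)
    moreover have "count_moves w (tower (Suc n)) 0 (first n) \<le> count_moves w (tower (Suc n)) 0 e"
      by (rule count_moves_mono2) (use first_n in simp_all)
    moreover have "beta (n - 1) \<le> count_moves w (tower n) 0 (first n) + count_moves w (tower (Suc n)) 0 (first n)"
      using moves_before_departure[of n] IH[of "n - 1"] \<open>\<not> to_own n\<close> n1 by simp
    ultimately show ?thesis
      using total beta_le_neutral_last[OF n] by linarith
  next
    case 2
    have own_n: "to_own n"
      using j(4)[of n] 2 i(1) by simp
    have "\<not> to_own i"
      using j(3) 2 i(1) n by simp
    then have "count_moves w (tower i) 0 (first i) + 2 * 2 ^ height i \<le> count_moves w (tower (Suc n)) 0 e"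
      using extend(2)[OF i(2,3) first_i on_at_departure[of i i], of "own_peg i"] end_i i by (simp add: to_own_def)
    moreover have "count_moves w (tower n) 0 (first n) + 2 ^ height n \<le> count_moves w (tower (Suc (Suc n))) 0 e"
      using extend(1)[OF n1 order_refl first_n to_own_on[OF n1 order_refl own_n] end_n] by simp
    moreover have "beta (i - 1) + 2 ^ height n \<le> W n + 1"
      using W_one[of i] IH[OF i(4)] \<open>\<not> to_own i\<close> own_n i by simp
    moreover have "i = n - 1" "i - 1 = n - 2"
      using i(1) by simp_all
    ultimately show ?thesis
      using total beta_le_neutral_last_but_one[OF n] by (simp add: W_def)
  next
    case 3
    have own: "to_own n" "to_own i"
      using j(4)[of n] j(4)[of i] 3 i(1) by simp_all
    have ext_n: "count_moves w (tower n) 0 (first n) + 2 ^ height n \<le> count_moves w (tower (Suc (Suc n))) 0 e"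
      using extend(1)[OF n1 order_refl first_n to_own_on[OF n1 order_refl own(1)] end_n] by simp
    have ext_i: "count_moves w (tower i) 0 (first i) + 2 ^ height i \<le> count_moves w (tower (Suc n)) 0 e"
      using extend(1)[OF i(2,3) first_i to_own_on[OF i(2,3) own(2)], of "own_peg i"] end_i i(1) by simp
    have W: "4 * beta (n - 3) + 4 * 2 ^ height (n - 2) + 4 * 2 ^ height (n - 1)
      \<le> 4 * W n + 4 + (if even n \<and> n = j + 3 then 2 ^ ((n - 4) div 2) else 0)"
      using W_bound[OF IH j(1) 3 j(3) j(4)] by simp
    have bound: "W n + 2 ^ height n + 2 ^ height (n - 1) \<le> count_moves w {1..n} 0 e"
      using ext_n ext_i total by (simp add: W_def i(1))
    show ?thesis
    proof (cases "even n \<and> n = j + 3 \<and> 5 \<le> j")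
      case False
      \<comment> \<open>For \<open>j\<close> equal to 1 or 3 the loss is at most 2 in an inequality
        multiplied by 4, so it vanishes by integrality.\<close>
      have "4 * beta (n - 3) + 4 * 2 ^ height (n - 2) + 4 * 2 ^ height (n - 1) \<le> 4 * W n + 4 + 2"
      proof (cases "even n \<and> n = j + 3")
        case True
        then have "odd j" "j < 5"
          using False by auto
        then have "j = 1 \<or> j = 3"
          using j(1) by presburger
        then have "(n - 4) div 2 = 0 \<or> (n - 4) div 2 = 1"
          using True by auto
        then have "(2::nat) ^ ((n - 4) div 2) \<le> 2"
          by (metis one_le_numeral power_0 power_one_right order_refl)
        then show ?thesis
          using W by (auto split: if_splits)
      qed (use W in auto)
      then have "beta (n - 3) + 2 ^ height (n - 2) + 2 ^ height (n - 1) \<le> W n + 1"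
        by presburger
      then show ?thesis
        using bound beta_rec[OF n] by linarith
    next
      case True
      then have jn: "odd j" "5 \<le> j" "j + 2 \<le> n" "n = Suc (Suc (Suc j))" "j - 1 < n" "j \<noteq> 1"
        by auto
      have "first (Suc (Suc j)) \<le> first n"
        using first_clear(2)[of "Suc (Suc j)" n] jn(4) by simp
      moreover have "on n (first n) Neutral2"
        by (rule to_own_on[OF n1 order_refl own(1)])
      moreover have "on (Suc (Suc j)) e (own_peg j)"
        using end_on[of "Suc (Suc j)"] jn(4) by (simp add: own_peg_def)
      ultimately have "beta (j - 1) + 26 * 2 ^ height (j - 3) \<le>
          count_moves w (tower n) 0 (first n) + count_moves w (tower (Suc n)) 0 e + 1"
        using congested_moves[OF jn(1-3) IH[OF jn(5)], of "first n"] j(3) jn(6) j(4)[of "Suc j"] j(4)[of "Suc (Suc j)"]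
          jn(4) first_n by simp
      then have "beta (j - 1) + 26 * 2 ^ height (j - 3) + 2 ^ height n \<le> count_moves w {1..n} 0 e + 1"
        using ext_n total by simp
      \<comment> \<open>With \<open>P = 2 ^ r\<close> and \<open>2 ^ u = 4 * P\<close> the left side
        exceeds \<open>beta (2 * u)\<close> by at most 5 + 28 = 33 times \<open>P\<close>, the right
        side by 26 + 8 = 34 times. The three-peg bounds alone would give 32.\<close>
      moreover have "beta n + 1 \<le> beta (j - 1) + 26 * 2 ^ height (j - 3) + 2 ^ height n"
      proof -
        obtain u where u: "j = 2 * u + 1"
          using jn(1) by (rule oddE)
        define r where "r = u - 2"
        have n_u: "n = 2 * u + 4"
          using u jn(4) by simp
        have "height (j - 3) = r"
          using u by (simp add: height_def r_def)
        moreover have "u = Suc (Suc r)"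
          using u jn(2) by (simp add: r_def)
        then have "(2::nat) ^ u = 4 * 2 ^ r"
          by simp
        moreover have "j - 1 = 2 * u" "(2::nat) ^ (u + 1) = 2 * 2 ^ u"
          using u by simp_all
        ultimately show ?thesis
          using beta_even[of u] beta_gaps[of u] unfolding n_u double_plus_4(4)[OF refl, of u] by simp
      qed
      ultimately show ?thesis
        by simp
    qed
  qed
qed

end

lemma b_bound_small:
  assumes "n \<le> 2"
  shows "b_bound n"
  unfolding b_bound_def
proof (intro allI impI)
  fix s w e
  assume "play s w" and start: "\<forall>d\<in>{1..n}. s 0 d = Neutral1" and at_end: "\<forall>d\<in>{1..n}. s e d = own_peg d"
  interpret play s w
    by fact
  have move: "1 \<le> count_moves w {d} 0 e" if "1 \<le> d" "d \<le> n" for d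
  proof -
    have "s 0 d = Neutral1" "s e d \<noteq> Neutral1"
      using start at_end that by simp_all
    then obtain i where "i < e" "w i = d"
      using first_exit[of 0 e d Neutral1] by auto
    then show ?thesis
      by (intro count_moves_ge_1[of 0 i]) simp_all
  qed
  consider "n = 0" | "n = 1" | "n = 2"
    using assms by linarith
  then show "beta n \<le> count_moves w {1..n} 0 e"
  proof cases
    case 1
    then show ?thesis by simp
  next
    case 2
    then show ?thesis
      using move[of 1] by simp
  next
    case 3
    have "{1..n} = {1} \<union> {2}"
      using 3 by auto
    moreover have "count_moves w ({1} \<union> {2}) 0 e = count_moves w {1} 0 e + count_moves w {2} 0 e"
      by (rule count_moves_Un) simp
    ultimately show ?thesis
      using move[of 1] move[of 2] 3 by (simp add: numeral_2_eq_2)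
  qed
qed

lemma b_bound: "b_bound n"
proof (induction n rule: less_induct)
  case (less n)
  show ?case
  proof (cases "n \<le> 2")
    case True
    then show ?thesis
      by (rule b_bound_small)
  next
    case False
    show ?thesis
      unfolding b_bound_def
    proof (intro allI impI)
      fix s w e
      assume "play s w" and start: "\<forall>d\<in>{1..n}. s 0 d = Neutral1" and at_end: "\<forall>d\<in>{1..n}. s e d = own_peg d"
      interpret play s w
        by fact
      interpret departure s w n e
        by unfold_locales (use start at_end in simp_all)
      show "beta n \<le> count_moves w {1..n} 0 e"
        by (rule b_step[OF less.IH]) (use False at_end in simp_all)
    qed
  qed
qed

section \<open>Lower bounds for the goals of \<open>c\<close> and \<open>d\<close>, and for half a
  transfer\<close>

lemma two_power: "1 \<le> (2::nat) ^ u" "(2::nat) ^ (u + 1) = 2 * 2 ^ u"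
  by simp_all

lemma height_double_plus: "height (2 * u + 2) = u" "height (2 * u + 3) = u + 1"
  by (simp_all add: height_def)

lemma beta_Suc_le:
  assumes "2 \<le> n"
  shows "beta (n - 1) + 1 \<le> beta (n - 2) + 2 * 2 ^ height n"
proof (cases "n = 2")
  case True
  then show ?thesis
    by (simp add: numeral_2_eq_2 height_def)
next
  case False
  then have "3 \<le> n"
    using assms by simp
  then show ?thesis
  proof (cases rule: double_plus_cases)
    case (1 u)
    then show ?thesis
      using beta_gaps[of u] two_power[of u] unfolding double_plus_3[OF 1] by linarith
  next
    case (2 u)
    then show ?thesis
      using beta_gaps_Suc[of u] two_power[of u] unfolding double_plus_4[OF 2] by linarith
  qed
qed

context departure
begin

text \<open>If disc \<open>n - 1\<close> first goes to its own peg, its class must pass to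
  \<open>Neutral2\<close> afterwards, which makes the tower of \<open>n - 1\<close> come back once
  more. This doubled cost replaces the single one in the bound for \<open>b\<close>.\<close>

lemma hard_cost:
  assumes n: "2 \<le> n" and at_end: "on (Suc (Suc n)) e (own_peg n)" "on (Suc n) e Neutral2"
  shows "beta (n - 2) + 2 * 2 ^ height n + 2 ^ height (n - 1) \<le> count_moves w {1..n} 0 e + 1"
proof -
  obtain i where i: "n = Suc i" "1 \<le> i" "i \<le> n" "i - 1 < n" "n - 1 = i" "n - 2 = i - 1"
    using n by (cases n) auto
  have n1: "1 \<le> n"
    using n by simp
  have end_i: "on (Suc (Suc i)) e Neutral2"
    using at_end(2) by (simp add: i(1))
  have total: "count_moves w {1..n} 0 e = count_moves w (tower (Suc (Suc n))) 0 e + count_moves w (tower (Suc n)) 0 e"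
    by (rule count_moves_upto[OF n1])
  have first_n: "first n < e"
    using first_props(1)[OF n1] by simp
  have first_i: "first i < e"
    using first_props(1)[OF i(2,3)] by simp
  obtain j where j: "1 \<le> j" "j \<le> n" "j = 1 \<or> \<not> to_own j" "\<And>k. j < k \<Longrightarrow> k \<le> n \<Longrightarrow> to_own k"
    using last_neutral_departure[OF n1] by metis
  consider "j = n" | "j = i" | "j + 2 \<le> n"
    using j(2) i(1) by linarith
  then show ?thesis
  proof cases
    case 1
    then have not_own: "\<not> to_own n"
      using j(3) n by simp
    then have "count_moves w (tower n) 0 (first n) + 2 * 2 ^ height n \<le> count_moves w (tower (Suc (Suc n))) 0 e"
      using extend(2)[OF n1 order_refl first_n on_at_departure[of n n] at_end(1)] n1 by (simp add: to_own_def)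
    moreover have "2 ^ height (Suc n) \<le> count_moves w (tower (Suc n)) (first n) e + 1"
      using tower_cost[OF less_imp_le[OF first_n] on_at_departure[of n "Suc n"] at_end(2)] not_own n1 by simp
    moreover have "count_moves w (tower (Suc n)) 0 e =
        count_moves w (tower (Suc n)) 0 (first n) + count_moves w (tower (Suc n)) (first n) e"
      by (rule count_moves_split) (use first_n in simp_all)
    moreover have "beta (n - 1) \<le> count_moves w (tower n) 0 (first n) + count_moves w (tower (Suc n)) 0 (first n)"
      using moves_before_departure[OF b_bound, of n] not_own n1 by simp
    moreover have "(2::nat) ^ height (Suc n) = 2 * 2 ^ height (n - 1)"
      using height_Suc_Suc[OF i(2)] i by simp
    moreover have "beta (n - 2) \<le> beta (n - 1)"
      using beta_Suc[of "n - 2"] n by (simp add: Suc_diff_Suc numeral_2_eq_2)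
    ultimately show ?thesis
      using total by linarith
  next
    case 2
    have own_n: "to_own n"
      using j(4)[of n] 2 i(1) by simp
    have j_i: "i = 1 \<or> \<not> to_own i"
      using j(3) 2 by simp
    have "count_moves w (tower i) 0 (first i) + 2 ^ height i \<le> count_moves w (tower (Suc n)) 0 e"
      using extend(1)[OF i(2,3) first_i on_at_departure[of i i] end_i] j_i i by simp
    moreover have "count_moves w (tower n) 0 (first n) + 2 ^ height n \<le> count_moves w (tower (Suc (Suc n))) 0 e"
      using extend(1)[OF n1 order_refl first_n to_own_on[OF n1 order_refl own_n] at_end(1)] by simp
    moreover have "beta (i - 1) + 2 ^ height n \<le> W n + 1"
      using W_one[OF b_bound, of i] j_i own_n i by simp
    ultimately show ?thesis
      using total i(1,5,6) by (simp add: W_def)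
  next
    case 3
    have own: "to_own n" "to_own i"
      using j(4)[of n] j(4)[of i] 3 i(1) by simp_all
    have "count_moves w (tower n) 0 (first n) + 2 ^ height n \<le> count_moves w (tower (Suc (Suc n))) 0 e"
      using extend(1)[OF n1 order_refl first_n to_own_on[OF n1 order_refl own(1)] at_end(1)] by simp
    moreover have "count_moves w (tower i) 0 (first i) + 2 * 2 ^ height i \<le> count_moves w (tower (Suc n)) 0 e"
      using extend(2)[OF i(2,3) first_i to_own_on[OF i(2,3) own(2)] end_i] own(2) i(1) by (simp add: to_own_def)
    ultimately have bound: "W n + 2 ^ height n + 2 * 2 ^ height (n - 1) \<le> count_moves w {1..n} 0 e"
      using total by (simp add: W_def i(1))
    have W: "4 * beta (n - 3) + 4 * 2 ^ height (n - 2) + 4 * 2 ^ height (n - 1)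
      + (if odd n \<and> n \<noteq> j + 2 then 2 ^ ((n - 3) div 2) else 0)
      \<le> 4 * W n + 4 + (if even n \<and> n = j + 3 then 2 ^ ((n - 4) div 2) else 0)"
      by (rule W_bound[OF b_bound j(1) 3 j(3) j(4)])
    have n3: "3 \<le> n"
      using 3 j(1) by simp
    then show ?thesis
    proof (cases rule: double_plus_cases)
      case (1 u)
      note e = double_plus_3[OF 1]
      have pow: "(2::nat) ^ (u + 1) = 2 * 2 ^ u"
        by simp
      show ?thesis
      proof (cases "n = j + 2")
        case False
        \<comment> \<open>The gain of \<open>run_bound\<close> is exactly the quarter needed when
          \<open>beta (2 * u)\<close> is replaced by \<open>beta (2 * u + 1)\<close>.\<close>
        then have "4 * beta (2 * u) + 9 * 2 ^ u \<le> 4 * W n + 4"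
          using W e(8) unfolding e by simp
        then show ?thesis
          using bound beta_gaps[of u] unfolding e pow by simp
      next
        case True
        then have j_u: "j = 2 * u + 1"
          using 1 by simp
        have "4 * beta (2 * u) + 8 * 2 ^ u \<le> 4 * W n + 4"
          using W e(8) True unfolding e by simp
        \<comment> \<open>For \<open>u \<le> 1\<close> the gap of \<open>beta\<close> is
          \<open>2 ^ u\<close> and nothing is lost. From \<open>u = 2\<close> on, \<open>j\<close>
          is at least 5 and the congestion applies: with \<open>P = 2 ^ (u - 2)\<close>, at most 5 +
          20 = 25 times \<open>P\<close> is needed and 26 times is available.\<close>
        show ?thesis
        proof (cases "u \<le> 1")
          case True
          have "beta 2 = 2" "beta 3 = 4"
            using beta_odd[of 0] by (simp_all add: numeral_2_eq_2)
          then have "beta (2 * u + 1) \<le> beta (2 * u) + 2 ^ u"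
            using True by (cases u) auto
          then show ?thesis
            using bound \<open>4 * beta (2 * u) + 8 * 2 ^ u \<le> 4 * W n + 4\<close> unfolding e pow by simp
        next
          case False
          define r where "r = u - 2"
          have j5: "odd j" "5 \<le> j" "j + 2 \<le> n" "n = Suc (Suc j)" "j \<noteq> 1"
            using j_u False 1 by simp_all
          have "on (Suc (Suc j)) e (own_peg j)" "on (Suc (Suc (Suc j))) e Neutral2"
          proof -
            show "on (Suc (Suc (Suc j))) e Neutral2"
              using at_end(2) j5(4) by simp
            have "own_peg j = own_peg n"
              using j5(4) by (simp add: own_peg_def)
            moreover have "on n e (own_peg n)"
              using at_end(1) on_Suc_Suc[OF n1] by simp
            ultimately show "on (Suc (Suc j)) e (own_peg j)"
              using j5(4) by simp
          qed
          then have "beta (j - 1) + 26 * 2 ^ height (j - 3) \<le>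
              count_moves w (tower (Suc n)) 0 e + count_moves w (tower (Suc (Suc n))) 0 e + 1"
            using congested_moves[OF j5(1-3) b_bound, of e] j(3) j5(5) j(4)[of "Suc j"] j(4)[of "Suc (Suc j)"]
              j5(4) first_n by simp
          moreover have "height (j - 3) = r" "j - 1 = 2 * u"
            using j_u by (simp_all add: height_def r_def)
          moreover have "u = Suc (Suc r)"
            using False by (simp add: r_def)
          then have "(2::nat) ^ u = 4 * 2 ^ r"
            by simp
          ultimately show ?thesis
            using total beta_gaps[of u] unfolding e pow by simp
        qed
      qed
    next
      case (2 u)
      note e = double_plus_4[OF 2]
      have "4 * beta (2 * u + 1) + 12 * 2 ^ u \<le> 4 * W n + 4 + 2 ^ u"
        using W e(8) unfolding e by (cases "n = j + 3") simp_all
      then show ?thesis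
        using bound beta_gaps[of u] unfolding e by simp
    qed
  qed
qed

text \<open>The class of \<open>n\<close> ends on \<open>Neutral2\<close>, so a departure of
  \<open>n\<close> to its own peg costs its tower a return. This leaves enough room to absorb the
  loss in \<open>run_bound\<close> without the congestion argument.\<close>

lemma easy_cost:
  assumes n: "2 \<le> n" and at_end: "on (Suc (Suc n)) e Neutral2" "on (Suc n) e (own_peg (Suc n))"
  shows "beta (n - 1) + 2 ^ height n \<le> count_moves w {1..n} 0 e"
proof -
  obtain i where i: "n = Suc i" "1 \<le> i" "i \<le> n" "i - 1 < n" "n - 1 = i" "n - 2 = i - 1"
    using n by (cases n) auto
  have n1: "1 \<le> n"
    using n by simp
  have end_i: "on (Suc (Suc i)) e (own_peg (Suc n))"
    using at_end(2) by (simp add: i(1))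
  have total: "count_moves w {1..n} 0 e = count_moves w (tower (Suc (Suc n))) 0 e + count_moves w (tower (Suc n)) 0 e"
    by (rule count_moves_upto[OF n1])
  have first_n: "first n < e"
    using first_props(1)[OF n1] by simp
  have first_i: "first i < e"
    using first_props(1)[OF i(2,3)] by simp
  obtain j where j: "1 \<le> j" "j \<le> n" "j = 1 \<or> \<not> to_own j" "\<And>k. j < k \<Longrightarrow> k \<le> n \<Longrightarrow> to_own k"
    using last_neutral_departure[OF n1] by metis
  consider "j = n" | "j = i" | "j + 2 \<le> n"
    using j(2) i(1) by linarith
  then show ?thesis
  proof cases
    case 1
    then have not_own: "\<not> to_own n"
      using j(3) n by simp
    then have "count_moves w (tower n) 0 (first n) + 2 ^ height n \<le> count_moves w (tower (Suc (Suc n))) 0 e"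
      using extend(1)[OF n1 order_refl first_n on_at_departure[of n n] at_end(1)] n1 by simp
    moreover have "count_moves w (tower (Suc n)) 0 (first n) \<le> count_moves w (tower (Suc n)) 0 e"
      by (rule count_moves_mono2) (use first_n in simp_all)
    moreover have "beta (n - 1) \<le> count_moves w (tower n) 0 (first n) + count_moves w (tower (Suc n)) 0 (first n)"
      using moves_before_departure[OF b_bound, of n] not_own n1 by simp
    ultimately show ?thesis
      using total by linarith
  next
    case 2
    have own_n: "to_own n"
      using j(4)[of n] 2 i(1) by simp
    have j_i: "i = 1 \<or> \<not> to_own i"
      using j(3) 2 by simp
    have "count_moves w (tower i) 0 (first i) \<le> count_moves w (tower (Suc n)) 0 e"
      by (rule count_moves_mono2) (use first_i tower_Suc_Suc[OF i(2)] i(1) in auto)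
    moreover have "count_moves w (tower n) 0 (first n) + 2 * 2 ^ height n \<le> count_moves w (tower (Suc (Suc n))) 0 e"
      using extend(2)[OF n1 order_refl first_n to_own_on[OF n1 order_refl own_n] at_end(1)] own_n
      by (simp add: to_own_def)
    moreover have "beta (i - 1) + 2 ^ height n \<le> W n + 1"
      using W_one[OF b_bound, of i] j_i own_n i by simp
    moreover have "W n = count_moves w (tower n) 0 (first n) + count_moves w (tower i) 0 (first i)"
      by (simp add: W_def i(1))
    ultimately show ?thesis
      using total beta_Suc_le[OF n] unfolding i(5,6) by linarith
  next
    case 3
    have own: "to_own n" "to_own i"
      using j(4)[of n] j(4)[of i] 3 i(1) by simp_all
    have "count_moves w (tower n) 0 (first n) + 2 * 2 ^ height n \<le> count_moves w (tower (Suc (Suc n))) 0 e"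
      using extend(2)[OF n1 order_refl first_n to_own_on[OF n1 order_refl own(1)] at_end(1)] own
      by (simp add: to_own_def)
    moreover have "count_moves w (tower i) 0 (first i) + 2 ^ height i \<le> count_moves w (tower (Suc n)) 0 e"
      using extend(1)[OF i(2,3) first_i to_own_on[OF i(2,3) own(2)] end_i] i(1) by simp
    ultimately have bound: "W n + 2 * 2 ^ height n + 2 ^ height (n - 1) \<le> count_moves w {1..n} 0 e"
      using total by (simp add: W_def i(1))
    have W: "4 * beta (n - 3) + 4 * 2 ^ height (n - 2) + 4 * 2 ^ height (n - 1)
      \<le> 4 * W n + 4 + (if even n \<and> n = j + 3 then 2 ^ ((n - 4) div 2) else 0)"
      using W_bound[OF b_bound j(1) 3 j(3) j(4)] by simp
    have n3: "3 \<le> n"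
      using 3 j(1) by simp
    then show ?thesis
    proof (cases rule: double_plus_cases)
      case (1 u)
      note e = double_plus_3[OF 1]
      have "4 * beta (2 * u) + 8 * 2 ^ u \<le> 4 * W n + 4"
        using W e(8) unfolding e by simp
      then show ?thesis
        using bound beta_gaps[of u] two_power[of u] unfolding e by linarith
    next
      case (2 u)
      note e = double_plus_4[OF 2]
      have "4 * beta (2 * u + 1) + 12 * 2 ^ u \<le> 4 * W n + 4 + 2 ^ u"
        using W e(8) unfolding e by (cases "n = j + 3") simp_all
      then show ?thesis
        using bound beta_gaps[of u] beta_gaps_Suc[of u] two_power[of u] unfolding e by linarith
    qed
  qed
qed

text \<open>To be applied to a play that moves all discs from \<open>Neutral1\<close> to \<open>Neutral2\<close> and to its reversal.\<close>

lemma half_transfer: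
  assumes n: "2 \<le> n" and own_n: "to_own n"
  shows "beta (n - 2) + 2 ^ height n \<le> W n + 1 \<and> on (n - 1) (first (n - 1)) (own_peg (n - 1)) \<or>
    3 \<le> n \<and> on (n - 1) (first (n - 1)) Neutral2 \<and>
    4 * beta (n - 3) + 4 * 2 ^ height (n - 2) + 4 * 2 ^ height (n - 1)
      \<le> 4 * W n + 4 + (if even n then 2 ^ ((n - 4) div 2) else 0)"
proof -
  obtain i where i: "n = Suc i" "1 \<le> i" "i \<le> n" "i - 1 < n" "n - 1 = i" "n - 2 = i - 1"
    using n by (cases n) auto
  have n1: "1 \<le> n"
    using n by simp
  obtain j where j: "1 \<le> j" "j \<le> n" "j = 1 \<or> \<not> to_own j" "\<And>k. j < k \<Longrightarrow> k \<le> n \<Longrightarrow> to_own k"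
    using last_neutral_departure[OF n1] by metis
  consider "j = i" | "j + 2 \<le> n"
    using j(2,3) i(1,2) own_n n by (metis Suc_leI add_2_eq_Suc' le_antisym le_less not_less_eq_eq
        numeral_2_eq_2 order_refl not_less_eq)
  then show ?thesis
  proof cases
    case 1
    then have j_i: "i = 1 \<or> \<not> to_own i"
      using j(3) by simp
    have "beta (i - 1) + 2 ^ height n \<le> W n + 1"
      using W_one[OF b_bound, of i] j_i own_n i by simp
    moreover have "on i (first i) (own_peg i)"
      by (rule on_at_departure[OF i(2,3) j_i]) simp
    ultimately show ?thesis
      using i by simp
  next
    case 2
    have "to_own i"
      using j(4)[of i] 2 i(1) by simp
    then have "on i (first i) Neutral2"
      by (rule to_own_on[OF i(2,3)])
    moreover have "4 * beta (n - 3) + 4 * 2 ^ height (n - 2) + 4 * 2 ^ height (n - 1)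
      \<le> 4 * W n + 4 + (if even n then 2 ^ ((n - 4) div 2) else 0)"
      using W_bound[OF b_bound j(1) 2 j(3) j(4)] by (auto split: if_splits)
    ultimately show ?thesis
      using 2 j(1) i by simp
  qed
qed

end

subsection \<open>Reversal and transfers between the neutral pegs\<close>

text \<open>Exchanging the neutral pegs turns a reversed transfer into one that starts on
  \<open>Neutral1\<close> again.\<close>

fun swap_peg :: "peg \<Rightarrow> peg" where
  "swap_peg Neutral1 = Neutral2"
| "swap_peg Neutral2 = Neutral1"
| "swap_peg p = p"

lemma swap_peg_swap_peg [simp]: "swap_peg (swap_peg p) = p"
  by (cases p) simp_all

lemma swap_peg_inject [simp]: "swap_peg p = swap_peg q \<longleftrightarrow> p = q"
  by (metis swap_peg_swap_peg)

lemma swap_peg_eq_iff [simp]: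
  "swap_peg p = Neutral1 \<longleftrightarrow> p = Neutral2" "swap_peg p = Neutral2 \<longleftrightarrow> p = Neutral1"
  by (cases p; simp)+

lemma swap_own_peg [simp]: "swap_peg (own_peg d) = own_peg d"
  by (simp add: own_peg_def)

lemma swap_peg_allowed [simp]: "swap_peg p \<in> allowed_pegs d \<longleftrightarrow> p \<in> allowed_pegs d"
  by (cases p) (auto simp: allowed_pegs_def)

lemma moves_disc_sym: "moves_disc d s t \<Longrightarrow> moves_disc d t s"
proof -
  assume m: "moves_disc d s t"
  then have t: "t = s(d := t d)"
    by (simp add: moves_disc_def)
  have same: "t e = s e" if "e \<noteq> d" for e
    using that by (subst t) simp
  then have "s = t(d := s d)"
    by auto
  then show ?thesis
    using m same by (auto simp: moves_disc_def)
qed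

lemma moves_disc_swap:
  assumes "moves_disc d s t"
  shows "moves_disc d (swap_peg \<circ> s) (swap_peg \<circ> t)"
proof -
  have t: "t = s(d := t d)"
    using assms by (simp add: moves_disc_def)
  have "swap_peg \<circ> t = (swap_peg \<circ> s)(d := swap_peg (t d))"
    by (subst t) auto
  then show ?thesis
    using assms by (auto simp: moves_disc_def)
qed

text \<open>For \<open>i \<ge> e\<close> the truncated subtraction keeps the reversed play in its final state.\<close>

definition rev_states :: "(nat \<Rightarrow> nat \<Rightarrow> peg) \<Rightarrow> nat \<Rightarrow> nat \<Rightarrow> nat \<Rightarrow> peg" where
  "rev_states s e i = swap_peg \<circ> s (e - i)"

definition rev_discs :: "(nat \<Rightarrow> nat) \<Rightarrow> nat \<Rightarrow> nat \<Rightarrow> nat" where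
  "rev_discs w e i = (if i < e then w (e - Suc i) else 0)"

lemma count_moves_rev:
  assumes "b \<le> e" "0 \<notin> S"
  shows "count_moves (rev_discs w e) S 0 b = count_moves w S (e - b) e"
proof -
  have "bij_betw (\<lambda>i. e - Suc i) {i. 0 \<le> i \<and> i < b \<and> rev_discs w e i \<in> S} {i. e - b \<le> i \<and> i < e \<and> w i \<in> S}"
    by (rule bij_betw_byWitness[where f' = "\<lambda>i. e - Suc i"]) (use assms in \<open>auto simp: rev_discs_def\<close>)
  then show ?thesis
    unfolding count_moves_def by (rule bij_betw_same_card)
qed

context play
begin

lemma play_rev: "play (rev_states s e) (rev_discs w e)"
proof
  show "rev_states s e 0 d \<in> allowed_pegs d" if "1 \<le> d" for d
    using allowed[OF that] by (simp add: rev_states_def)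
  show "rev_states s e (Suc i) = rev_states s e i" if "rev_discs w e i = 0" for i
  proof (cases "i < e")
    case True
    then have "w (e - Suc i) = 0" "e - i = Suc (e - Suc i)"
      using that by (auto simp: rev_discs_def)
    then show ?thesis
      using idle[of "e - Suc i"] by (simp add: rev_states_def)
  qed (simp add: rev_states_def)
  show "moves_disc (rev_discs w e i) (rev_states s e i) (rev_states s e (Suc i))" if "1 \<le> rev_discs w e i" for i
  proof -
    have i: "i < e" "rev_discs w e i = w (e - Suc i)" "e - i = Suc (e - Suc i)"
      using that by (auto simp: rev_discs_def split: if_splits)
    show ?thesis
      using moves_disc_swap[OF moves_disc_sym[OF active[of "e - Suc i"]]] that
      unfolding rev_states_def i(2) i(3) by simp
  qed
qed

end

section \<open>Lower bound for \<open>a\<close>\<close>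

lemma transfer_numeric:
  assumes "3 \<le> n"
    and "4 * beta (n - 3) + 4 * 2 ^ height (n - 2) + 4 * 2 ^ height (n - 1)
      \<le> 4 * W + 4 + (if even n then 2 ^ ((n - 4) div 2) else 0)"
    and "4 * beta (n - 3) + 4 * 2 ^ height (n - 2) + 4 * 2 ^ height (n - 1)
      \<le> 4 * W' + 4 + (if even n then 2 ^ ((n - 4) div 2) else 0)"
  shows "2 * beta (n - 1) + 1 \<le> W + W' + 2 ^ height n + 2 ^ height (n - 1) + 2"
  using assms(1)
proof (cases rule: double_plus_cases)
  case (1 u)
  note e = double_plus_3[OF 1]
  have W: "4 * beta (2 * u) + 8 * 2 ^ u \<le> 4 * W + 4" "4 * beta (2 * u) + 8 * 2 ^ u \<le> 4 * W' + 4"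
    using assms(2,3) e(8) unfolding e by simp_all
  show ?thesis
  proof (cases u)
    case 0
    then show ?thesis
      using W unfolding e by (simp add: numeral_2_eq_2)
  next
    case (Suc v)
    then have "2 \<le> (2::nat) ^ u"
      by simp
    then show ?thesis
      using W beta_gaps[of u] unfolding e height_double_plus two_power by linarith
  qed
next
  case (2 u)
  note e = double_plus_4[OF 2]
  have W: "4 * beta (2 * u + 1) + 12 * 2 ^ u \<le> 4 * W + 4 + 2 ^ u" "4 * beta (2 * u + 1) + 12 * 2 ^ u \<le> 4 * W' + 4 + 2 ^ u"
    using assms(2,3) e(8) unfolding e by simp_all
  show ?thesis
  proof (cases u)
    case 0
    then show ?thesis
      using W beta_odd[of 0] unfolding e by simp
  next
    case (Suc v)
    then have "2 \<le> (2::nat) ^ u"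
      by simp
    then show ?thesis
      using W beta_gaps[of u] beta_gaps_Suc[of u] unfolding e height_double_plus two_power by linarith
  qed
qed

lemma transfer_numeric_own:
  assumes "2 \<le> n"
  shows "2 * beta (n - 1) \<le> 2 * beta (n - 2) + 3 * 2 ^ height n"
proof (cases "n = 2")
  case True
  then show ?thesis
    by (simp add: height_def)
next
  case False
  then have "3 \<le> n"
    using assms by simp
  then show ?thesis
  proof (cases rule: double_plus_cases)
    case (1 u)
    then show ?thesis
      using beta_gaps[of u] unfolding double_plus_3[OF 1] by simp
  next
    case (2 u)
    then show ?thesis
      using beta_gaps_Suc[of u] unfolding double_plus_4[OF 2] by simp
  qed
qed

text \<open>For the mixed case of \<open>transfer_cost\<close>: if only one half is of the first
  kind, its bound is brought to the form of the other.\<close>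

lemma half_transfer_weaken:
  assumes "3 \<le> n" "beta (n - 2) + 2 ^ height n \<le> W + 1"
  shows "4 * beta (n - 3) + 4 * 2 ^ height (n - 2) + 4 * 2 ^ height (n - 1)
      \<le> 4 * W + 4 + (if even n then 2 ^ ((n - 4) div 2) else 0)"
  using assms(1)
proof (cases rule: double_plus_cases)
  case (1 u)
  then show ?thesis
    using beta_gaps[of u] assms(2) unfolding double_plus_3[OF 1] by simp
next
  case (2 u)
  then show ?thesis
    using beta_gaps[of u] assms(2) unfolding double_plus_4[OF 2] by simp
qed

text \<open>Without a direct move of disc \<open>n\<close>, both ends are bounded by
  \<open>W\<close>, and the middle remains: the tower of \<open>n\<close> is on
  \<open>Neutral2\<close> after the front part and on \<open>Neutral1\<close> before the back part,
  and the tower of \<open>n - 1\<close> must cross too unless it is on its own peg both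
  times.\<close>

lemma transfer_cost:
  assumes "play s w" and n: "2 \<le> n"
    and start: "\<And>d. 1 \<le> d \<Longrightarrow> d \<le> n \<Longrightarrow> s 0 d = Neutral1"
    and at_end: "\<And>d. 1 \<le> d \<Longrightarrow> d \<le> n \<Longrightarrow> s e d = Neutral2"
  shows "2 * beta (n - 1) + 1 \<le> count_moves w {1..n} 0 e"
proof -
  interpret D: departure s w n e
    by (rule departure.intro[OF assms(1)], unfold_locales) (simp_all add: start at_end)
  define s' w' where "s' = rev_states s e" and "w' = rev_discs w e"
  have play': "play s' w'"
    unfolding s'_def w'_def by (rule D.play_rev)
  interpret R: departure s' w' n e
    by (rule departure.intro[OF play'], unfold_locales) (simp_all add: start at_end s'_def rev_states_def)
  have s': "s' i d = swap_peg (s (e - i) d)" for i d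
    by (simp add: s'_def rev_states_def)
  have on': "D.on k (e - i) (swap_peg x)" if "R.on k i x" for k i x
    unfolding D.on_def
  proof
    fix d assume "d \<in> tower k"
    then have "swap_peg (s (e - i) d) = x"
      using R.onD[OF that] s' by simp
    then show "s (e - i) d = swap_peg x"
      by auto
  qed
  have n1: "1 \<le> n"
    using n by simp
  obtain i where i: "n = Suc i" "1 \<le> i" "i \<le> n" "i < n" "n - 1 = i"
    using n by (cases n) auto
  show ?thesis
  proof (cases "\<exists>c. c < e \<and> w c = n \<and> s c n \<noteq> own_peg n \<and> s (Suc c) n \<noteq> own_peg n")
    case True
    then obtain c where c: "c < e" "w c = n" "s c n \<noteq> own_peg n" "s (Suc c) n \<noteq> own_peg n"
      by blast
    have own: "s c d = own_peg d" "s (Suc c) d = own_peg d" if "1 \<le> d" "d \<le> i" for d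
      using D.neutral_move[OF c(2-4) that(1)] D.unchanged[of c d] that(2) c(2) i(1) by simp_all
    have "beta i \<le> count_moves w {1..i} 0 c"
      by (rule b_boundD[OF b_bound assms(1)]) (use start own i in simp_all)
    moreover have "beta i \<le> count_moves w' {1..i} 0 (e - Suc c)"
      by (rule b_boundD[OF b_bound play']) (use at_end own i c(1) s' in simp_all)
    then have "beta i \<le> count_moves w {1..i} (Suc c) e"
      using count_moves_rev[of "e - Suc c" e "{1..i}" w] c(1) by (simp add: w'_def)
    moreover have "count_moves w {1..i} 0 e = count_moves w {1..i} 0 c + count_moves w {1..i} c (Suc c)
        + count_moves w {1..i} (Suc c) e"
      using count_moves_split[of 0 c e w "{1..i}"] count_moves_split[of c "Suc c" e w "{1..i}"] c(1) by simp
    moreover have "1 \<le> count_moves w {n} 0 e"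
      by (rule count_moves_ge_1[of 0 c]) (use c in simp_all)
    moreover have "count_moves w {1..n} 0 e = count_moves w ({1..i} \<union> {n}) 0 e"
      by (rule arg_cong[where f = "\<lambda>S. count_moves w S 0 e"]) (use i in auto)
    moreover have "count_moves w ({1..i} \<union> {n}) 0 e = count_moves w {1..i} 0 e + count_moves w {n} 0 e"
      by (rule count_moves_Un) (use i(1) in simp)
    ultimately show ?thesis
      unfolding i(5) by linarith
  next
    case False
    define p p' q q' where "p = D.first n" and "p' = R.first n" and "q = D.first i" and "q' = R.first i"
    have p: "p < e" "w p = n" "s p n = Neutral1"
      using D.first_props[OF n1 order_refl] by (simp_all add: p_def)
    have p': "p' < e" "w' p' = n" "s' p' n = Neutral1"
      using R.first_props[OF n1 order_refl] by (simp_all add: p'_def)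
    have q: "q < p" "w q = i"
      using D.first_clear(2)[OF i(2,4) order_refl] D.first_props(2)[OF i(2,3)] by (simp_all add: p_def q_def)
    have q': "q' < p'" "w' q' = i"
      using R.first_clear(2)[OF i(2,4) order_refl] R.first_props(2)[OF i(2,3)] by (simp_all add: p'_def q'_def)
    have w_back: "w (e - Suc p') = n" "w (e - Suc q') = i"
      using p' q' by (simp_all add: w'_def rev_discs_def)
    have mirror: "e - p' = Suc (e - Suc p')" "e - Suc p' < e"
      using p' by simp_all
    have own: "D.to_own n"
      using False p D.first_props(4)[OF n1 order_refl] D.not_to_own[OF n1 order_refl] unfolding p_def
      by (metis own_peg_neq(3,4))
    have s_back: "s (e - p') n = Neutral2"
      using p'(3) s' by simp
    have "s (e - Suc p') n = own_peg n"
    proof (rule ccontr)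
      assume "s (e - Suc p') n \<noteq> own_peg n"
      then show False
        using False w_back(1) s_back mirror by (metis own_peg_neq(4))
    qed
    then have own': "R.to_own n"
      using s' by (simp add: R.to_own_def p'_def[symmetric])
    have order: "p < e - Suc p'"
    proof (rule ccontr)
      assume "\<not> p < e - Suc p'"
      then have "s (e - Suc p') n = Neutral1"
        using D.first_props(5)[OF n1 order_refl, of "e - Suc p'"] by (simp add: p_def)
      then show False
        using \<open>s (e - Suc p') n = own_peg n\<close> by simp
    qed
    have count': "count_moves w' (tower k) 0 c = count_moves w (tower k) (e - c) e" if "c < e" for k c
      using count_moves_rev[of c e "tower k" w] that by (simp add: w'_def tower_def)
    have n_moves: "2 \<le> count_moves w {n} 0 e"
      by (rule count_moves_ge_2[of 0 p "e - Suc p'"]) (use p w_back order mirror in simp_all)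
    have i_moves: "2 \<le> count_moves w {i} 0 e"
      by (rule count_moves_ge_2[of 0 q "e - Suc q'"]) (use q q' p' w_back order mirror in simp_all)
    have "D.on n (e - p') Neutral1"
      using on'[OF R.to_own_on[OF n1 order_refl own']] by (simp add: p'_def)
    then have mid_n: "2 ^ height n \<le> count_moves w (tower n) p (e - p') + 1"
      using D.tower_cost[of p "e - p'" n Neutral2 Neutral1] D.to_own_on[OF n1 order_refl own] order mirror
      by (simp add: p_def)
    have split_n: "count_moves w (tower n) 0 e = count_moves w (tower n) 0 p
        + count_moves w (tower n) p (e - p') + count_moves w' (tower n) 0 p'"
      using count_moves_split[of 0 p e w "tower n"] count_moves_split[of p "e - p'" e w "tower n"]
        count'[OF p'(1)] p order mirror by simp
    have split_i: "count_moves w (tower i) 0 e = count_moves w (tower i) 0 q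
        + count_moves w (tower i) q (e - q') + count_moves w' (tower i) 0 q'"
      using count_moves_split[of 0 q e w "tower i"] count_moves_split[of q "e - q'" e w "tower i"]
        count'[of q'] p p' q q' order mirror by simp
    have W: "D.W n = count_moves w (tower n) 0 p + count_moves w (tower i) 0 q"
      "R.W n = count_moves w' (tower n) 0 p' + count_moves w' (tower i) 0 q'"
      by (simp_all add: D.W_def R.W_def p_def q_def p'_def q'_def i(1))
    \<comment> \<open>Discs \<open>n\<close> and \<open>n - 1\<close> move at least twice each, and
      1 is lost in \<open>mid_n\<close>, hence the 3.\<close>
    have total: "D.W n + R.W n + 2 ^ height n + count_moves w (tower i) q (e - q') + 3 \<le> count_moves w {1..n} 0 e"
      using count_moves_upto[OF n1, of w 0 e] count_moves_tower_Suc_Suc[OF n1, of w 0 e]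
        count_moves_tower_Suc_Suc[OF i(2), of w 0 e] n_moves i_moves mid_n split_n split_i W
      unfolding i(1) by linarith
    define weak where "weak V \<longleftrightarrow> 4 * beta (n - 3) + 4 * 2 ^ height (n - 2) + 4 * 2 ^ height (n - 1)
      \<le> 4 * V + 4 + (if even n then 2 ^ ((n - 4) div 2) else 0)" for V
    have D: "beta (n - 2) + 2 ^ height n \<le> D.W n + 1 \<and> D.on i q (own_peg i) \<or>
        3 \<le> n \<and> D.on i q Neutral2 \<and> weak (D.W n)"
      using D.half_transfer[OF n own] unfolding weak_def q_def i(5) .
    have "beta (n - 2) + 2 ^ height n \<le> R.W n + 1 \<and> R.on i q' (own_peg i) \<or>
        3 \<le> n \<and> R.on i q' Neutral2 \<and> weak (R.W n)"
      using R.half_transfer[OF n own'] unfolding weak_def q'_def i(5) .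
    then have R: "beta (n - 2) + 2 ^ height n \<le> R.W n + 1 \<and> D.on i (e - q') (own_peg i) \<or>
        3 \<le> n \<and> D.on i (e - q') Neutral1 \<and> weak (R.W n)"
      using on'[of i q' "own_peg i"] on'[of i q' Neutral2] by auto
    show ?thesis
    proof (cases "D.on i q (own_peg i) \<and> D.on i (e - q') (own_peg i) \<and>
        beta (n - 2) + 2 ^ height n \<le> D.W n + 1 \<and> beta (n - 2) + 2 ^ height n \<le> R.W n + 1")
      case True
      then show ?thesis
        using total transfer_numeric_own[OF n] by linarith
    next
      case False
      then have n3: "3 \<le> n"
        using D R by blast
      have weak: "weak (D.W n)" "weak (R.W n)"
        using D R half_transfer_weaken[OF n3, folded weak_def] by blast+
      \<comment> \<open>At least one half is of the second kind. It puts the tower on a neutral peg,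
        \<open>Neutral2\<close> in front and \<open>Neutral1\<close> behind, so the two positions
        differ.\<close>
      obtain x y where "D.on i q x" "D.on i (e - q') y" "x \<noteq> y"
        using D R False by (metis own_peg_neq(1,2) peg.distinct(5))
      moreover have "q \<le> e - q'"
        using q q' p' order by simp
      ultimately have "2 ^ height i \<le> count_moves w (tower i) q (e - q') + 1"
        using D.tower_cost by blast
      then show ?thesis
        using total transfer_numeric[OF n3, folded weak_def, OF weak] unfolding i(5) by linarith
    qed
  qed
qed

subsection \<open>Optimal solutions\<close>

text \<open>Membership in \<open>states n\<close> is not demanded, so a solution for few discs can
  be used unchanged among more discs.\<close>

definition steps :: "nat \<Rightarrow> ((nat \<Rightarrow> peg) \<times> (nat \<Rightarrow> peg)) set" where
  "steps n = {(s, t). \<exists>d. d \<le> n \<and> moves_disc d s t}"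

lemma steps_mono: "m \<le> n \<Longrightarrow> steps m \<subseteq> steps n"
  unfolding steps_def using le_trans by blast

lemma steps_weaken:
  assumes "(s, t) \<in> steps m ^^ k" "m \<le> n"
  shows "(s, t) \<in> steps n ^^ k"
  using assms(1)
proof (induction k arbitrary: t)
  case (Suc k)
  then show ?case
    using steps_mono[OF assms(2)] by (auto intro: relpow_Suc_I)
qed simp

lemma steps_trans: "(s, t) \<in> steps n ^^ k \<Longrightarrow> (t, v) \<in> steps n ^^ l \<Longrightarrow> (s, v) \<in> steps n ^^ (k + l)"
  by (auto simp: relpow_add)

lemma steps_single:
  assumes "1 \<le> d" "d \<le> n" "x \<noteq> s d" "s d \<in> allowed_pegs d" "x \<in> allowed_pegs d"
    and "\<And>e. 1 \<le> e \<Longrightarrow> e < d \<Longrightarrow> s e \<noteq> s d \<and> s e \<noteq> x"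
  shows "(s, s(d := x)) \<in> steps n ^^ 1"
  using assms by (auto simp: steps_def moves_disc_def)

text \<open>The classical solution. The last assumption stops at \<open>Suc d < k\<close> so that
  disc \<open>k - 1\<close>, larger than the whole tower, may stand on a neutral peg.\<close>

lemma steps_tower:
  assumes "k \<le> n + 1" "\<And>d. d \<in> tower k \<Longrightarrow> s d = x" "x \<noteq> y" "x \<in> allowed_pegs k" "y \<in> allowed_pegs k"
    and "\<And>d. 1 \<le> d \<Longrightarrow> Suc d < k \<Longrightarrow> d \<notin> tower k \<Longrightarrow> s d \<notin> allowed_pegs k"
  shows "(s, \<lambda>d. if d \<in> tower k then y else s d) \<in> steps n ^^ (2 ^ height k - 1)"
  using assms
proof (induction k arbitrary: s x y rule: less_induct)
  case (less k)
  show ?case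
  proof (cases "k \<le> 2")
    case True
    then have "tower k = {}"
      using tower_range[of _ k 0] by force
    moreover have "height k = 0"
      using True by (auto simp: height_def)
    ultimately show ?thesis
      by simp
  next
    case False
    define d where "d = k - 2"
    have d: "1 \<le> d" "k = Suc (Suc d)" "d < k" "d \<le> n" "d \<le> n + 1"
      using False less.prems(1) by (auto simp: d_def)
    have tower_k: "tower k = insert d (tower d)"
      using tower_Suc_Suc[OF d(1)] d(2) by simp
    have allowed: "allowed_pegs k = allowed_pegs d"
      using d(2) by (simp add: allowed_pegs_def)
    have own: "s c \<notin> allowed_pegs d" if "1 \<le> c" "c < d" "c \<notin> tower d" for c
      using less.prems(6)[of c] that d(2) tower_k allowed by simp
    have s_d: "s d = x"
      using less.prems(2)[of d] tower_k by simp
    obtain z where z: "z \<in> allowed_pegs d" "z \<noteq> x" "z \<noteq> y"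
      using third_peg_exists[of x d y] less.prems(4,5) allowed by auto
    define s1 where "s1 = (\<lambda>c. if c \<in> tower d then z else s c)"
    define s2 where "s2 = s1(d := y)"
    define s3 where "s3 = (\<lambda>c. if c \<in> tower d then y else s2 c)"
    have "(s, s1) \<in> steps n ^^ (2 ^ height d - 1)"
      unfolding s1_def
      by (rule less.IH[OF d(3,5), of s x z]) (use less.prems(2,4) tower_k allowed z own in auto)
    moreover have "(s1, s2) \<in> steps n ^^ 1"
      unfolding s2_def
    proof (rule steps_single[OF d(1,4)])
      show "y \<noteq> s1 d" "s1 d \<in> allowed_pegs d" "y \<in> allowed_pegs d"
        using s_d notin_tower[of d] less.prems(3-5) allowed by (auto simp: s1_def)
      show "s1 c \<noteq> s1 d \<and> s1 c \<noteq> y" if "1 \<le> c" "c < d" for c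
        using own[OF that] s_d notin_tower[of d] z less.prems(4,5) allowed by (auto simp: s1_def)
    qed
    moreover have "(s2, s3) \<in> steps n ^^ (2 ^ height d - 1)"
      unfolding s3_def
      by (rule less.IH[OF d(3,5), of s2 z y])
        (use own z less.prems(5) allowed notin_tower[of d] in \<open>auto simp: s2_def s1_def\<close>)
    ultimately have "(s, s3) \<in> steps n ^^ (2 ^ height d - 1 + 1 + (2 ^ height d - 1))"
      using steps_trans by blast
    moreover have "2 ^ height d - 1 + 1 + (2 ^ height d - 1) = (2::nat) ^ height k - 1"
      using height_Suc_Suc[OF d(1)] d(2) two_power(1)[of "height d"] by simp
    moreover have "s3 = (\<lambda>c. if c \<in> tower k then y else s c)"
      using tower_k by (auto simp: s3_def s2_def s1_def)
    ultimately show ?thesis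
      by simp
  qed
qed

definition own_upto :: "nat \<Rightarrow> (nat \<Rightarrow> peg) \<Rightarrow> nat \<Rightarrow> peg" where
  "own_upto n s = (\<lambda>d. if 1 \<le> d \<and> d \<le> n then own_peg d else s d)"

definition hard_value :: "nat \<Rightarrow> nat" where
  "hard_value n = beta (n - 2) + 2 * 2 ^ height n + 2 ^ height (n - 1) - 1"

lemma own_peg_in [simp]: "own_peg d \<in> allowed_pegs d" "Neutral1 \<in> allowed_pegs d" "Neutral2 \<in> allowed_pegs d"
  by (simp_all add: allowed_pegs_own)

lemma own_peg_parity: "odd (d + k) \<Longrightarrow> own_peg d \<notin> allowed_pegs k"
  by (auto simp: own_peg_def allowed_pegs_def)

lemma not_in_tower: "1 \<le> d \<Longrightarrow> d < k \<Longrightarrow> d \<notin> tower k \<longleftrightarrow> odd (d + k)"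
  by (auto simp: tower_def)

lemma tower_parity: "1 \<le> d \<Longrightarrow> d \<le> m \<Longrightarrow> d \<in> tower (Suc (Suc m)) \<longleftrightarrow> d \<notin> tower (Suc m)"
  by (auto simp: tower_def)

text \<open>\<open>hard_state\<close> is the goal of \<open>c\<close> for odd \<open>n\<close> and of \<open>d\<close> for even \<open>n\<close>, \<open>easy_state\<close> that of
  \<open>c\<close> for even \<open>n\<close> and of \<open>d\<close> for odd \<open>n\<close>.\<close>

definition hard_state :: "nat \<Rightarrow> (nat \<Rightarrow> peg) \<Rightarrow> nat \<Rightarrow> peg" where
  "hard_state n s = (\<lambda>d. if d \<in> tower (Suc (Suc n)) then own_peg n else if d \<in> tower (Suc n) then Neutral2 else s d)"

definition easy_state :: "nat \<Rightarrow> (nat \<Rightarrow> peg) \<Rightarrow> nat \<Rightarrow> peg" where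
  "easy_state n s = (\<lambda>d. if d \<in> tower (Suc (Suc n)) then Neutral2 else if d \<in> tower (Suc n) then own_peg (Suc n) else s d)"

definition b_reachable :: "nat \<Rightarrow> bool" where
  "b_reachable n \<longleftrightarrow> (\<forall>s. (\<forall>d. 1 \<le> d \<and> d \<le> n \<longrightarrow> s d = Neutral1) \<longrightarrow> (s, own_upto n s) \<in> steps n ^^ beta n)"

lemma b_reachableD:
  assumes "b_reachable m" "\<And>d. 1 \<le> d \<Longrightarrow> d \<le> m \<Longrightarrow> s d = Neutral1" "m \<le> n"
  shows "(s, own_upto m s) \<in> steps n ^^ beta m"
  by (rule steps_weaken[OF _ assms(3)]) (use assms(1,2) in \<open>simp add: b_reachable_def\<close>)

text \<open>Once the discs up to \<open>m\<close> are on their own pegs, disc \<open>n - 1\<close>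
  goes to \<open>Neutral2\<close>. The tower of \<open>n\<close> piles up on it, lets disc
  \<open>n\<close> pass to its own peg and goes back; then the tower of \<open>n - 1\<close> follows
  to \<open>Neutral2\<close>.\<close>

lemma hard_reachable:
  assumes IH: "b_reachable m" and n: "n = Suc (Suc m)"
    and start: "\<And>d. 1 \<le> d \<Longrightarrow> d \<le> n \<Longrightarrow> s d = Neutral1"
  shows "(s, hard_state n s) \<in> steps n ^^ hard_value n"
proof -
  have own_other: "own_peg d \<notin> allowed_pegs n" if "1 \<le> d" "d \<le> m" "d \<notin> tower n" for d
    using that by (intro own_peg_parity) (simp add: not_in_tower n)
  have tower_n: "1 \<le> d" "d \<le> m" "own_peg d = own_peg n" if "d \<in> tower n" for d
    using tower_range[OF that, of m] own_peg_tower[OF that] by (simp_all add: n)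
  have tower_m: "1 \<le> d" "d \<le> m" "d \<notin> tower n" "own_peg d = own_peg (Suc m)" if "d \<in> tower (Suc m)" for d
    using tower_range[OF that, of m] own_peg_tower[OF that] tower_parity[of d m] that by (simp_all add: n)
  define s1 where "s1 = own_upto m s"
  define s2 where "s2 = s1(Suc m := Neutral2)"
  define s3 where "s3 = (\<lambda>d. if d \<in> tower n then Neutral2 else s2 d)"
  define s4 where "s4 = s3(n := own_peg n)"
  define s5 where "s5 = (\<lambda>d. if d \<in> tower n then own_peg n else s4 d)"
  define s6 where "s6 = (\<lambda>d. if d \<in> tower (Suc m) then Neutral2 else s5 d)"
  have s1: "s1 d = own_peg d" if "1 \<le> d" "d \<le> m" for d
    using that by (simp add: s1_def own_upto_def)
  have s1': "s1 (Suc m) = Neutral1" "s1 n = Neutral1"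
    using start[of "Suc m"] start[of n] n by (simp_all add: s1_def own_upto_def)
  have s2: "s2 d = own_peg d" if "1 \<le> d" "d \<le> m" for d
    using s1[OF that] that by (simp add: s2_def)
  have s2': "s2 (Suc m) = Neutral2" "s2 n = Neutral1"
    using s1' n by (simp_all add: s2_def)
  have s4: "s4 d = own_peg d" if "1 \<le> d" "d \<le> m" "d \<notin> tower n" for d
    using s2[OF that(1,2)] that n by (simp add: s4_def s3_def)
  have s4': "s4 d = Neutral2" if "d \<in> tower n" for d
    using tower_n[OF that] that n by (simp add: s4_def s3_def)
  have p1: "(s, s1) \<in> steps n ^^ beta m"
    unfolding s1_def by (rule b_reachableD[OF IH]) (simp_all add: start n)
  have p2: "(s1, s2) \<in> steps n ^^ 1"
    unfolding s2_def by (rule steps_single) (use s1 s1' n in auto)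
  have p3: "(s2, s3) \<in> steps n ^^ (2 ^ height n - 1)"
    unfolding s3_def
    by (rule steps_tower[where x = "own_peg n"]) (use s2 tower_n own_other n in auto)
  have p4: "(s3, s4) \<in> steps n ^^ 1"
    unfolding s4_def
  proof (rule steps_single)
    show "own_peg n \<noteq> s3 n" "s3 n \<in> allowed_pegs n"
      using s2' notin_tower[of n] by (simp_all add: s3_def)
    show "s3 d \<noteq> s3 n \<and> s3 d \<noteq> own_peg n" if d: "1 \<le> d" "d < n" for d
    proof -
      have "s3 d = Neutral2 \<or> s3 d = own_peg d \<and> own_peg d \<notin> allowed_pegs n"
        using s2[of d] s2'(1) own_other[of d] d n by (cases "d = Suc m") (auto simp: s3_def)
      moreover have "s3 n = Neutral1"
        using s2' notin_tower[of n] by (simp add: s3_def)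
      ultimately show ?thesis
        by (metis own_peg_in(1) own_peg_neq peg.distinct)
    qed
  qed (use n in simp_all)
  have p5: "(s4, s5) \<in> steps n ^^ (2 ^ height n - 1)"
    unfolding s5_def
    by (rule steps_tower[where x = Neutral2]) (use s4 s4' own_other n in auto)
  have p6: "(s5, s6) \<in> steps n ^^ (2 ^ height (Suc m) - 1)"
    unfolding s6_def
  proof (rule steps_tower[where x = "own_peg (Suc m)"])
    show "s5 d = own_peg (Suc m)" if "d \<in> tower (Suc m)" for d
      using tower_m[OF that] s4[of d] by (simp add: s5_def)
    show "s5 d \<notin> allowed_pegs (Suc m)" if "1 \<le> d" "Suc d < Suc m" "d \<notin> tower (Suc m)" for d
      using that tower_parity[of d m] own_peg_parity[of n "Suc m"] n by (simp add: s5_def)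
  qed (use n in simp_all)
  have "(s, s6) \<in> steps n ^^ (beta m + 1 + (2 ^ height n - 1) + 1 + (2 ^ height n - 1) + (2 ^ height (Suc m) - 1))"
    by (rule steps_trans[OF steps_trans[OF steps_trans[OF steps_trans[OF steps_trans[OF p1 p2] p3] p4] p5] p6])
  moreover have "beta m + 1 + (2 ^ height n - 1) + 1 + (2 ^ height n - 1) + (2 ^ height (Suc m) - 1) = hard_value n"
    using two_power(1)[of "height n"] two_power(1)[of "height (Suc m)"] n by (simp add: hard_value_def)
  moreover have "s6 = hard_state n s"
  proof
    fix d
    have "tower (Suc (Suc n)) = insert n (tower n)" "tower (Suc n) = insert (Suc m) (tower (Suc m))"
      using tower_Suc_Suc[of n] tower_Suc_Suc[of "Suc m"] n by simp_all
    moreover have "s d = s4 d" if "d \<noteq> n" "d \<noteq> Suc m" "d \<notin> tower n" "d \<notin> tower (Suc m)"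
      using that tower_parity[of d m] n by (auto simp: s4_def s3_def s2_def s1_def own_upto_def)
    moreover have "Suc m \<notin> tower n" "n \<notin> tower n" "n \<noteq> Suc m" "n \<notin> tower (Suc m)"
      using n by (auto simp: tower_def)
    moreover have "s4 n = own_peg n" "s4 (Suc m) = Neutral2"
      using \<open>Suc m \<notin> tower n\<close> s2' n by (simp_all add: s4_def s3_def)
    ultimately show "s6 d = hard_state n s d"
      using tower_m(3)[of d] unfolding s6_def s5_def hard_state_def by auto
  qed
  ultimately show ?thesis
    by simp
qed

text \<open>With all smaller discs on their own pegs, disc \<open>n\<close> crosses directly and its
  tower follows.\<close>

lemma easy_reachable:
  assumes IH: "b_reachable m" and n: "n = Suc m"
    and start: "\<And>d. 1 \<le> d \<Longrightarrow> d \<le> n \<Longrightarrow> s d = Neutral1"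
  shows "(s, easy_state n s) \<in> steps n ^^ (beta m + 2 ^ height n)"
proof -
  have own_other: "own_peg d \<notin> allowed_pegs n" if "1 \<le> d" "d \<le> m" "d \<notin> tower n" for d
    using that by (intro own_peg_parity) (simp add: not_in_tower n)
  have tower_n: "1 \<le> d" "d \<le> m" "own_peg d = own_peg n" if "d \<in> tower n" for d
    using tower_range[OF that, of m] own_peg_tower[OF that] by (simp_all add: n)
  define s1 where "s1 = own_upto m s"
  define s2 where "s2 = s1(n := Neutral2)"
  define s3 where "s3 = (\<lambda>d. if d \<in> tower n then Neutral2 else s2 d)"
  have s1: "s1 d = own_peg d" if "1 \<le> d" "d \<le> m" for d
    using that by (simp add: s1_def own_upto_def)
  have s1': "s1 n = Neutral1"
    using start[of n] n by (simp add: s1_def own_upto_def)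
  have s2: "s2 d = own_peg d" if "1 \<le> d" "d \<le> m" for d
    using s1[OF that] that n by (simp add: s2_def)
  have p1: "(s, s1) \<in> steps n ^^ beta m"
    unfolding s1_def by (rule b_reachableD[OF IH]) (simp_all add: start n)
  have p2: "(s1, s2) \<in> steps n ^^ 1"
    unfolding s2_def by (rule steps_single) (use s1 s1' n in auto)
  have p3: "(s2, s3) \<in> steps n ^^ (2 ^ height n - 1)"
    unfolding s3_def
    by (rule steps_tower[where x = "own_peg n"]) (use s2 tower_n own_other n in auto)
  have "(s, s3) \<in> steps n ^^ (beta m + 1 + (2 ^ height n - 1))"
    by (rule steps_trans[OF steps_trans[OF p1 p2] p3])
  moreover have "s3 = easy_state n s"
  proof
    fix d
    have "tower (Suc (Suc n)) = insert n (tower n)"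
      using tower_Suc_Suc[of n] n by simp
    moreover have "d \<in> tower (Suc n) \<longleftrightarrow> 1 \<le> d \<and> d \<le> m \<and> d \<notin> tower n"
      using tower_range[of d "Suc n" m] tower_parity[of d m] n by auto
    ultimately show "s3 d = easy_state n s d"
      using tower_n[of d] own_peg_tower[of d "Suc n"] n
      by (auto simp: s3_def s2_def s1_def own_upto_def easy_state_def)
  qed
  ultimately show ?thesis
    by simp
qed

text \<open>The hard goal for \<open>n - 1\<close> puts the tower of \<open>n\<close> on
  \<open>Neutral2\<close> and leaves the own peg of \<open>n\<close> empty. Disc \<open>n\<close>
  goes there and the tower follows.\<close>

lemma b_reachable: "b_reachable n"
proof (induction n rule: less_induct)
  case (less n)
  show ?case
    unfolding b_reachable_def
  proof (intro allI impI)
    fix s :: "nat \<Rightarrow> peg"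
    assume start: "\<forall>d. 1 \<le> d \<and> d \<le> n \<longrightarrow> s d = Neutral1"
    consider "n = 0" | "n = 1" | "n = 2" | "3 \<le> n"
      by linarith
    then show "(s, own_upto n s) \<in> steps n ^^ beta n"
    proof cases
      case 1
      then have "own_upto n s = s"
        by (auto simp: own_upto_def)
      then show ?thesis
        using 1 by simp
    next
      case 2
      have "(s, s(1 := own_peg 1)) \<in> steps n ^^ 1"
        by (rule steps_single) (use start 2 in auto)
      moreover have "own_upto n s = s(1 := own_peg 1)"
        using 2 by (auto simp: own_upto_def)
      ultimately show ?thesis
        using 2 by simp
    next
      case 3
      have "(s, s(1 := own_peg 1)) \<in> steps n ^^ 1"
        by (rule steps_single) (use start 3 in auto)
      moreover have "(s(1 := own_peg 1), (s(1 := own_peg 1))(2 := own_peg 2)) \<in> steps n ^^ 1"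
        by (rule steps_single) (use start 3 in \<open>auto simp: own_peg_def allowed_pegs_def\<close>)
      ultimately have "(s, (s(1 := own_peg 1))(2 := own_peg 2)) \<in> steps n ^^ (1 + 1)"
        by (rule steps_trans)
      moreover have "own_upto n s = (s(1 := own_peg 1))(2 := own_peg 2)"
      proof
        fix d
        show "own_upto n s d = ((s(1 := own_peg 1))(2 := own_peg 2)) d"
          using 3 by (cases "d = 0"; cases "d = 1"; cases "d = 2") (auto simp: own_upto_def)
      qed
      moreover have "beta n = 1 + 1"
        using 3 by (simp add: numeral_2_eq_2)
      ultimately show ?thesis
        by simp
    next
      case 4
      define m where "m = n - 3"
      have m: "n = Suc (Suc (Suc m))" "m < n"
        using 4 by (simp_all add: m_def)
      define k where "k = Suc (Suc m)"
      have n: "n = Suc k" "k \<noteq> n"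
        using m by (simp_all add: k_def)
      have pos: "1 \<le> n" and pred: "k = n - 1"
        using n(1) by simp_all
      define s1 where "s1 = hard_state k s"
      define s2 where "s2 = s1(n := own_peg n)"
      define s3 where "s3 = (\<lambda>d. if d \<in> tower n then own_peg n else s2 d)"
      have "(s, s1) \<in> steps k ^^ hard_value k"
        unfolding s1_def by (rule hard_reachable[OF less.IH[OF m(2)] k_def]) (use start n in auto)
      then have p1: "(s, s1) \<in> steps n ^^ hard_value k"
        by (rule steps_weaken) (simp add: n(1))
      have tower_k: "d \<in> tower (Suc n) \<longleftrightarrow> d \<notin> tower n" if "1 \<le> d" "d \<le> k" for d
        using tower_parity[of d k] that by (simp add: n(1))
      have other: "own_peg k \<notin> allowed_pegs n"
        by (rule own_peg_parity) (simp add: n(1))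
      have s1: "s1 d = (if d \<in> tower n then Neutral2 else own_peg k)" if "1 \<le> d" "d \<le> k" for d
        using tower_k[OF that] by (simp add: s1_def hard_state_def n(1)[symmetric])
      have "n \<notin> tower n" "n \<notin> tower (Suc n)"
        by (simp_all add: tower_def)
      then have s1': "s1 n = Neutral1"
        using start pos by (simp add: s1_def hard_state_def n(1)[symmetric])
      have s2: "s2 d = (if d \<in> tower n then Neutral2 else own_peg k)" if "1 \<le> d" "d \<le> k" for d
        using s1[OF that] that n by (simp add: s2_def)
      have p2: "(s1, s2) \<in> steps n ^^ 1"
        unfolding s2_def
      proof (rule steps_single)
        show "s1 d \<noteq> s1 n \<and> s1 d \<noteq> own_peg n" if "1 \<le> d" "d < n" for d
          using s1[of d] that other s1' n by auto
      qed (use s1' n in simp_all)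
      have p3: "(s2, s3) \<in> steps n ^^ (2 ^ height n - 1)"
        unfolding s3_def
      proof (rule steps_tower[where x = Neutral2])
        show "s2 d = Neutral2" if "d \<in> tower n" for d
          using tower_range[OF that, of k] s2[of d] that n by simp
        show "s2 d \<notin> allowed_pegs n" if "1 \<le> d" "Suc d < n" "d \<notin> tower n" for d
          using s2[of d] that other n by simp
      qed simp_all
      have "(s, s3) \<in> steps n ^^ (hard_value k + 1 + (2 ^ height n - 1))"
        by (rule steps_trans[OF steps_trans[OF p1 p2] p3])
      moreover have "hard_value k + 1 + (2 ^ height n - 1) = beta n"
      proof -
        have "k - 2 = n - 3" "k - 1 = n - 2"
          by (simp_all add: pred)
        then show ?thesis
          using beta_rec[OF 4] two_power(1)[of "height n"] two_power(1)[of "height (n - 1)"]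
          unfolding hard_value_def pred[symmetric] by simp
      qed
      moreover have "s3 = own_upto n s"
      proof
        fix d
        consider "d = n" | "1 \<le> d" "d \<le> k" | "d = 0 \<or> n < d"
          using n(1) by linarith
        then show "s3 d = own_upto n s d"
        proof cases
          case 1
          then show ?thesis
            using \<open>n \<notin> tower n\<close> n by (simp add: s3_def s2_def own_upto_def)
        next
          case 2
          have "own_peg d = (if d \<in> tower n then own_peg n else own_peg k)"
            using own_peg_tower[of d n] own_peg_tower[of d "Suc n"] tower_k[OF 2] n(1) by (auto simp: own_peg_def)
          then show ?thesis
            using s2[OF 2] 2 n by (simp add: s3_def own_upto_def)
        next
          case 3
          then have "d \<notin> tower n" "d \<notin> tower (Suc n)"
            by (auto simp: tower_def)
          then show ?thesis
            using 3 pos by (auto simp: s3_def s2_def s1_def hard_state_def own_upto_def n(1)[symmetric])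
        qed
      qed
      ultimately show ?thesis
        by simp
    qed
  qed
qed

lemma steps_mirror:
  assumes "(s, t) \<in> steps n ^^ k"
  shows "(swap_peg \<circ> t, swap_peg \<circ> s) \<in> steps n ^^ k"
  using assms
proof (induction k arbitrary: t)
  case 0
  then show ?case by simp
next
  case (Suc k)
  then obtain v where v: "(s, v) \<in> steps n ^^ k" "(v, t) \<in> steps n"
    by auto
  have "(swap_peg \<circ> t, swap_peg \<circ> v) \<in> steps n"
    using v(2) moves_disc_swap moves_disc_sym unfolding steps_def by blast
  then show ?case
    using Suc.IH[OF v(1)] by (rule relpow_Suc_I2)
qed

definition transfer_state :: "nat \<Rightarrow> (nat \<Rightarrow> peg) \<Rightarrow> nat \<Rightarrow> peg" where
  "transfer_state n s = (\<lambda>d. if 1 \<le> d \<and> d \<le> n then Neutral2 else s d)"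

lemma transfer_reachable:
  assumes n: "n = Suc m" and start: "\<And>d. 1 \<le> d \<Longrightarrow> d \<le> n \<Longrightarrow> s d = Neutral1"
  shows "(s, transfer_state n s) \<in> steps n ^^ (2 * beta m + 1)"
proof -
  define s1 where "s1 = own_upto m s"
  define s2 where "s2 = s1(n := Neutral2)"
  \<comment> \<open>Chosen so that its mirror image is the goal and the mirror image of
    \<open>own_upto m v\<close> is \<open>s2\<close>: the second half is a solution for
    \<open>m\<close> discs, reversed and mirrored.\<close>
  define v where "v = (\<lambda>d. if 1 \<le> d \<and> d \<le> m then Neutral1 else swap_peg (s2 d))"
  have p1: "(s, s1) \<in> steps n ^^ beta m"
    unfolding s1_def by (rule b_reachableD[OF b_reachable]) (simp_all add: start n)
  have s1: "s1 d = own_peg d" if "1 \<le> d" "d \<le> m" for d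
    using that by (simp add: s1_def own_upto_def)
  have s1': "s1 n = Neutral1"
    using start[of n] n by (simp add: s1_def own_upto_def)
  have p2: "(s1, s2) \<in> steps n ^^ 1"
    unfolding s2_def by (rule steps_single) (use s1 s1' n in auto)
  have "(v, own_upto m v) \<in> steps n ^^ beta m"
    by (rule b_reachableD[OF b_reachable]) (simp_all add: v_def n)
  then have "(swap_peg \<circ> own_upto m v, swap_peg \<circ> v) \<in> steps n ^^ beta m"
    by (rule steps_mirror)
  moreover have "swap_peg \<circ> own_upto m v = s2"
    using s1 by (auto simp: own_upto_def v_def s2_def n)
  moreover have "swap_peg \<circ> v = transfer_state n s"
  proof
    fix d
    consider "1 \<le> d" "d \<le> m" | "d = n" | "d = 0 \<or> n < d"
      using n by linarith
    then show "(swap_peg \<circ> v) d = transfer_state n s d"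
      by cases (auto simp: v_def transfer_state_def s2_def s1_def own_upto_def n)
  qed
  ultimately have "(s, transfer_state n s) \<in> steps n ^^ (beta m + 1 + beta m)"
    using steps_trans[OF steps_trans[OF p1 p2]] by simp
  then show ?thesis
    by (simp add: mult_2)
qed

subsection \<open>The move counts\<close>

lemma legal_moves_iff:
  assumes "s \<in> states n"
  shows "(s, t) \<in> legal_moves n \<longleftrightarrow> (s, t) \<in> steps n"
proof
  have fin: "finite (discs_on n s p)" for p
    by (simp add: discs_on_def)
  assume "(s, t) \<in> legal_moves n"
  then obtain d p q where t: "t = s(d := q)" and ne: "discs_on n s p \<noteq> {}" and d: "d = Min (discs_on n s p)"
    and pq: "q \<noteq> p" "p \<in> allowed_pegs d" "q \<in> allowed_pegs d"
    and free: "discs_on n s q = {} \<or> d < Min (discs_on n s q)"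
    by (auto simp: legal_moves_def top_disc_def)
  have d_in: "d \<in> discs_on n s p"
    unfolding d by (rule Min_in[OF fin ne])
  have "s e \<noteq> p \<and> s e \<noteq> q" if "1 \<le> e" "e < d" for e
  proof -
    have "e \<notin> discs_on n s p"
      using Min_le[OF fin, of e p] that d by auto
    moreover have "e \<notin> discs_on n s q"
      using Min_le[OF fin, of e q] that free by auto
    ultimately show ?thesis
      using that d_in by (auto simp: discs_on_def)
  qed
  then show "(s, t) \<in> steps n"
    using d_in pq t by (auto simp: steps_def moves_disc_def discs_on_def)
next
  have fin: "finite (discs_on n s p)" for p
    by (simp add: discs_on_def)
  assume "(s, t) \<in> steps n"
  then obtain d where d: "d \<le> n" "1 \<le> d" "t = s(d := t d)" "t d \<noteq> s d"
    "s d \<in> allowed_pegs d" "t d \<in> allowed_pegs d" "\<And>e. 1 \<le> e \<Longrightarrow> e < d \<Longrightarrow> s e \<noteq> s d \<and> s e \<noteq> t d"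
    by (auto simp: steps_def moves_disc_def)
  have d_in: "d \<in> discs_on n s (s d)"
    using d by (simp add: discs_on_def)
  have "Min (discs_on n s (s d)) = d"
  proof (rule Min_eqI[OF fin _ d_in])
    show "d \<le> e" if "e \<in> discs_on n s (s d)" for e
      using that d(7)[of e] by (cases "e < d") (auto simp: discs_on_def)
  qed
  moreover have "d < Min (discs_on n s (t d))" if "discs_on n s (t d) \<noteq> {}"
  proof -
    define e where "e = Min (discs_on n s (t d))"
    have "e \<in> discs_on n s (t d)"
      unfolding e_def by (rule Min_in[OF fin that])
    then have "1 \<le> e" "s e = t d"
      by (simp_all add: discs_on_def)
    then have "\<not> e < d" "e \<noteq> d"
      using d(4) d(7)[of e] by auto
    then show ?thesis
      unfolding e_def[symmetric] by simp
  qed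
  ultimately have "\<exists>d' p q. (s, t) = (s, s(d' := q)) \<and> s \<in> states n \<and> discs_on n s p \<noteq> {} \<and> d' = top_disc n s p \<and>
      q \<noteq> p \<and> p \<in> allowed_pegs d' \<and> q \<in> allowed_pegs d' \<and> (discs_on n s q = {} \<or> d' < top_disc n s q)"
    using assms d d_in unfolding top_disc_def by (intro exI[of _ d] exI[of _ "s d"] exI[of _ "t d"]) auto
  then show "(s, t) \<in> legal_moves n"
    unfolding legal_moves_def by blast
qed

lemma steps_states:
  assumes "(s, t) \<in> steps n" "s \<in> states n"
  shows "t \<in> states n"
proof -
  obtain d where d: "d \<le> n" "1 \<le> d" "t = s(d := t d)" "t d \<in> allowed_pegs d"
    using assms(1) by (auto simp: steps_def moves_disc_def)
  have "s(d := q) \<in> states n" if "q \<in> allowed_pegs d" for q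
    using assms(2) d(1,2) that by (auto simp: states_def PiE_iff extensional_def)
  then show ?thesis
    using d(3,4) by metis
qed

lemma relpow_legal_moves:
  assumes "s \<in> states n"
  shows "(s, t) \<in> legal_moves n ^^ k \<longleftrightarrow> (s, t) \<in> steps n ^^ k"
proof -
  have "((s, t) \<in> legal_moves n ^^ k \<longleftrightarrow> (s, t) \<in> steps n ^^ k) \<and> ((s, t) \<in> steps n ^^ k \<longrightarrow> t \<in> states n)"
  proof (induction k arbitrary: t)
    case 0
    then show ?case using assms by auto
  next
    case (Suc k)
    have "(s, t) \<in> legal_moves n ^^ Suc k \<longleftrightarrow> (\<exists>v. (s, v) \<in> steps n ^^ k \<and> (v, t) \<in> legal_moves n)"
      using Suc by (simp add: relcomp_unfold)
    also have "\<dots> \<longleftrightarrow> (\<exists>v. (s, v) \<in> steps n ^^ k \<and> (v, t) \<in> steps n)"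
      using Suc legal_moves_iff by blast
    finally have "(s, t) \<in> legal_moves n ^^ Suc k \<longleftrightarrow> (s, t) \<in> steps n ^^ Suc k"
      by (simp add: relcomp_unfold)
    moreover have "t \<in> states n" if "(s, t) \<in> steps n ^^ Suc k"
      using that Suc steps_states by auto
    ultimately show ?case
      by blast
  qed
  then show ?thesis
    by blast
qed

lemma min_moves_eqI:
  assumes "s \<in> states n" "(s, t) \<in> steps n ^^ m" "\<And>k. (s, t) \<in> steps n ^^ k \<Longrightarrow> m \<le> k"
  shows "min_moves n s t = enat m"
  unfolding min_moves_def
proof (rule antisym)
  show "(INF k\<in>{k. (s, t) \<in> legal_moves n ^^ k}. enat k) \<le> enat m"
    using assms(1,2) relpow_legal_moves by (intro INF_lower) simp
  show "enat m \<le> (INF k\<in>{k. (s, t) \<in> legal_moves n ^^ k}. enat k)"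
    using assms(1,3) relpow_legal_moves by (intro INF_greatest) simp
qed

lemma start_state_in: "start_state n \<in> states n"
  by (auto simp: start_state_def parity_state_def states_def)

lemma start_state_apply: "1 \<le> d \<Longrightarrow> d \<le> n \<Longrightarrow> start_state n d = Neutral1"
  by (simp add: start_state_def parity_state_def)

lemma play_of_steps:
  assumes "(start_state n, t) \<in> steps n ^^ k"
  shows "\<exists>s w. play s w \<and> (\<forall>d. 1 \<le> d \<and> d \<le> n \<longrightarrow> s 0 d = Neutral1) \<and>
    (\<forall>d. 1 \<le> d \<and> d \<le> n \<longrightarrow> s k d = t d) \<and> count_moves w {1..n} 0 k \<le> k"
proof -
  obtain f where f: "f 0 = start_state n" "f k = t" "\<And>i. i < k \<Longrightarrow> (f i, f (Suc i)) \<in> steps n"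
    using assms unfolding relpow_fun_conv by blast
  have "\<forall>i. \<exists>d. i < k \<longrightarrow> d \<le> n \<and> moves_disc d (f i) (f (Suc i))"
    using f(3) by (auto simp: steps_def)
  then obtain g where g: "\<And>i. i < k \<Longrightarrow> g i \<le> n \<and> moves_disc (g i) (f i) (f (Suc i))"
    by metis
  \<comment> \<open>States are undefined outside \<open>{1..n}\<close>, but a play needs an allowed
    peg for every disc; the others rest on \<open>Neutral1\<close>. The minimum with
    \<open>k\<close> freezes the play at the goal.\<close>
  define s where "s = (\<lambda>i d. if 1 \<le> d \<and> d \<le> n then f (min i k) d else Neutral1)"
  define w where "w = (\<lambda>i. if i < k then g i else 0)"
  have "play s w"
  proof
    show "s 0 d \<in> allowed_pegs d" for d
      using f(1) start_state_apply[of d n] by (simp add: s_def)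
    show "s (Suc i) = s i" if "w i = 0" for i
    proof -
      have "\<not> i < k"
        using that g[of i] by (auto simp: w_def moves_disc_def split: if_splits)
      then have mins: "min i k = k" "min (Suc i) k = k"
        by simp_all
      show ?thesis
        unfolding s_def mins ..
    qed
    show "moves_disc (w i) (s i) (s (Suc i))" if "1 \<le> w i" for i
    proof -
      have i: "i < k" "w i = g i"
        using that by (auto simp: w_def split: if_splits)
      then have m: "g i \<le> n" "moves_disc (g i) (f i) (f (Suc i))" "min i k = i" "min (Suc i) k = Suc i"
        using g[of i] by auto
      then have upd: "f (Suc i) = (f i)(g i := f (Suc i) (g i))" "1 \<le> g i"
        by (simp_all add: moves_disc_def)
      have "f (Suc i) d = f i d" if "d \<noteq> g i" for d
        using that by (subst upd(1)) simp
      then have "s (Suc i) = (s i)(g i := s (Suc i) (g i))"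
        using m by (auto simp: s_def)
      then show ?thesis
        using m upd(2) unfolding i(2) moves_disc_def by (simp add: s_def)
    qed
  qed
  moreover have "count_moves w {1..n} 0 k \<le> k"
    using count_moves_le[of w "{1..n}" 0 k] by simp
  moreover have "\<forall>d. 1 \<le> d \<and> d \<le> n \<longrightarrow> s 0 d = Neutral1"
    using f(1) start_state_apply by (simp add: s_def)
  moreover have "\<forall>d. 1 \<le> d \<and> d \<le> n \<longrightarrow> s k d = t d"
    using f(2) by (simp add: s_def)
  ultimately show ?thesis
    by blast
qed

lemma b_count_eq: "b_count n = enat (beta n)"
  unfolding b_count_def
proof (rule min_moves_eqI[OF start_state_in])
  have "parity_state n OddPeg EvenPeg = own_upto n (start_state n)"
    by (auto simp: parity_state_def own_upto_def start_state_def own_peg_def)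
  then show "(start_state n, parity_state n OddPeg EvenPeg) \<in> steps n ^^ beta n"
    using b_reachableD[OF b_reachable start_state_apply order_refl] by simp
  fix k
  assume "(start_state n, parity_state n OddPeg EvenPeg) \<in> steps n ^^ k"
  from play_of_steps[OF this] obtain s w where play_ex: "play s w"
    "\<forall>d. 1 \<le> d \<and> d \<le> n \<longrightarrow> s 0 d = Neutral1"
    "\<forall>d. 1 \<le> d \<and> d \<le> n \<longrightarrow> s k d = parity_state n OddPeg EvenPeg d" "count_moves w {1..n} 0 k \<le> k"
    by blast
  have play: "play s w" "\<And>d. 1 \<le> d \<Longrightarrow> d \<le> n \<Longrightarrow> s 0 d = Neutral1"
    "\<And>d. 1 \<le> d \<Longrightarrow> d \<le> n \<Longrightarrow> s k d = parity_state n OddPeg EvenPeg d" "count_moves w {1..n} 0 k \<le> k"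
    using play_ex by simp_all
  have "beta n \<le> count_moves w {1..n} 0 k"
    by (rule b_boundD[OF b_bound play(1,2)]) (use play(3) in \<open>simp_all add: parity_state_def own_peg_def\<close>)
  then show "beta n \<le> k"
    using play(4) by simp
qed

lemma a_count_eq:
  assumes "1 \<le> n"
  shows "a_count n = enat (2 * beta (n - 1) + 1)"
  unfolding a_count_def
proof (rule min_moves_eqI[OF start_state_in])
  have "parity_state n Neutral2 Neutral2 = transfer_state n (start_state n)"
    by (auto simp: parity_state_def transfer_state_def start_state_def)
  moreover have "n = Suc (n - 1)"
    using assms by simp
  ultimately show "(start_state n, parity_state n Neutral2 Neutral2) \<in> steps n ^^ (2 * beta (n - 1) + 1)"
    using transfer_reachable[of n "n - 1" "start_state n"] start_state_apply by simp
  fix k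
  assume "(start_state n, parity_state n Neutral2 Neutral2) \<in> steps n ^^ k"
  from play_of_steps[OF this] obtain s w where play_ex: "play s w"
    "\<forall>d. 1 \<le> d \<and> d \<le> n \<longrightarrow> s 0 d = Neutral1"
    "\<forall>d. 1 \<le> d \<and> d \<le> n \<longrightarrow> s k d = parity_state n Neutral2 Neutral2 d" "count_moves w {1..n} 0 k \<le> k"
    by blast
  have play: "play s w" "\<And>d. 1 \<le> d \<Longrightarrow> d \<le> n \<Longrightarrow> s 0 d = Neutral1"
    "\<And>d. 1 \<le> d \<Longrightarrow> d \<le> n \<Longrightarrow> s k d = parity_state n Neutral2 Neutral2 d" "count_moves w {1..n} 0 k \<le> k"
    using play_ex by simp_all
  have at_end: "s k d = Neutral2" if "1 \<le> d" "d \<le> n" for d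
    using play(3)[OF that] that by (simp add: parity_state_def)
  show "2 * beta (n - 1) + 1 \<le> k"
  proof (cases "n = 1")
    case True
    have "k \<noteq> 0"
    proof
      assume "k = 0"
      then show False
        using play(2)[of 1] at_end[of 1] assms by simp
    qed
    then show ?thesis
      using True by simp
  next
    case False
    then have "2 * beta (n - 1) + 1 \<le> count_moves w {1..n} 0 k"
      using assms by (intro transfer_cost[OF play(1) _ play(2) at_end]) simp_all
    then show ?thesis
      using play(4) by simp
  qed
qed

lemma tower_iff:
  "d \<in> tower (Suc (Suc n)) \<longleftrightarrow> 1 \<le> d \<and> d \<le> n \<and> even (d + n)"
  "d \<in> tower (Suc n) \<longleftrightarrow> 1 \<le> d \<and> d \<le> n \<and> odd (d + n)"
  by (auto simp: tower_def less_Suc_eq)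

lemma hard_count:
  assumes "2 \<le> n" and t: "\<And>d. t d = (if d \<in> {1..n} then if even (d + n) then own_peg n else Neutral2 else undefined)"
  shows "min_moves n (start_state n) t = enat (hard_value n)"
proof (rule min_moves_eqI[OF start_state_in])
  have "t = hard_state n (start_state n)"
    by (rule ext) (simp add: t hard_state_def tower_iff[of _ n] start_state_def parity_state_def)
  then show "(start_state n, t) \<in> steps n ^^ hard_value n"
    using hard_reachable[OF b_reachable, of n "n - 2" "start_state n"] start_state_apply assms(1) by simp
  fix k
  assume "(start_state n, t) \<in> steps n ^^ k"
  from play_of_steps[OF this] obtain s w where play_ex: "play s w"
    "\<forall>d. 1 \<le> d \<and> d \<le> n \<longrightarrow> s 0 d = Neutral1"
    "\<forall>d. 1 \<le> d \<and> d \<le> n \<longrightarrow> s k d = t d" "count_moves w {1..n} 0 k \<le> k"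
    by blast
  have play: "play s w" "\<And>d. 1 \<le> d \<Longrightarrow> d \<le> n \<Longrightarrow> s 0 d = Neutral1"
    "\<And>d. 1 \<le> d \<Longrightarrow> d \<le> n \<Longrightarrow> s k d = t d" "count_moves w {1..n} 0 k \<le> k"
    using play_ex by simp_all
  interpret departure s w n k
    by (rule departure.intro[OF play(1)], unfold_locales) (use play t in auto)
  have "on (Suc (Suc n)) k (own_peg n)"
    unfolding on_def
  proof
    fix d assume d: "d \<in> tower (Suc (Suc n))"
    then have "even (d + n)"
      by (auto simp: tower_def)
    then show "s k d = own_peg n"
      using tower_range[OF d, of n] play(3)[of d] t[of d] by simp
  qed
  moreover have "on (Suc n) k Neutral2"
    unfolding on_def
  proof
    fix d assume d: "d \<in> tower (Suc n)"
    then have "odd (d + n)"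
      by (auto simp: tower_def)
    then show "s k d = Neutral2"
      using tower_range[OF d, of n] play(3)[of d] t[of d] by simp
  qed
  ultimately show "hard_value n \<le> k"
    using hard_cost[OF assms(1)] play(4) by (simp add: hard_value_def)
qed

lemma easy_count:
  assumes "2 \<le> n" and t: "\<And>d. t d = (if d \<in> {1..n} then if even (d + n) then Neutral2 else own_peg (Suc n) else undefined)"
  shows "min_moves n (start_state n) t = enat (beta (n - 1) + 2 ^ height n)"
proof (rule min_moves_eqI[OF start_state_in])
  have "t = easy_state n (start_state n)"
    by (rule ext) (simp add: t easy_state_def tower_iff[of _ n] start_state_def parity_state_def)
  then show "(start_state n, t) \<in> steps n ^^ (beta (n - 1) + 2 ^ height n)"
    using easy_reachable[OF b_reachable, of n "n - 1" "start_state n"] start_state_apply assms(1) by simp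
  fix k
  assume "(start_state n, t) \<in> steps n ^^ k"
  from play_of_steps[OF this] obtain s w where play_ex: "play s w"
    "\<forall>d. 1 \<le> d \<and> d \<le> n \<longrightarrow> s 0 d = Neutral1"
    "\<forall>d. 1 \<le> d \<and> d \<le> n \<longrightarrow> s k d = t d" "count_moves w {1..n} 0 k \<le> k"
    by blast
  have play: "play s w" "\<And>d. 1 \<le> d \<Longrightarrow> d \<le> n \<Longrightarrow> s 0 d = Neutral1"
    "\<And>d. 1 \<le> d \<Longrightarrow> d \<le> n \<Longrightarrow> s k d = t d" "count_moves w {1..n} 0 k \<le> k"
    using play_ex by simp_all
  interpret departure s w n k
    by (rule departure.intro[OF play(1)], unfold_locales) (use play t in auto)
  have "on (Suc (Suc n)) k Neutral2"
    unfolding on_def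
  proof
    fix d assume d: "d \<in> tower (Suc (Suc n))"
    then have "even (d + n)"
      by (auto simp: tower_def)
    then show "s k d = Neutral2"
      using tower_range[OF d, of n] play(3)[of d] t[of d] by simp
  qed
  moreover have "on (Suc n) k (own_peg (Suc n))"
    unfolding on_def
  proof
    fix d assume d: "d \<in> tower (Suc n)"
    then have "odd (d + n)"
      by (auto simp: tower_def)
    then show "s k d = own_peg (Suc n)"
      using tower_range[OF d, of n] play(3)[of d] t[of d] by simp
  qed
  ultimately show "beta (n - 1) + 2 ^ height n \<le> k"
    using easy_cost[OF assms(1)] play(4) by simp
qed

lemma c_count_eq:
  assumes "2 \<le> n"
  shows "c_count n = enat (if even n then beta (n - 1) + 2 ^ height n else hard_value n)"
proof (cases "even n")
  case True
  then have "min_moves n (start_state n) (parity_state n OddPeg Neutral2) = enat (beta (n - 1) + 2 ^ height n)"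
    by (intro easy_count[OF assms]) (auto simp: parity_state_def own_peg_def)
  then show ?thesis
    using True by (simp add: c_count_def)
next
  case False
  then have "min_moves n (start_state n) (parity_state n OddPeg Neutral2) = enat (hard_value n)"
    by (intro hard_count[OF assms]) (auto simp: parity_state_def own_peg_def)
  then show ?thesis
    using False by (simp add: c_count_def)
qed

lemma d_count_eq:
  assumes "2 \<le> n"
  shows "d_count n = enat (if odd n then beta (n - 1) + 2 ^ height n else hard_value n)"
proof (cases "odd n")
  case True
  then have "min_moves n (start_state n) (parity_state n Neutral2 EvenPeg) = enat (beta (n - 1) + 2 ^ height n)"
    by (intro easy_count[OF assms]) (auto simp: parity_state_def own_peg_def)
  then show ?thesis
    using True by (simp add: d_count_def)
next
  case False
  then have "min_moves n (start_state n) (parity_state n Neutral2 EvenPeg) = enat (hard_value n)"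
    by (intro hard_count[OF assms]) (auto simp: parity_state_def own_peg_def)
  then show ?thesis
    using False by (simp add: d_count_def)
qed

lemma counts_0: "a_count 0 = 0" "b_count 0 = 0" "c_count 0 = 0" "d_count 0 = 0"
proof -
  have eq: "parity_state 0 p q = own_upto 0 (start_state 0)" for p q
    by (auto simp: parity_state_def start_state_def own_upto_def)
  have "min_moves 0 (start_state 0) (parity_state 0 p q) = 0" for p q
    using b_count_eq[of 0] unfolding b_count_def eq by (simp add: zero_enat_def)
  then show "a_count 0 = 0" "b_count 0 = 0" "c_count 0 = 0" "d_count 0 = 0"
    by (simp_all add: a_count_def b_count_def c_count_def d_count_def)
qed

lemma counts_1: "a_count 1 = 1" "b_count 1 = 1" "c_count 1 = 1" "d_count 1 = 1"
proof -
  have "parity_state 1 p q = parity_state 1 p q'" for p q q'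
    by (auto simp: parity_state_def)
  then have "c_count 1 = b_count 1" "d_count 1 = a_count 1"
    unfolding a_count_def b_count_def c_count_def d_count_def by metis+
  moreover have "a_count 1 = 1" "b_count 1 = 1"
    using a_count_eq[of 1] b_count_eq[of 1] by (simp_all add: one_enat_def)
  ultimately show "a_count 1 = 1" "b_count 1 = 1" "c_count 1 = 1" "d_count 1 = 1"
    by simp_all
qed

lemma beta_eq_hard_value:
  assumes "3 \<le> n"
  shows "beta n = hard_value (n - 1) + 2 ^ height n"
proof -
  have "n - 1 - 2 = n - 3" "n - 1 - 1 = n - 2"
    by simp_all
  then show ?thesis
    using beta_rec[OF assms] two_power(1)[of "height (n - 1)"] by (simp only: hard_value_def) linarith
qed

lemma two_power_h3: "2 ^ k = h3 k + 1"
  by (simp add: h3_def)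

theorem theorem3p1:
  shows "a_count 0 = 0 \<and> b_count 0 = 0 \<and> c_count 0 = 0 \<and> d_count 0 = 0 \<and>
    a_count 1 = 1 \<and> b_count 1 = 1 \<and> c_count 1 = 1 \<and> d_count 1 = 1 \<and>
    (\<forall>n::nat. n \<ge> 2 \<longrightarrow>
      a_count n = 2 * b_count (n - 1) + 1 \<and>
      b_count n =
        (if even n then c_count (n - 1) + enat (h3 ((n - 1) div 2)) + 1
         else d_count (n - 1) + enat (h3 ((n - 1) div 2)) + 1) \<and>
      c_count n =
        (if even n then b_count (n - 1) + enat (h3 ((n - 1) div 2)) + 1
         else b_count (n - 2) + 2 * enat (h3 ((n - 1) div 2)) + enat (h3 ((n - 2) div 2)) + 2) \<and>
      d_count n =
        (if even n then b_count (n - 2) + 3 * enat (h3 ((n - 2) div 2)) + 2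
         else b_count (n - 1) + enat (h3 ((n - 1) div 2)) + 1))"
proof -
  have "a_count n = 2 * b_count (n - 1) + 1 \<and>
      b_count n =
        (if even n then c_count (n - 1) + enat (h3 ((n - 1) div 2)) + 1
         else d_count (n - 1) + enat (h3 ((n - 1) div 2)) + 1) \<and>
      c_count n =
        (if even n then b_count (n - 1) + enat (h3 ((n - 1) div 2)) + 1
         else b_count (n - 2) + 2 * enat (h3 ((n - 1) div 2)) + enat (h3 ((n - 2) div 2)) + 2) \<and>
      d_count n =
        (if even n then b_count (n - 2) + 3 * enat (h3 ((n - 2) div 2)) + 2
         else b_count (n - 1) + enat (h3 ((n - 1) div 2)) + 1)" if n: "2 \<le> n" for n :: nat
  proof -
    have heights: "(n - 1) div 2 = height n" "(n - 2) div 2 = height (n - 1)"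
      by (simp_all add: height_def)
    \<comment> \<open>This merges the two kinds of three-peg terms into the factor 3 in the
      recurrence for \<open>d\<close>.\<close>
    have even_heights: "height (n - 1) = height n" if ev: "even n"
    proof -
      obtain v where "n = 2 * v"
        using ev by (rule evenE)
      then have "n = Suc (Suc (2 * (v - 1)))"
        using n by simp
      then show ?thesis
        by (metis diff_Suc_1 height_double(1,2))
    qed
    note enat = one_enat_def numeral_eq_enat plus_enat_simps times_enat_simps
    have hard: "hard_value n = beta (n - 2) + 2 * h3 (height n) + h3 (height (n - 1)) + 2"
      by (simp add: hard_value_def two_power_h3)
    have a: "a_count n = 2 * b_count (n - 1) + 1"
      using a_count_eq[of n] b_count_eq[of "n - 1"] n by (simp add: enat)
    have b: "b_count n = (if even n then c_count (n - 1) else d_count (n - 1)) + enat (h3 (height n)) + 1"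
    \<comment> \<open>Here the recurrence refers to \<open>c_count 1\<close>, which
      \<open>c_count_eq\<close> does not cover.\<close>
    proof (cases "n = 2")
      case True
      then show ?thesis
        using b_count_eq[of 2] counts_1 by (simp add: enat height_def h3_def numeral_2_eq_2)
    next
      case False
      then have n3: "3 \<le> n" "2 \<le> n - 1" "even (n - 1) \<longleftrightarrow> odd n"
        using n by auto
      have "(if even n then c_count (n - 1) else d_count (n - 1)) = enat (hard_value (n - 1))"
        using c_count_eq[OF n3(2)] d_count_eq[OF n3(2)] n3(3) by simp
      then show ?thesis
        using beta_eq_hard_value[OF n3(1)] b_count_eq[of n] by (simp add: enat two_power_h3)
    qed
    have easy: "enat (beta (n - 1) + 2 ^ height n) = b_count (n - 1) + enat (h3 (height n)) + 1"
      by (simp add: b_count_eq two_power_h3 enat)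
    have c: "c_count n = (if even n then b_count (n - 1) + enat (h3 (height n)) + 1
        else b_count (n - 2) + 2 * enat (h3 (height n)) + enat (h3 (height (n - 1))) + 2)"
      using c_count_eq[OF n] easy hard by (simp add: b_count_eq enat)
    have d: "d_count n = (if even n then b_count (n - 2) + 3 * enat (h3 (height (n - 1))) + 2
        else b_count (n - 1) + enat (h3 (height n)) + 1)"
      using d_count_eq[OF n] easy hard even_heights by (simp add: b_count_eq enat)
    show ?thesis
      using a b c d unfolding heights by simp
  qed
  then show ?thesis
    using counts_0 counts_1 by blast
qed

end
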